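(* Let $A\ge2$ and let $(u_a(n))_{a\in[A],n\in\mathbb{N}_0}$ be the balls-in-bins process with (random) feedback, as defined in the context, with initial condition $(u_a(0))_{a\in[A]}\in\mathbb{N}^A$ and feedback variables distributed as a sequence $(F(j))_{j\in\mathbb{N}_0}$ of independent $(0,\infty)$-valued random variables. Then: 1. Monopoly occurs with probability zero or one. Moreover, monopoly occurs with probability one if and only if $\sum_{j=0}^\infty 1/F(j)<\infty$ almost surely. 2. Strict leadership occurs with probability zero or one. Moreover, strict leadership occurs with probability one if and only if $\sum_{j=0}^\infty 1/F(j)^2<\infty$ almost surely.
   Context: Notation: $[A]=\{1,\dots,A\}$, $\mathbb{N}=\{1,2,\dots\}$, $\mathbb{N}_0=\mathbb{N}\cup\{0\}$. Balls-in-bins process with random feedback. There are $A\ge 2$ urns; urn $a$ contains $u_a(n)$ balls at time $n$, with $u_a(0)\in\mathbb{N}$ given. Let $(F_a(j))_{a\in[A],j\in\mathbb{N}_0}$ be mutually independent $(0,\infty)$-valued random variables such that, for every $a\in[A]$, the sequence $(F_a(j))_{j\in\mathbb{N}_0}$ has the same law as $(F(j))_{j\in\mathbb{N}_0}$ (the law of $F(j)$ may depend on $j$). The process evolves as follows. At time $0$ the variables $F_a(u_a(0))$, $a\in[A]$, are sampled. At time $n+1$, given $(u_b(n))_{b\in[A]}$ and $(F_b(u_b(n)))_{b\in[A]}$, urn $a$ is selected with probability $$\frac{F_a(u_a(n))}{\sum_{b=1}^A F_b(u_b(n))};$$ if urn $a$ is selected then $u_a(n+1)=u_a(n)+1$,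 $u_{a'}(n+1)=u_{a'}(n)$ for $a'\neq a$, and $F_a(u_a(n+1))$ is sampled. Strict leadership: there is $a\in[A]$ such that, for all but finitely many $n$, $u_a(n)>u_{a'}(n)$ for every $a'\ne a$. Monopoly: there is a unique $a\in[A]$ such that $\lim_{n\to\infty}u_a(n)=\infty$. *)

theory Defs
  imports "HOL-Probability.Probability"
begin

locale feedback_sequence = prob_space N
  for N :: "'v measure" +
  fixes X :: "nat \<Rightarrow> 'v \<Rightarrow> real"
  assumes X_indep: "indep_vars (\<lambda>_. borel) X UNIV"
    and X_pos: "\<And>j \<omega>. \<omega> \<in> space N \<Longrightarrow> 0 < X j \<omega>"

text \<open>
  The sigma-algebra with respect to which the selection at time \<open>n + 1\<close> is made: it contains the
  whole feedback family and the evolution of the urns up to time \<open>n\<close>. Sampling a feedback value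
  only when its urn reaches the corresponding size amounts to fixing the family beforehand and
  letting each selection depend on it only through the values already revealed. This is expressed
  by conditioning on all of it and prescribing a conditional probability that involves just the
  current sizes and their feedback values.
\<close>

definition urn_history ::
  "'w measure \<Rightarrow> nat \<Rightarrow> (nat \<Rightarrow> nat \<Rightarrow> 'w \<Rightarrow> real) \<Rightarrow> (nat \<Rightarrow> nat \<Rightarrow> 'w \<Rightarrow> nat) \<Rightarrow> nat \<Rightarrow> 'w measure"
where
  "urn_history M A F u n = sigma (space M)
     ({F a j -` S \<inter> space M | a j S. a \<in> {1..A} \<and> S \<in> sets borel} \<union>
      {u a k -` S \<inter> space M | a k S. a \<in> {1..A} \<and> k \<le> n})"

text \<open>
  \<open>F a j\<close> is the feedback of urn \<open>a\<close> when it contains \<open>j\<close> balls, \<open>u a n\<close> the number of balls in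
  urn \<open>a\<close> at time \<open>n\<close>; the urns are \<open>{1..A}\<close>, and values at other indices are irrelevant.
\<close>

locale balls_in_bins = prob_space M
  for M :: "'w measure" +
  fixes N :: "'v measure"
    and X :: "nat \<Rightarrow> 'v \<Rightarrow> real"
    and A :: nat
    and u0 :: "nat \<Rightarrow> nat"
    and F :: "nat \<Rightarrow> nat \<Rightarrow> 'w \<Rightarrow> real"
    and u :: "nat \<Rightarrow> nat \<Rightarrow> 'w \<Rightarrow> nat"
  assumes F_indep: "indep_vars (\<lambda>_. borel) (\<lambda>(a, j). F a j) ({1..A} \<times> UNIV)"
    and F_pos: "\<And>a j \<omega>. a \<in> {1..A} \<Longrightarrow> \<omega> \<in> space M \<Longrightarrow> 0 < F a j \<omega>"
    and F_law: "\<And>a. a \<in> {1..A} \<Longrightarrow>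
      distr M (Pi\<^sub>M UNIV (\<lambda>_. borel)) (\<lambda>\<omega> j. F a j \<omega>) =
      distr N (Pi\<^sub>M UNIV (\<lambda>_. borel)) (\<lambda>\<omega> j. X j \<omega>)"
    and u_measurable: "\<And>a n. a \<in> {1..A} \<Longrightarrow> u a n \<in> M \<rightarrow>\<^sub>M count_space UNIV"
    and u0_pos: "\<And>a. a \<in> {1..A} \<Longrightarrow> 1 \<le> u0 a"
    and u_init: "\<And>a \<omega>. a \<in> {1..A} \<Longrightarrow> \<omega> \<in> space M \<Longrightarrow> u a 0 \<omega> = u0 a"
    and u_step: "\<And>n \<omega>. \<omega> \<in> space M \<Longrightarrow>
      \<exists>a\<in>{1..A}. u a (n + 1) \<omega> = u a n \<omega> + 1 \<and>
        (\<forall>a'\<in>{1..A} - {a}. u a' (n + 1) \<omega> = u a' n \<omega>)"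
    and selection: "\<And>a n. a \<in> {1..A} \<Longrightarrow>
      AE \<omega> in M. real_cond_exp M (urn_history M A F u n)
          (indicator {\<omega> \<in> space M. u a (n + 1) \<omega> = u a n \<omega> + 1}) \<omega> =
        F a (u a n \<omega>) \<omega> / (\<Sum>b=1..A. F b (u b n \<omega>) \<omega>)"

definition monopoly :: "nat \<Rightarrow> (nat \<Rightarrow> nat \<Rightarrow> nat) \<Rightarrow> bool" where
  "monopoly A v \<longleftrightarrow> (\<exists>!a. a \<in> {1..A} \<and> filterlim (v a) at_top sequentially)"

definition strict_leadership :: "nat \<Rightarrow> (nat \<Rightarrow> nat \<Rightarrow> nat) \<Rightarrow> bool" where
  "strict_leadership A v \<longleftrightarrow>
     (\<exists>a\<in>{1..A}. \<forall>\<^sub>F n in sequentially. \<forall>a'\<in>{1..A} - {a}. v a' n < v a n)"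

text \<open>Both events are measurable, so their probabilities are not default values of \<open>measure\<close>.\<close>

context balls_in_bins
begin

lemma monopoly_event: "{\<omega> \<in> space M. monopoly A (\<lambda>a n. u a n \<omega>)} \<in> events"
proof -
  have "{\<omega> \<in> space M. filterlim (\<lambda>n. u a n \<omega>) at_top sequentially} \<in> events" if "a \<in> {1..A}" for a
  proof -
    note [measurable] = u_measurable[OF that]
    show ?thesis
      unfolding filterlim_at_top eventually_sequentially by measurable
  qed
  then show ?thesis
    unfolding monopoly_def by (intro sets.sets_Collect_countable_Ex1') auto
qed

lemma strict_leadership_event:
  "{\<omega> \<in> space M. strict_leadership A (\<lambda>a n. u a n \<omega>)} \<in> events"
proof -
  have "{\<omega> \<in> space M. u a' n \<omega> < u a n \<omega>} \<in> events" if "a \<in> {1..A}" "a' \<in> {1..A}" for a a' n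
  proof -
    have [measurable]: "u a n \<in> borel_measurable M" "u a' n \<in> borel_measurable M"
      using that by (simp_all add: measurable_compose[OF u_measurable, where g = "\<lambda>x. x"])
    show ?thesis by measurable
  qed
  then show ?thesis
    unfolding strict_leadership_def eventually_sequentially
    by (intro sets.sets_Collect_countable_Ex' sets.sets_Collect_countable_Ex
        sets.sets_Collect_countable_All sets.sets_Collect_imp sets.sets_Collect_const
        sets.sets_Collect_countable_All') auto
qed

end

end

theory Submission
  imports Defs
begin

text \<open>
  Rubin's exponential embedding. Attach to urn \<open>a\<close> holding \<open>j\<close> balls an exponential clock of rate
  \<open>F a j\<close>, all clocks being independent given the feedback, and let the urns jump when their clocks
  ring. Lack of memory of the exponential law shows that the order of the jumps has the law of the
  balls-in-bins process, so that only the independent holding times \<open>H a j\<close> matter: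
  urn \<open>a\<close> leaves size \<open>j\<close> before urn \<open>b\<close> leaves size \<open>k\<close> iff the partial sum of its holding
  times is smaller.

  If \<open>\<Sum>j. 1 / F j\<close> converges, so do the sums of holding times; their limits have no ties, and the urn
  with the smallest one gets a monopoly. If it diverges, all urns grow beyond every bound.
  If \<open>\<Sum>j. 1 / (F j)\<^sup>2\<close> converges, then so do the symmetric sums \<open>\<Sum>j. H a j - H b j\<close>, again without ties,
  and their signs determine a leader; if it diverges, these sums oscillate between \<open>-\<infinity>\<close> and \<open>\<infinity>\<close>,
  and the lead changes for ever. The truncated moments of \<open>H a j\<close> and \<open>1 / F j\<close> are comparable, which
  makes the two conditions interchangeable.
\<close>

section \<open>The race between clocks\<close>

text \<open>The given space need not carry clocks, and \<open>u\<close> is known only through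
  conditional selection probabilities. The race is therefore run on the product of \<open>M\<close>
  with a space of clocks, and only the laws of the two selection sequences are compared: given the
  feedback, a finite path of selections has the same product as its probability on both sides. That
  histories contain the whole feedback family is what allows it to be frozen.

  Continuous time never appears. A jump subtracts the winning clock from those still running, so the
  race is a recursion on steps, and it visits only the jumps before a possible explosion.

  Comparing two urns with each other, and not one urn with its mean, gives symmetric differences.
  Truncating them keeps the mean zero, so no centring series enters, and one series of truncated
  second moments decides between convergence and oscillation. The zero-one statements come from the
  same dichotomy: a deterministic series either converges or does not.\<close>

definition next_urn :: "nat \<Rightarrow> (nat \<Rightarrow> nat) \<Rightarrow> (nat \<times> nat \<Rightarrow> real) \<Rightarrow> nat" where
  "next_urn A v h = (LEAST a. a \<in> {1..A} \<and> (\<forall>b\<in>{1..A}. h (a, v a) \<le> h (b, v b)))"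

text \<open>
  \<open>h (b, j)\<close> is the time that urn \<open>b\<close> spends with \<open>j\<close> balls. When urn \<open>a\<close> jumps, the current clocks of
  the other urns have already run for \<open>h (a, v a)\<close>.
\<close>

definition residual :: "nat \<Rightarrow> (nat \<Rightarrow> nat) \<Rightarrow> nat \<Rightarrow> (nat \<times> nat \<Rightarrow> real) \<Rightarrow> nat \<times> nat \<Rightarrow> real" where
  "residual A v a h = (\<lambda>i. if i \<in> (\<lambda>b. (b, v b)) ` ({1..A} - {a}) then h i - h (a, v a) else h i)"

primrec race :: "nat \<Rightarrow> (nat \<Rightarrow> nat) \<Rightarrow> (nat \<times> nat \<Rightarrow> real) \<Rightarrow> nat \<Rightarrow> nat" where
  "race A v h 0 = next_urn A v h"
| "race A v h (Suc k) =
     race A (v(next_urn A v h := Suc (v (next_urn A v h)))) (residual A v (next_urn A v h) h) k"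

definition urn_count :: "(nat \<Rightarrow> nat) \<Rightarrow> (nat \<Rightarrow> nat) \<Rightarrow> nat \<Rightarrow> nat \<Rightarrow> nat" where
  "urn_count v c a n = v a + card {k. k < n \<and> c k = a}"

text \<open>Selection becomes one inequality per competitor, the form in which lack of memory can
  treat the clocks one by one. It is strict exactly against smaller indices, because ties go to the
  smallest index.\<close>

lemma next_urn_iff:
  assumes "a \<in> {1..A}"
  shows "next_urn A v h = a \<longleftrightarrow>
    (\<forall>b\<in>{1..A} - {a}. if b < a then h (a, v a) < h (b, v b) else h (a, v a) \<le> h (b, v b))"
    (is "_ \<longleftrightarrow> ?R")
proof
  let ?P = "\<lambda>a. a \<in> {1..A} \<and> (\<forall>b\<in>{1..A}. h (a, v a) \<le> h (b, v b))"
  assume eq: "next_urn A v h = a"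
  have "Min ((\<lambda>b. h (b, v b)) ` {1..A}) \<in> (\<lambda>b. h (b, v b)) ` {1..A}"
    using assms by (intro Min_in) auto
  then obtain m where "m \<in> {1..A}" "h (m, v m) = Min ((\<lambda>b. h (b, v b)) ` {1..A})" by fastforce
  then have "?P m" by simp
  then have "?P a" using LeastI[of ?P m] eq unfolding next_urn_def by simp
  moreover have "h (a, v a) < h (b, v b)" if b: "b < a" "b \<in> {1..A}" for b
  proof (rule ccontr)
    assume "\<not> h (a, v a) < h (b, v b)"
    with \<open>?P a\<close> b have "?P b" by fastforce
    then have "a \<le> b" using Least_le[of ?P b] eq unfolding next_urn_def by simp
    with b show False by simp
  qed
  ultimately show ?R by auto
next
  assume R: ?R
  show "next_urn A v h = a"
    unfolding next_urn_def
  proof (rule Least_equality)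
    show "a \<in> {1..A} \<and> (\<forall>b\<in>{1..A}. h (a, v a) \<le> h (b, v b))"
      using R assms by (metis DiffI empty_iff insert_iff less_imp_le order_refl)
  next
    fix b assume b: "b \<in> {1..A} \<and> (\<forall>b'\<in>{1..A}. h (b, v b) \<le> h (b', v b'))"
    show "a \<le> b"
    proof (rule ccontr)
      assume "\<not> a \<le> b"
      then have "h (a, v a) < h (b, v b)" using R b by auto
      with b assms show False by force
    qed
  qed
qed

lemma next_urn_props:
  assumes "1 \<le> A"
  shows next_urn_in: "next_urn A v h \<in> {1..A}"
    and next_urn_le: "b \<in> {1..A} \<Longrightarrow> h (next_urn A v h, v (next_urn A v h)) \<le> h (b, v b)"
proof -
  let ?P = "\<lambda>a. a \<in> {1..A} \<and> (\<forall>b\<in>{1..A}. h (a, v a) \<le> h (b, v b))"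
  have "Min ((\<lambda>b. h (b, v b)) ` {1..A}) \<in> (\<lambda>b. h (b, v b)) ` {1..A}"
    using assms by (intro Min_in) auto
  then obtain m where "m \<in> {1..A}" "h (m, v m) = Min ((\<lambda>b. h (b, v b)) ` {1..A})" by fastforce
  then have "?P m" by simp
  then have "?P (next_urn A v h)" unfolding next_urn_def by (rule LeastI)
  then show "next_urn A v h \<in> {1..A}"
    "b \<in> {1..A} \<Longrightarrow> h (next_urn A v h, v (next_urn A v h)) \<le> h (b, v b)" by auto
qed

lemma race_in: "1 \<le> A \<Longrightarrow> race A v h k \<in> {1..A}"
  by (induction k arbitrary: v h) (use next_urn_in in auto)

lemma urn_count_0 [simp]: "urn_count v c a 0 = v a"
  by (simp add: urn_count_def)

lemma urn_count_Suc: "urn_count v c a (Suc n) = urn_count v c a n + (if c n = a then 1 else 0)"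
proof -
  have "{k. k < Suc n \<and> c k = a} = (if c n = a then insert n else id) {k. k < n \<and> c k = a}"
    by (auto simp: less_Suc_eq)
  then show ?thesis by (auto simp: urn_count_def)
qed

text \<open>\<open>race\<close> moves its first jump into the starting configuration, whereas
  \<open>urn_count\<close> grows at its last step; the shift reconciles the two recursions.\<close>

lemma urn_count_Suc_shift:
  "urn_count v c a (Suc n) = urn_count (v(c 0 := Suc (v (c 0)))) (\<lambda>k. c (Suc k)) a n"
proof (induction n)
  case 0
  show ?case by (simp add: urn_count_Suc)
next
  case (Suc n)
  then show ?case by (simp add: urn_count_Suc[of _ _ _ "Suc n"] urn_count_Suc[of _ _ _ n])
qed

lemma urn_count_ge: "v a \<le> urn_count v c a n"
  by (simp add: urn_count_def)

lemma residual_nonneg: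
  assumes "1 \<le> A" "\<And>i. 0 \<le> h i"
  shows "0 \<le> residual A v (next_urn A v h) h i"
  using next_urn_le[OF assms(1)] assms(2) by (auto simp: residual_def)

lemma sum_residual_selected:
  assumes "v a < l"
  shows "(\<Sum>j=Suc (v a)..l. residual A v a h (a, j)) = (\<Sum>j=v a..l. h (a, j)) - h (a, v a)"
proof -
  have "(\<Sum>j=v a..l. h (a, j)) = h (a, v a) + (\<Sum>j=Suc (v a)..l. h (a, j))"
    using assms by (simp add: sum.atLeast_Suc_atMost)
  moreover have "(\<Sum>j=Suc (v a)..l. residual A v a h (a, j)) = (\<Sum>j=Suc (v a)..l. h (a, j))"
    by (intro sum.cong) (auto simp: residual_def)
  ultimately show ?thesis by simp
qed

lemma sum_residual_other:
  assumes "b \<in> {1..A}" "b \<noteq> a" "v b \<le> l"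
  shows "(\<Sum>j=v b..l. residual A v a h (b, j)) = (\<Sum>j=v b..l. h (b, j)) - h (a, v a)"
proof -
  have "(\<Sum>j=v b..l. h (b, j)) = h (b, v b) + (\<Sum>j=Suc (v b)..l. h (b, j))"
    using assms by (simp add: sum.atLeast_Suc_atMost)
  moreover have "(\<Sum>j=v b..l. residual A v a h (b, j)) =
      residual A v a h (b, v b) + (\<Sum>j=Suc (v b)..l. residual A v a h (b, j))"
    using assms by (simp add: sum.atLeast_Suc_atMost)
  moreover have "(\<Sum>j=Suc (v b)..l. residual A v a h (b, j)) = (\<Sum>j=Suc (v b)..l. h (b, j))"
    by (intro sum.cong) (auto simp: residual_def)
  moreover have "residual A v a h (b, v b) = h (b, v b) - h (a, v a)"
    using assms by (auto simp: residual_def)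
  ultimately show ?thesis by simp
qed

text \<open>The sums are the times at which \<open>a\<close> leaves size \<open>l\<close> and
  \<open>b\<close> leaves size \<open>l'\<close>; by step \<open>n\<close> the first has happened
  and the second has not. The first jump subtracts the same amount from both sums and leaves the
  claim for the residual clocks. The exception is that this jump is itself the exit of
  \<open>a\<close> from \<open>l\<close>; then the left sum is the smallest running clock.\<close>

lemma race_order:
  assumes "1 \<le> A" "\<And>i. 0 \<le> h i" "a \<in> {1..A}" "b \<in> {1..A}"
    and "v a \<le> l" "l < urn_count v (race A v h) a n" "urn_count v (race A v h) b n \<le> l'"
  shows "(\<Sum>j=v a..l. h (a, j)) \<le> (\<Sum>j=v b..l'. h (b, j))"
  using assms(2,5-)
proof (induction n arbitrary: v h)
  case 0
  then show ?case by simp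
next
  case (Suc n)
  define s where "s = next_urn A v h"
  define v' where "v' = v(s := Suc (v s))"
  define h' where "h' = residual A v s h"
  have s: "s \<in> {1..A}" using next_urn_in[OF assms(1)] by (simp add: s_def)
  have shift: "urn_count v (race A v h) x (Suc n) = urn_count v' (race A v' h') x n" for x
    by (simp add: urn_count_Suc_shift v'_def h'_def s_def)
  have vb: "v' b \<le> l'" using Suc.prems(4) urn_count_ge[of v' b] unfolding shift by (meson order_trans)
  have sum_h': "(\<Sum>j=v' x..m. h' (x, j)) = (\<Sum>j=v x..m. h (x, j)) - h (s, v s)"
    if "x \<in> {1..A}" "v' x \<le> m" for x m
    using that sum_residual_selected[of v s m A h] sum_residual_other[of x A s v m h]
    by (cases "x = s") (auto simp: v'_def h'_def)
  show ?case
  proof (cases "v' a \<le> l")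
    case True
    have "(\<Sum>j=v' a..l. h' (a, j)) \<le> (\<Sum>j=v' b..l'. h' (b, j))"
    proof (rule Suc.IH)
      show "0 \<le> h' i" for i using residual_nonneg[OF assms(1) Suc.prems(1)] by (simp add: h'_def s_def)
    qed (use True Suc.prems shift in auto)
    then show ?thesis using sum_h'[OF assms(3) True] sum_h'[OF assms(4) vb] by simp
  next
    case False
    then have "a = s" "l = v a" using Suc.prems(2) by (auto simp: v'_def split: if_splits)
    then have "(\<Sum>j=v a..l. h (a, j)) = h (s, v s)" by simp
    also have "\<dots> \<le> h (b, v b)" using next_urn_le[OF assms(1,4)] by (simp add: s_def)
    also have "v b \<le> l'" using vb by (auto simp: v'_def split: if_splits)
    then have "h (b, v b) \<le> (\<Sum>j=v b..l'. h (b, j))"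
      using Suc.prems(1) by (intro member_le_sum) auto
    finally show ?thesis .
  qed
qed

section \<open>Pathwise consequences of the order of exits\<close>

locale urn_race =
  fixes A :: nat and u0 :: "nat \<Rightarrow> nat" and h :: "nat \<times> nat \<Rightarrow> real" and c :: "nat \<Rightarrow> nat"
  assumes h_nonneg: "0 \<le> h i"
    and c_in: "c k \<in> {1..A}"
    and exit_order: "\<lbrakk>a \<in> {1..A}; b \<in> {1..A}; u0 a \<le> l; l < urn_count u0 c a n; urn_count u0 c b n \<le> l'\<rbrakk>
      \<Longrightarrow> (\<Sum>j=u0 a..l. h (a, j)) \<le> (\<Sum>j=u0 b..l'. h (b, j))"
begin

abbreviation "u \<equiv> urn_count u0 c"

definition exit_time :: "nat \<Rightarrow> nat \<Rightarrow> real" where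
  "exit_time a l = (\<Sum>j=u0 a..l. h (a, j))"

lemma exit_time_order:
  "\<lbrakk>a \<in> {1..A}; b \<in> {1..A}; u0 a \<le> l; l < u a n; u b n \<le> l'\<rbrakk> \<Longrightarrow> exit_time a l \<le> exit_time b l'"
  unfolding exit_time_def by (rule exit_order)

lemma mono_exit_time: "l \<le> l' \<Longrightarrow> exit_time a l \<le> exit_time a l'"
  unfolding exit_time_def by (intro sum_mono2) (auto simp: h_nonneg)

lemma mono_u: "m \<le> n \<Longrightarrow> u a m \<le> u a n"
  by (auto simp: urn_count_def intro!: card_mono)

lemma at_top_iff: "filterlim (u a) at_top sequentially \<longleftrightarrow> (\<forall>K. \<exists>n. K \<le> u a n)"
  unfolding filterlim_at_top eventually_sequentially using mono_u by (meson order_refl order_trans)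

lemma not_at_topE:
  assumes "\<not> filterlim (u a) at_top sequentially"
  obtains K where "\<And>n. u a n \<le> K"
  using assms unfolding at_top_iff by (metis nat_le_linear)

lemma ex_at_top: "\<exists>a\<in>{1..A}. filterlim (u a) at_top sequentially"
proof (rule ccontr)
  assume "\<not> ?thesis"
  then have "\<forall>a\<in>{1..A}. \<exists>K. \<forall>n. u a n \<le> K"
    by (meson not_at_topE)
  then obtain K where K: "\<And>a n. a \<in> {1..A} \<Longrightarrow> u a n \<le> K a"
    by metis
  have total: "n \<le> (\<Sum>a\<in>{1..A}. u a n)" for n
  proof (induction n)
    case (Suc n)
    have "(\<Sum>a\<in>{1..A}. u a (Suc n)) = (\<Sum>a\<in>{1..A}. u a n) + 1"
      using c_in[of n] by (simp add: urn_count_Suc sum.distrib del: atLeastAtMost_iff)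
    with Suc show ?case by simp
  qed simp
  have "Suc (\<Sum>a\<in>{1..A}. K a) \<le> (\<Sum>a\<in>{1..A}. K a)"
    using total K by (meson order_trans sum_mono)
  then show False by simp
qed

lemma reaches:
  assumes "u0 a \<le> l" "filterlim (u a) at_top sequentially"
  obtains n where "u a n = l"
proof -
  obtain N where "l \<le> u a N" using assms(2) at_top_iff by blast
  then have "\<exists>n. u a n = l"
  proof (induction N)
    case (Suc N)
    show ?case
    proof (cases "l = u a (Suc N)")
      case False
      with Suc.prems have "l \<le> u a N" by (simp add: urn_count_Suc split: if_splits)
      then show ?thesis by (rule Suc.IH)
    qed blast
  qed (use assms(1) in \<open>auto intro: exI[of _ 0]\<close>)
  with that show thesis by blast
qed

lemma sum_eq_exit_time:
  assumes "u0 a \<le> l"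
  shows "(\<Sum>j<Suc l. h (a, j)) = (\<Sum>j<u0 a. h (a, j)) + exit_time a l"
proof -
  have "{..<Suc l} = {..<u0 a} \<union> {u0 a..l}" using assms by auto
  then show ?thesis unfolding exit_time_def by (simp add: sum.union_disjoint ivl_disj_int)
qed

lemma exit_time_at_top:
  assumes "\<not> summable (\<lambda>j. h (a, j))"
  obtains l where "u0 a \<le> l" "K < exit_time a l"
proof -
  have "\<exists>l\<ge>u0 a. K < exit_time a l"
  proof (rule ccontr)
    assume "\<not> ?thesis"
    then have le: "exit_time a l \<le> K" if "u0 a \<le> l" for l using that by force
    have "(\<Sum>j<n. h (a, j)) \<le> (\<Sum>j<u0 a. h (a, j)) + K" for n
    proof -
      have "(\<Sum>j<n. h (a, j)) \<le> (\<Sum>j<Suc (max n (u0 a)). h (a, j))"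
        by (intro sum_mono2) (auto simp: h_nonneg)
      also have "\<dots> \<le> (\<Sum>j<u0 a. h (a, j)) + K"
        using sum_eq_exit_time[of a "max n (u0 a)"] le[of "max n (u0 a)"] by simp
      finally show ?thesis .
    qed
    then have "summable (\<lambda>j. h (a, j))"
      using bounded_imp_summable[of "\<lambda>j. h (a, j)"] h_nonneg
      by (metis lessThan_Suc_atMost)
    with assms show False by simp
  qed
  with that show thesis by blast
qed

text \<open>An urn bounded by \<open>K\<close> never leaves size \<open>K\<close>, so
  \<open>exit_time b K\<close> would bound every exit time of an urn that grows for ever. Divergence
  makes those unbounded.\<close>

lemma all_at_top:
  assumes div: "\<And>a. a \<in> {1..A} \<Longrightarrow> \<not> summable (\<lambda>j. h (a, j))" and b: "b \<in> {1..A}"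
  shows "filterlim (u b) at_top sequentially"
proof (rule ccontr)
  assume "\<not> ?thesis"
  then obtain K where K: "\<And>n. u b n \<le> K" using not_at_topE by blast
  obtain a where a: "a \<in> {1..A}" "filterlim (u a) at_top sequentially" using ex_at_top by blast
  obtain l where l: "u0 a \<le> l" "exit_time b K < exit_time a l"
    using exit_time_at_top[OF div[OF a(1)]] by blast
  obtain n where "Suc l \<le> u a n" using a(2) at_top_iff by blast
  then have "exit_time a l \<le> exit_time b K"
    using exit_time_order[OF a(1) b l(1) _ K] by (simp add: Suc_le_eq)
  with l show False by simp
qed

lemma exit_time_LIMSEQ:
  assumes "summable (\<lambda>j. h (a, j))"
  shows "exit_time a \<longlonglongrightarrow> (\<Sum>j. h (a, j)) - (\<Sum>j<u0 a. h (a, j))"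
proof -
  have "(\<lambda>l. (\<Sum>j<Suc l. h (a, j)) - (\<Sum>j<u0 a. h (a, j)))
      \<longlonglongrightarrow> (\<Sum>j. h (a, j)) - (\<Sum>j<u0 a. h (a, j))"
    by (intro tendsto_diff tendsto_const LIMSEQ_Suc summable_LIMSEQ assms)
  moreover have "\<forall>\<^sub>F l in sequentially. (\<Sum>j<Suc l. h (a, j)) - (\<Sum>j<u0 a. h (a, j)) = exit_time a l"
    using eventually_ge_at_top[of "u0 a"] by eventually_elim (simp add: sum_eq_exit_time del: sum.lessThan_Suc)
  ultimately show ?thesis by (rule Lim_transform_eventually)
qed

text \<open>Two urns that both grow for ever leave all their sizes, so each exit time of one is
  bounded by an exit time of the other, and their limits \<open>T\<close> coincide. This is the tie
  that \<open>ne\<close> excludes.\<close>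

lemma monopoly_if_summable:
  assumes sm: "\<And>a. a \<in> {1..A} \<Longrightarrow> summable (\<lambda>j. h (a, j))"
    and ne: "\<And>a b. \<lbrakk>a \<in> {1..A}; b \<in> {1..A}; a \<noteq> b\<rbrakk> \<Longrightarrow> \<not> (\<lambda>l. exit_time a l - exit_time b l) \<longlonglongrightarrow> 0"
  shows "monopoly A u"
proof -
  define T where "T a = (\<Sum>j. h (a, j)) - (\<Sum>j<u0 a. h (a, j))" for a
  have lim: "exit_time a \<longlonglongrightarrow> T a" if "a \<in> {1..A}" for a
    unfolding T_def by (rule exit_time_LIMSEQ[OF sm[OF that]])
  have le: "T b \<le> T a" if a: "a \<in> {1..A}" "filterlim (u a) at_top sequentially"
    and b: "b \<in> {1..A}" "filterlim (u b) at_top sequentially" for a b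
  proof (rule LIMSEQ_le_const2[OF lim[OF b(1)]], intro exI[of _ "u0 b"] allI impI)
    fix l assume l: "u0 b \<le> l"
    obtain n where n: "Suc l \<le> u b n" using b(2) at_top_iff by blast
    have "exit_time b l \<le> exit_time a (u a n)" using exit_time_order[OF b(1) a(1) l, of n] n by simp
    also have "\<dots> \<le> T a"
      using mono_exit_time by (intro LIMSEQ_le_const[OF lim[OF a(1)]]) blast
    finally show "exit_time b l \<le> T a" .
  qed
  have "a = b" if a: "a \<in> {1..A}" "filterlim (u a) at_top sequentially"
    and b: "b \<in> {1..A}" "filterlim (u b) at_top sequentially" for a b
  proof (rule ccontr)
    assume "a \<noteq> b"
    have "T a = T b" using le[OF a b] le[OF b a] by simp
    then have "(\<lambda>l. exit_time a l - exit_time b l) \<longlonglongrightarrow> 0"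
      using tendsto_diff[OF lim[OF a(1)] lim[OF b(1)]] by simp
    with ne[OF a(1) b(1) \<open>a \<noteq> b\<close>] show False by simp
  qed
  with ex_at_top show ?thesis unfolding monopoly_def by blast
qed

lemma strict_leadership_if_monopoly:
  assumes "monopoly A u"
  shows "strict_leadership A u"
proof -
  from assms obtain a where a: "a \<in> {1..A}" "filterlim (u a) at_top sequentially"
    and uniq: "\<And>b. b \<in> {1..A} \<Longrightarrow> filterlim (u b) at_top sequentially \<Longrightarrow> b = a"
    unfolding monopoly_def by blast
  have "\<forall>\<^sub>F n in sequentially. \<forall>b\<in>{1..A} - {a}. u b n < u a n"
  proof (rule eventually_ball_finite)
    show "\<forall>b\<in>{1..A} - {a}. \<forall>\<^sub>F n in sequentially. u b n < u a n"
    proof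
      fix b assume b: "b \<in> {1..A} - {a}"
      then obtain K where K: "\<And>n. u b n \<le> K" using uniq not_at_topE by blast
      have "\<forall>\<^sub>F n in sequentially. Suc K \<le> u a n" using a(2) unfolding filterlim_at_top by blast
      then show "\<forall>\<^sub>F n in sequentially. u b n < u a n"
        by eventually_elim (use K in \<open>metis Suc_le_lessD le_less_trans\<close>)
    qed
  qed simp
  with a(1) show ?thesis unfolding strict_leadership_def by blast
qed

text \<open>Only differences of exit times are known to converge, so the urns are ranked by limits
  relative to an arbitrary urn \<open>r\<close>. The urn with the least limit is eventually earlier
  than each rival by a positive margin.\<close>

lemma strict_leadership_if_convergent:
  assumes top: "\<And>a. a \<in> {1..A} \<Longrightarrow> filterlim (u a) at_top sequentially"
    and zero: "\<And>a. a \<in> {1..A} \<Longrightarrow> (\<lambda>j. h (a, j)) \<longlonglongrightarrow> 0"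
    and conv: "\<And>a b. \<lbrakk>a \<in> {1..A}; b \<in> {1..A}\<rbrakk> \<Longrightarrow> convergent (\<lambda>l. exit_time a l - exit_time b l)"
    and ne: "\<And>a b. \<lbrakk>a \<in> {1..A}; b \<in> {1..A}; a \<noteq> b\<rbrakk> \<Longrightarrow> \<not> (\<lambda>l. exit_time a l - exit_time b l) \<longlonglongrightarrow> 0"
  shows "strict_leadership A u"
proof -
  obtain r where r: "r \<in> {1..A}" using c_in by blast
  define L where "L a = lim (\<lambda>l. exit_time a l - exit_time r l)" for a
  have L: "(\<lambda>l. exit_time a l - exit_time r l) \<longlonglongrightarrow> L a" if "a \<in> {1..A}" for a
    unfolding L_def using conv[OF that r] by (simp add: convergent_LIMSEQ_iff)
  have Ld: "(\<lambda>l. exit_time a l - exit_time b l) \<longlonglongrightarrow> L a - L b" if "a \<in> {1..A}" "b \<in> {1..A}" for a b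
    using tendsto_diff[OF L[OF that(1)] L[OF that(2)]] by simp
  have "Min (L ` {1..A}) \<in> L ` {1..A}" using r by (intro Min_in) auto
  then obtain a where a: "a \<in> {1..A}" and La: "L a = Min (L ` {1..A})" by fastforce
  have "\<forall>\<^sub>F n in sequentially. \<forall>b\<in>{1..A} - {a}. u b n < u a n"
  proof (rule eventually_ball_finite)
    show "\<forall>b\<in>{1..A} - {a}. \<forall>\<^sub>F n in sequentially. u b n < u a n"
    proof
      fix b assume b: "b \<in> {1..A} - {a}"
      have "L a \<le> L b" using La b by simp
      moreover have "L a \<noteq> L b" using ne[OF a, of b] Ld[OF a, of b] b by auto
      ultimately have "L a - L b < 0" by simp
      \<comment> \<open>If \<open>b\<close> holds \<open>Suc l\<close> balls and \<open>a\<close> no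
        more, the order of exits compares \<open>exit_time b l\<close> with
        \<open>exit_time a (Suc l)\<close>, one index apart. The vanishing holding time of
        \<open>b\<close> bridges this shift.\<close>
      moreover have "(\<lambda>l. exit_time a l - exit_time b l + h (b, l)) \<longlonglongrightarrow> L a - L b + 0"
        using b by (intro tendsto_add Ld a zero) auto
      ultimately have "\<forall>\<^sub>F l in sequentially. exit_time a l - exit_time b l + h (b, l) < 0"
        using order_tendstoD(2)[of _ "L a - L b + 0" sequentially 0] by simp
      then obtain k where k: "\<And>l. k \<le> l \<Longrightarrow> exit_time a l - exit_time b l + h (b, l) < 0"
        unfolding eventually_sequentially by blast
      have "\<forall>\<^sub>F n in sequentially. Suc (Suc (k + u0 b)) \<le> u b n"
        using top[of b] b unfolding filterlim_at_top by blast
      then show "\<forall>\<^sub>F n in sequentially. u b n < u a n"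
      proof eventually_elim
        case (elim n)
        show ?case
        proof (rule ccontr)
          assume "\<not> u b n < u a n"
          then have le: "u a n \<le> u b n" by simp
          obtain l where l: "u b n = Suc l" using elim by (cases "u b n") auto
          then have lb: "u0 b \<le> l" "k \<le> l" "u0 b < Suc l" using elim by auto
          have "exit_time b l \<le> exit_time a (u b n)"
            using exit_time_order[of b a l n "u b n"] b a lb le l by simp
          moreover have "exit_time b (Suc l) = exit_time b l + h (b, Suc l)"
            using lb by (simp add: exit_time_def)
          ultimately show False using k[of "Suc l"] lb l by simp
        qed
      qed
    qed
  qed simp
  with a show ?thesis unfolding strict_leadership_def by blast
qed

text \<open>Against a supposed leader \<open>a\<close>, take a late size \<open>l\<close> that
  \<open>b\<close> leaves strictly earlier than \<open>a\<close>. At the step where \<open>a\<close>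
  reaches \<open>Suc l\<close>, urn \<open>b\<close> must already have left \<open>l\<close>, so it
  is not behind.\<close>

lemma no_strict_leadership:
  assumes "2 \<le> A"
    and top: "\<And>a. a \<in> {1..A} \<Longrightarrow> filterlim (u a) at_top sequentially"
    and osc: "\<And>a b m. \<lbrakk>a \<in> {1..A}; b \<in> {1..A}; a \<noteq> b\<rbrakk> \<Longrightarrow> \<exists>l\<ge>m. exit_time b l < exit_time a l"
  shows "\<not> strict_leadership A u"
proof
  assume "strict_leadership A u"
  then obtain a where a: "a \<in> {1..A}" and ev: "\<forall>\<^sub>F n in sequentially. \<forall>b\<in>{1..A} - {a}. u b n < u a n"
    unfolding strict_leadership_def by blast
  obtain b where b: "b \<in> {1..A} - {a}" using assms(1) by (cases "a = 1") (auto intro: that[of 1] that[of 2])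
  from ev obtain n0 where n0: "\<And>n. n0 \<le> n \<Longrightarrow> u b n < u a n"
    unfolding eventually_sequentially using b by blast
  obtain l where l: "u a n0 \<le> l" "exit_time b l < exit_time a l"
    using osc[of a b "u a n0"] a b by auto
  have ul: "u0 a \<le> l" using urn_count_ge[of u0 a c n0] l(1) by simp
  then obtain n where n: "u a n = Suc l" using reaches[of a "Suc l"] top[OF a] by auto
  have "n0 \<le> n"
  proof (rule ccontr)
    assume "\<not> n0 \<le> n"
    then have "u a n \<le> u a n0" by (intro mono_u) simp
    with n l(1) show False by simp
  qed
  then have "u b n \<le> l" using n0[of n] n by simp
  then have "exit_time a l \<le> exit_time b l" using exit_time_order[of a b l n l] a b ul n by simp
  with l show False by simp
qed

lemma exit_time_diff:
  assumes "u0 a \<le> l" "u0 b \<le> l"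
  shows "exit_time a l - exit_time b l
    = (\<Sum>j<Suc l. h (a, j) - h (b, j)) - ((\<Sum>j<u0 a. h (a, j)) - (\<Sum>j<u0 b. h (b, j)))"
  using sum_eq_exit_time[OF assms(1)] sum_eq_exit_time[OF assms(2)]
  by (simp only: sum_subtractf)

lemma convergent_exit_time_diff:
  assumes "convergent (\<lambda>n. \<Sum>j<n. h (a, j) - h (b, j))"
  shows "convergent (\<lambda>l. exit_time a l - exit_time b l)"
proof -
  obtain L where L: "(\<lambda>n. \<Sum>j<n. h (a, j) - h (b, j)) \<longlonglongrightarrow> L"
    using assms by (auto simp: convergent_def)
  define C where "C = (\<Sum>j<u0 a. h (a, j)) - (\<Sum>j<u0 b. h (b, j))"
  have "(\<lambda>l. (\<Sum>j<Suc l. h (a, j) - h (b, j)) - C) \<longlonglongrightarrow> L - C"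
    by (intro tendsto_diff tendsto_const LIMSEQ_Suc L)
  moreover have "\<forall>\<^sub>F l in sequentially. (\<Sum>j<Suc l. h (a, j) - h (b, j)) - C = exit_time a l - exit_time b l"
    using eventually_ge_at_top[of "max (u0 a) (u0 b)"]
    by eventually_elim (simp only: exit_time_diff max.bounded_iff C_def)
  ultimately have "(\<lambda>l. exit_time a l - exit_time b l) \<longlonglongrightarrow> L - C" by (rule Lim_transform_eventually)
  then show ?thesis by (auto simp: convergent_def)
qed

lemma exit_time_oscillation:
  assumes "\<forall>K::nat. \<exists>n. real K < (\<Sum>j<n. h (a, j) - h (b, j))"
  shows "\<exists>l\<ge>m. exit_time b l < exit_time a l"
proof -
  define s where "s n = (\<Sum>j<n. h (a, j) - h (b, j))" for n
  define C where "C = (\<Sum>j<u0 a. h (a, j)) - (\<Sum>j<u0 b. h (b, j))"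
  define m' where "m' = Suc (max m (max (u0 a) (u0 b)))"
  \<comment> \<open>\<open>K\<close> dominates both the correction \<open>C\<close> for unequal
    initial sizes and all partial sums up to \<open>m'\<close>; an index at which the sum exceeds
    \<open>K\<close> therefore lies beyond \<open>m'\<close>.\<close>
  obtain K :: nat where K: "max C (\<Sum>i\<le>m'. \<bar>s i\<bar>) \<le> K" using real_arch_simple by blast
  obtain n where n: "real K < s n" using assms unfolding s_def by blast
  have "m' < n"
  proof (rule ccontr)
    assume "\<not> m' < n"
    then have "\<bar>s n\<bar> \<le> (\<Sum>i\<le>m'. \<bar>s i\<bar>)" by (intro member_le_sum) auto
    with n K show False by linarith
  qed
  then obtain l where l: "n = Suc l" "m' \<le> l" by (cases n) auto
  then have "exit_time a l - exit_time b l = s n - C"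
    by (subst exit_time_diff) (auto simp: m'_def s_def C_def)
  then have "exit_time b l < exit_time a l" using n K by simp
  moreover have "m \<le> l" using l by (simp add: m'_def)
  ultimately show ?thesis by blast
qed

end

section \<open>Sums of independent random variables\<close>

text \<open>The terms of a convergent series are eventually below 1, so the truncation changes only
  finitely many of them.\<close>

lemma summable_min_one_iff:
  fixes x :: "nat \<Rightarrow> real"
  assumes "\<And>j. 0 \<le> x j"
  shows "summable (\<lambda>j. min 1 (x j)) \<longleftrightarrow> summable x"
proof
  assume s: "summable (\<lambda>j. min 1 (x j))"
  have "\<forall>\<^sub>F j in sequentially. min 1 (x j) < 1"
    using summable_LIMSEQ_zero[OF s] by (rule order_tendstoD) simp
  then have "\<forall>\<^sub>F j in sequentially. min 1 (x j) = x j" by eventually_elim auto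
  then show "summable x" using s summable_cong by metis
next
  assume "summable x"
  then show "summable (\<lambda>j. min 1 (x j))"
    by (rule summable_comparison_test'[of _ 0]) (use assms in auto)
qed

text \<open>Turns summability of \<open>1 - cos\<close> back into summability of squares. The
  expansion to fourth order would give the constant 1/2 - 1/24; 1/4 is a convenient smaller
  one.\<close>

lemma cos_le_one_minus_square:
  fixes x :: real
  assumes "\<bar>x\<bar> \<le> 1"
  shows "x\<^sup>2 / 4 \<le> 1 - cos x"
proof -
  obtain t where "cos x = (\<Sum>m<4. cos_coeff m * x ^ m) + cos (t + 1 / 2 * real 4 * pi) / fact 4 * x ^ 4"
    using Maclaurin_cos_expansion[of x 4] by blast
  moreover have "{..<4} = {0, 1, 2, 3 :: nat}" by auto
  then have "(\<Sum>m<4. cos_coeff m * x ^ m) = 1 - x\<^sup>2 / 2"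
    by (simp add: cos_coeff_def)
  moreover have "cos (t + 1 / 2 * real 4 * pi) / fact 4 * x ^ 4 \<le> 1 / fact 4 * x ^ 4"
    by (intro mult_right_mono divide_right_mono) auto
  moreover have "(1 :: real) / fact 4 * x ^ 4 = x ^ 4 / 24" by (simp add: eval_nat_numeral)
  moreover have "x ^ 4 \<le> x\<^sup>2"
    using assms power_decreasing[of 2 4 "\<bar>x\<bar>"] by simp
  ultimately have "cos x \<le> 1 - x\<^sup>2 / 2 + x\<^sup>2 / 24" by linarith
  moreover have "0 \<le> x\<^sup>2" by simp
  ultimately show ?thesis by linarith
qed

lemma cos_ge_one_minus_half_square: "1 - x\<^sup>2 / 2 \<le> cos (x :: real)"
proof -
  have "cos x = 1 - 2 * (sin (x / 2))\<^sup>2" using cos_double_sin[of "x / 2"] by simp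
  moreover have "(sin (x / 2))\<^sup>2 \<le> (x / 2)\<^sup>2"
    using abs_sin_x_le_abs_x[of "x / 2"] by (simp only: abs_le_square_iff)
  ultimately show ?thesis by (simp add: power_divide)
qed

lemma exp_minus_le:
  fixes z :: real
  assumes "0 \<le> z" "z \<le> 1"
  shows "exp (- z) \<le> 1 - z / 2"
proof -
  have "1 + z \<le> exp z" by simp
  then have "exp (- z) \<le> 1 / (1 + z)"
    using assms by (simp add: exp_minus field_simps)
  also have "\<dots> \<le> 1 - z / 2"
  proof -
    have "z * z \<le> z" using assms mult_left_le[of z z] by simp
    then show ?thesis using assms by (simp add: field_simps)
  qed
  finally show ?thesis .
qed

context prob_space
begin

lemma AE_summable_if_summable_expectation:
  fixes Z :: "nat \<Rightarrow> 'a \<Rightarrow> real"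
  assumes int: "\<And>j. integrable M (Z j)" and nonneg: "\<And>j \<omega>. \<omega> \<in> space M \<Longrightarrow> 0 \<le> Z j \<omega>"
    and s: "summable (\<lambda>j. expectation (Z j))"
  shows "AE \<omega> in M. summable (\<lambda>j. Z j \<omega>)"
proof -
  have [measurable]: "Z j \<in> borel_measurable M" for j using int by auto
  have "(\<integral>\<^sup>+\<omega>. (\<Sum>j. ennreal (Z j \<omega>)) \<partial>M) = (\<Sum>j. \<integral>\<^sup>+\<omega>. ennreal (Z j \<omega>) \<partial>M)"
    by (rule nn_integral_suminf) measurable
  also have "\<dots> = (\<Sum>j. ennreal (expectation (Z j)))"
    using nonneg by (intro suminf_cong nn_integral_eq_integral int) auto
  also have "\<dots> = ennreal (\<Sum>j. expectation (Z j))"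
    using nonneg s by (intro suminf_ennreal2) (auto intro!: Bochner_Integration.integral_nonneg_AE)
  finally have "(\<integral>\<^sup>+\<omega>. (\<Sum>j. ennreal (Z j \<omega>)) \<partial>M) \<noteq> \<infinity>" by simp
  then have "AE \<omega> in M. (\<Sum>j. ennreal (Z j \<omega>)) \<noteq> \<infinity>"
    by (intro nn_integral_PInf_AE) measurable
  then show ?thesis
    by (rule AE_mp) (use nonneg in \<open>auto intro!: AE_I2 summable_suminf_not_top\<close>)
qed

text \<open>As \<open>Z j\<close> lies between 0 and 1, the mean of \<open>exp (- Z j)\<close> is at
  most \<open>exp (- expectation (Z j) / 2)\<close>, and by independence these factors multiply.
  Divergence of the means sends the Laplace transform of the partial sums to 0, and Markov's
  inequality for \<open>exp (K - sum)\<close> leaves probability 0 for any common bound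
  \<open>K\<close>.\<close>

lemma AE_not_summable_if_indep:
  fixes Z :: "nat \<Rightarrow> 'a \<Rightarrow> real"
  assumes ind: "indep_vars (\<lambda>_. borel) Z UNIV"
    and bound: "\<And>j \<omega>. \<omega> \<in> space M \<Longrightarrow> 0 \<le> Z j \<omega>" "\<And>j \<omega>. \<omega> \<in> space M \<Longrightarrow> Z j \<omega> \<le> 1"
    and ns: "\<not> summable (\<lambda>j. expectation (Z j))"
  shows "AE \<omega> in M. \<not> summable (\<lambda>j. Z j \<omega>)"
proof -
  have [measurable]: "Z j \<in> borel_measurable M" for j using ind by (auto simp: indep_vars_def)
  have int: "integrable M (Z j)" for j
    using bound by (intro integrable_const_bound[where B=1]) auto
  have EZ: "0 \<le> expectation (Z j)" for j using bound by (intro integral_nonneg_AE) auto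
  have factor: "expectation (\<lambda>\<omega>. exp (- Z j \<omega>)) \<le> exp (- expectation (Z j) / 2)" for j
  proof -
    have "expectation (\<lambda>\<omega>. exp (- Z j \<omega>)) \<le> expectation (\<lambda>\<omega>. 1 - Z j \<omega> / 2)"
      using bound int exp_minus_le
      by (intro integral_mono_AE integrable_const_bound[where B=1 and f="\<lambda>\<omega>. exp (- Z j \<omega>)"]) auto
    also have "\<dots> = 1 - expectation (Z j) / 2"
      using int by (simp add: prob_space)
    also have "\<dots> \<le> exp (- expectation (Z j) / 2)"
      using exp_ge_add_one_self[of "- expectation (Z j) / 2"] by simp
    finally show ?thesis .
  qed
  have prod: "expectation (\<lambda>\<omega>. exp (- (\<Sum>j<n. Z j \<omega>))) \<le> exp (- (\<Sum>j<n. expectation (Z j)) / 2)" for n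
  proof -
    have "expectation (\<lambda>\<omega>. exp (- (\<Sum>j<n. Z j \<omega>))) = expectation (\<lambda>\<omega>. \<Prod>j<n. exp (- Z j \<omega>))"
      by (simp add: exp_sum flip: sum_negf)
    also have "\<dots> = (\<Prod>j<n. expectation (\<lambda>\<omega>. exp (- Z j \<omega>)))"
      by (intro indep_vars_lebesgue_integral indep_vars_compose2[OF indep_vars_subset[OF ind]])
        (use bound in \<open>auto intro!: integrable_const_bound[where B=1]\<close>)
    also have "\<dots> \<le> (\<Prod>j<n. exp (- expectation (Z j) / 2))"
      by (intro prod_mono conjI factor) (auto intro!: Bochner_Integration.integral_nonneg)
    also have "\<dots> = exp (- (\<Sum>j<n. expectation (Z j)) / 2)"
      by (simp flip: exp_sum add: sum_negf sum_divide_distrib)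
    finally show ?thesis .
  qed
  have div: "filterlim (\<lambda>n. \<Sum>j<n. expectation (Z j)) at_top sequentially"
  proof -
    have "\<exists>n. K \<le> (\<Sum>j<n. expectation (Z j))" for K
    proof (rule ccontr)
      assume "\<not> ?thesis"
      then have "summable (\<lambda>j. expectation (Z j))"
        by (intro bounded_imp_summable[of _ K] EZ) (metis le_cases lessThan_Suc_atMost)
      with ns show False by simp
    qed
    moreover have "mono (\<lambda>n. \<Sum>j<n. expectation (Z j))"
      by (intro monoI sum_mono2) (auto simp: EZ)
    ultimately show ?thesis
      unfolding filterlim_at_top eventually_sequentially mono_def by (meson order_trans)
  qed
  have null: "prob {\<omega> \<in> space M. \<forall>n. (\<Sum>j<n. Z j \<omega>) \<le> K} = 0" for K :: real
  proof -
    have le: "prob {\<omega> \<in> space M. \<forall>n. (\<Sum>j<n. Z j \<omega>) \<le> K} \<le> exp K * exp (- (\<Sum>j<n. expectation (Z j)) / 2)" for n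
    proof -
      have "prob {\<omega> \<in> space M. \<forall>n. (\<Sum>j<n. Z j \<omega>) \<le> K} =
          expectation (indicator {\<omega> \<in> space M. \<forall>n. (\<Sum>j<n. Z j \<omega>) \<le> K})" by simp
      also have "\<dots> \<le> expectation (\<lambda>\<omega>. exp K * exp (- (\<Sum>j<n. Z j \<omega>)))"
        by (intro integral_mono_AE integrable_mult_right integrable_const_bound[where B=1] AE_I2)
          (use bound in \<open>auto simp: indicator_def sum_nonneg simp flip: exp_add\<close>)
      also have "\<dots> \<le> exp K * exp (- (\<Sum>j<n. expectation (Z j)) / 2)"
        using prod[of n] by simp
      finally show ?thesis .
    qed
    have "(\<lambda>n. exp K * exp (- (\<Sum>j<n. expectation (Z j)) / 2)) \<longlonglongrightarrow> exp K * 0"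
    proof (intro tendsto_mult tendsto_const filterlim_compose[OF exp_at_bot])
      show "filterlim (\<lambda>n. - (\<Sum>j<n. expectation (Z j)) / 2) at_bot sequentially"
        using filterlim_tendsto_pos_mult_at_bot[of "\<lambda>_. 1 / 2 :: real" "1 / 2" sequentially
            "\<lambda>n. - (\<Sum>j<n. expectation (Z j))"] div
        by (simp add: filterlim_uminus_at_bot)
    qed
    then have "prob {\<omega> \<in> space M. \<forall>n. (\<Sum>j<n. Z j \<omega>) \<le> K} \<le> 0"
      by (intro LIMSEQ_le_const[of "\<lambda>n. exp K * exp (- (\<Sum>j<n. expectation (Z j)) / 2)"])
        (use le in auto)
    then show ?thesis by (simp add: measure_le_0_iff)
  qed
  have "AE \<omega> in M. \<forall>K::nat. \<not> (\<forall>n. (\<Sum>j<n. Z j \<omega>) \<le> real K)"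
  proof (subst AE_all_countable, rule allI)
    fix K :: nat
    have "AE \<omega> in M. \<omega> \<notin> {\<omega> \<in> space M. \<forall>n. (\<Sum>j<n. Z j \<omega>) \<le> K}"
      by (intro AE_not_in null_setsI) (auto simp: emeasure_eq_measure null)
    then show "AE \<omega> in M. \<not> (\<forall>n. (\<Sum>j<n. Z j \<omega>) \<le> real K)" by (rule AE_mp) auto
  qed
  then show ?thesis
  proof (rule AE_mp, intro AE_I2 impI notI)
    fix \<omega> assume \<omega>: "\<omega> \<in> space M" and K: "\<forall>K::nat. \<not> (\<forall>n. (\<Sum>j<n. Z j \<omega>) \<le> real K)"
      and s: "summable (\<lambda>j. Z j \<omega>)"
    obtain K :: nat where "(\<Sum>j. Z j \<omega>) \<le> K" using real_arch_simple by blast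
    moreover have "(\<Sum>j<n. Z j \<omega>) \<le> (\<Sum>j. Z j \<omega>)" for n
      using s bound(1)[OF \<omega>] by (intro sum_le_suminf) auto
    ultimately show False using K by (meson order_trans)
  qed
qed

end

section \<open>Kolmogorov's maximal inequality and the one-series theorem\<close>

text \<open>Freezing the partial sums at the first exceedance of \<open>e\<close> turns the maximal inequality into
  Markov's inequality for a second moment.\<close>

primrec stopped_sum :: "real \<Rightarrow> (nat \<Rightarrow> real) \<Rightarrow> nat \<Rightarrow> real" where
  "stopped_sum e y 0 = 0"
| "stopped_sum e y (Suc k) = stopped_sum e y k + (if \<bar>stopped_sum e y k\<bar> < e then y k else 0)"

text \<open>Stopping is decided by earlier values only, which makes the stopped sum independent of
  the next summand.\<close>

lemma stopped_sum_restrict: "k \<le> n \<Longrightarrow> stopped_sum e (restrict y {..<n}) k = stopped_sum e y k"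
  by (induction k) auto

lemma measurable_stopped_sum:
  "k \<le> n \<Longrightarrow> (\<lambda>y. stopped_sum e y k) \<in> borel_measurable (PiM {..<n} (\<lambda>_. borel))"
proof (induction k)
  case (Suc k)
  then have [measurable]: "(\<lambda>y. stopped_sum e y k) \<in> borel_measurable (PiM {..<n} (\<lambda>_. borel))"
    "(\<lambda>y. y k) \<in> borel_measurable (PiM {..<n} (\<lambda>_. borel :: real measure))" by auto
  show ?case by simp
qed simp

lemma stopped_sum_stays: "k \<le> n \<Longrightarrow> e \<le> \<bar>stopped_sum e y k\<bar> \<Longrightarrow> stopped_sum e y n = stopped_sum e y k"
  by (induction n rule: dec_induct) auto

lemma stopped_sum_exceeds:
  assumes "e \<le> \<bar>\<Sum>j<k. y j\<bar>" "k \<le> n"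
  shows "e \<le> \<bar>stopped_sum e y n\<bar>"
proof (rule ccontr)
  assume "\<not> ?thesis"
  then have small: "\<bar>stopped_sum e y i\<bar> < e" if "i \<le> n" for i
    using stopped_sum_stays[OF that] by (metis not_le)
  have "stopped_sum e y i = (\<Sum>j<i. y j)" if "i \<le> n" for i
    using that
  proof (induction i)
    case (Suc i)
    then show ?case using small[of i] by simp
  qed simp
  with assms small[of k] show False by auto
qed

lemma abs_stopped_sum_le: "(\<And>j. \<bar>y j\<bar> \<le> 1) \<Longrightarrow> \<bar>stopped_sum e y k\<bar> \<le> real k"
proof (induction k)
  case (Suc k)
  show ?case
    using Suc.IH[OF Suc.prems] Suc.prems[of k] abs_triangle_ineq[of "stopped_sum e y k" "y k"] by auto
qed simp

context prob_space
begin

lemma indep_var_past: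
  fixes Y :: "nat \<Rightarrow> 'a \<Rightarrow> real"
  assumes ind: "indep_vars (\<lambda>_. borel) Y UNIV"
    and f: "f \<in> borel_measurable (PiM {..<k} (\<lambda>_. borel))"
  shows "indep_var borel (\<lambda>\<omega>. f (\<lambda>i\<in>{..<k}. Y i \<omega>)) borel (Y k)"
proof -
  have "indep_var borel (f \<circ> (\<lambda>\<omega>. \<lambda>i\<in>{..<k}. Y i \<omega>)) borel ((\<lambda>f. f k) \<circ> (\<lambda>\<omega>. \<lambda>i\<in>{k}. Y i \<omega>))"
    by (intro indep_var_compose[OF indep_var_restrict[OF ind]] f) auto
  then show ?thesis by (simp add: comp_def)
qed

text \<open>The increment of the stopped sum \<open>T\<close> is \<open>Y k\<close> or 0 according
  to the past. So the cross term of its second moment has mean zero, and each step adds at most the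
  second moment of \<open>Y k\<close>. An exceedance before \<open>n\<close> persists in
  \<open>T\<close> until \<open>n\<close>, where Markov's inequality applies.\<close>

lemma kolmogorov_maximal:
  fixes Y :: "nat \<Rightarrow> 'a \<Rightarrow> real"
  assumes ind: "indep_vars (\<lambda>_. borel) Y UNIV"
    and bound: "\<And>j \<omega>. \<bar>Y j \<omega>\<bar> \<le> 1"
    and mean: "\<And>j. expectation (Y j) = 0" and "0 < e"
  shows "prob {\<omega> \<in> space M. \<exists>k\<le>n. e \<le> \<bar>\<Sum>j<k. Y j \<omega>\<bar>} \<le> (\<Sum>j<n. expectation (\<lambda>\<omega>. (Y j \<omega>)\<^sup>2)) / e\<^sup>2"
proof -
  have [measurable]: "Y j \<in> borel_measurable M" for j using ind by (auto simp: indep_vars_def)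
  define T where "T k \<omega> = stopped_sum e (\<lambda>i. Y i \<omega>) k" for k \<omega>
  have T_Suc: "T (Suc k) \<omega> = T k \<omega> + (if \<bar>T k \<omega>\<bar> < e then Y k \<omega> else 0)" for k \<omega>
    by (simp add: T_def)
  have T_meas [measurable]: "T k \<in> borel_measurable M" for k
  proof (induction k)
    case (Suc k) then show ?case unfolding T_Suc by measurable
  qed (simp add: T_def)
  have T_bound: "\<bar>T k \<omega>\<bar> \<le> k" for k \<omega> unfolding T_def by (rule abs_stopped_sum_le[OF bound])
  have T2_int: "integrable M (\<lambda>\<omega>. (T k \<omega>)\<^sup>2)" for k
    using T_bound by (intro integrable_const_bound[where B="(real k)\<^sup>2"])
      (auto intro!: AE_I2 simp flip: abs_le_square_iff)
  have Y2_int: "integrable M (\<lambda>\<omega>. (Y k \<omega>)\<^sup>2)" for k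
    using bound by (intro integrable_const_bound[where B=1]) (auto intro!: AE_I2 simp: abs_square_le_1)
  have var: "expectation (\<lambda>\<omega>. (T k \<omega>)\<^sup>2) \<le> (\<Sum>j<k. expectation (\<lambda>\<omega>. (Y j \<omega>)\<^sup>2))" for k
  proof (induction k)
    case 0
    show ?case by (simp add: T_def)
  next
    case (Suc k)
    \<comment> \<open>\<open>g\<close> moves the decision to stop into the factor that depends on
      the past, so that the cross term is a product of independent variables.\<close>
    define g where "g x = (if \<bar>x\<bar> < e then x else 0)" for x :: real
    have [measurable]: "g \<in> borel_measurable borel" unfolding g_def by measurable
    have g_bound: "\<bar>g x\<bar> \<le> e" for x using \<open>0 < e\<close> by (auto simp: g_def)
    note [measurable] = measurable_stopped_sum[of k k e, OF order_refl]
    have "indep_var borel (\<lambda>\<omega>. g (stopped_sum e (\<lambda>i\<in>{..<k}. Y i \<omega>) k)) borel (Y k)"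
      by (rule indep_var_past[OF ind, of "\<lambda>y. g (stopped_sum e y k)"]) measurable
    then have gY: "indep_var borel (\<lambda>\<omega>. g (T k \<omega>)) borel (Y k)"
      by (simp add: stopped_sum_restrict T_def)
    have int: "integrable M (\<lambda>\<omega>. g (T k \<omega>))" "integrable M (Y k)"
      using g_bound bound by (auto intro!: integrable_const_bound[where B=e and f="\<lambda>\<omega>. g (T k \<omega>)"]
          integrable_const_bound[where B=1 and f="Y k"])
    have cross: "expectation (\<lambda>\<omega>. g (T k \<omega>) * Y k \<omega>) = 0"
      using indep_var_lebesgue_integral[OF gY int] mean by simp
    have cross_int: "integrable M (\<lambda>\<omega>. g (T k \<omega>) * Y k \<omega>)"
      by (rule indep_var_integrable[OF gY int])
    have "expectation (\<lambda>\<omega>. (T (Suc k) \<omega>)\<^sup>2)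
        \<le> expectation (\<lambda>\<omega>. (T k \<omega>)\<^sup>2 + 2 * (g (T k \<omega>) * Y k \<omega>) + (Y k \<omega>)\<^sup>2)"
      by (intro integral_mono T2_int Bochner_Integration.integrable_add integrable_mult_right cross_int Y2_int)
        (auto simp: T_Suc g_def power2_sum)
    also have "\<dots> = expectation (\<lambda>\<omega>. (T k \<omega>)\<^sup>2) + expectation (\<lambda>\<omega>. (Y k \<omega>)\<^sup>2)"
      using T2_int cross_int Y2_int cross by simp
    finally show ?case using Suc by simp
  qed
  have "prob {\<omega> \<in> space M. \<exists>k\<le>n. e \<le> \<bar>\<Sum>j<k. Y j \<omega>\<bar>} \<le> prob {\<omega> \<in> space M. e\<^sup>2 \<le> (T n \<omega>)\<^sup>2}"
  proof (intro finite_measure_mono subsetI)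
    fix \<omega> assume "\<omega> \<in> {\<omega> \<in> space M. \<exists>k\<le>n. e \<le> \<bar>\<Sum>j<k. Y j \<omega>\<bar>}"
    then show "\<omega> \<in> {\<omega> \<in> space M. e\<^sup>2 \<le> (T n \<omega>)\<^sup>2}"
      using \<open>0 < e\<close> stopped_sum_exceeds[of e "\<lambda>i. Y i \<omega>" _ n]
      by (auto simp: T_def simp flip: abs_le_square_iff)
  qed measurable
  also have "\<dots> \<le> expectation (\<lambda>\<omega>. (T n \<omega>)\<^sup>2) / e\<^sup>2"
    using \<open>0 < e\<close> by (intro integral_Markov_inequality_measure[where A="{}"] T2_int) auto
  also have "\<dots> \<le> (\<Sum>j<n. expectation (\<lambda>\<omega>. (Y j \<omega>)\<^sup>2)) / e\<^sup>2"
    by (intro divide_right_mono var) simp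
  finally show ?thesis .
qed

lemma indep_vars_shift:
  assumes "indep_vars (\<lambda>_. N) Y (UNIV :: nat set)"
  shows "indep_vars (\<lambda>_. N) (\<lambda>j. Y (n + j)) UNIV"
proof -
  have "indep_vars (\<lambda>j. PiM {n + j} (\<lambda>_. N)) (\<lambda>j \<omega>. \<lambda>i\<in>{n + j}. Y i \<omega>) UNIV"
    by (intro indep_vars_restrict[OF assms]) (auto simp: disjoint_family_on_def)
  from indep_vars_compose2[OF this, of "\<lambda>j f. f (n + j)" "\<lambda>_. N"] show ?thesis by simp
qed

text \<open>The maximal inequality after index \<open>n\<close> bounds the chance that some block
  sum starting at \<open>n\<close> reaches \<open>e\<close> by a tail of the variance series. This
  tends to 0, and running \<open>e\<close> through \<open>1 / Suc i\<close> makes the partial sums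
  Cauchy.\<close>

lemma AE_convergent_if_indep:
  fixes Y :: "nat \<Rightarrow> 'a \<Rightarrow> real"
  assumes ind: "indep_vars (\<lambda>_. borel) Y UNIV"
    and bound: "\<And>j \<omega>. \<bar>Y j \<omega>\<bar> \<le> 1"
    and mean: "\<And>j. expectation (Y j) = 0"
    and s: "summable (\<lambda>j. expectation (\<lambda>\<omega>. (Y j \<omega>)\<^sup>2))"
  shows "AE \<omega> in M. convergent (\<lambda>n. \<Sum>j<n. Y j \<omega>)"
proof -
  have [measurable]: "Y j \<in> borel_measurable M" for j using ind by (auto simp: indep_vars_def)
  define V where "V j = expectation (\<lambda>\<omega>. (Y j \<omega>)\<^sup>2)" for j
  have V: "0 \<le> V j" for j by (simp add: V_def)
  define B where "B e n m = {\<omega> \<in> space M. \<exists>k\<le>m. e \<le> \<bar>\<Sum>j<k. Y (n + j) \<omega>\<bar>}" for e n m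
  have B_ev [measurable]: "B e n m \<in> events" for e n m unfolding B_def by measurable
  have tail: "prob (\<Union>m. B e n m) \<le> (\<Sum>j. V (n + j)) / e\<^sup>2" if "0 < e" for e n
  proof (rule LIMSEQ_le_const2[OF finite_Lim_measure_incseq])
    show "range (B e n) \<subseteq> events" by auto
    show "incseq (B e n)" by (auto simp: incseq_def B_def) (meson order_trans)
    have "prob (B e n m) \<le> (\<Sum>j. V (n + j)) / e\<^sup>2" for m
    proof -
      have "prob (B e n m) \<le> (\<Sum>j<m. V (n + j)) / e\<^sup>2"
        unfolding B_def V_def
        by (rule kolmogorov_maximal[OF indep_vars_shift[OF ind]]) (use bound mean that in auto)
      also have "\<dots> \<le> (\<Sum>j. V (n + j)) / e\<^sup>2"
        using s V by (intro divide_right_mono sum_le_suminf)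
          (auto simp: V_def summable_iff_shift[of "\<lambda>j. expectation (\<lambda>\<omega>. (Y j \<omega>)\<^sup>2)"] add.commute[of n])
      finally show ?thesis .
    qed
    then show "\<exists>N. \<forall>m\<ge>N. prob (B e n m) \<le> (\<Sum>j. V (n + j)) / e\<^sup>2" by blast
  qed
  have null: "prob (\<Inter>n. \<Union>m. B e n m) = 0" if e: "0 < e" for e
  proof -
    have "(\<lambda>n. (\<Sum>j. V (j + n)) / e\<^sup>2) \<longlonglongrightarrow> 0 / e\<^sup>2"
      using e s unfolding V_def by (intro tendsto_divide tendsto_const suminf_exist_split2) auto
    moreover have "prob (\<Inter>n. \<Union>m. B e n m) \<le> (\<Sum>j. V (j + n)) / e\<^sup>2" for n
    proof -
      have "prob (\<Inter>n. \<Union>m. B e n m) \<le> prob (\<Union>m. B e n m)"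
        by (intro finite_measure_mono) auto
      with tail[OF e, of n] show ?thesis by (simp add: add.commute)
    qed
    ultimately have "prob (\<Inter>n. \<Union>m. B e n m) \<le> 0"
      by (intro LIMSEQ_le_const[of "\<lambda>n. (\<Sum>j. V (j + n)) / e\<^sup>2"]) auto
    then show ?thesis by (simp add: measure_le_0_iff)
  qed
  have "AE \<omega> in M. \<forall>i. \<omega> \<notin> (\<Inter>n. \<Union>m. B (1 / Suc i) n m)"
    unfolding AE_all_countable
  proof (intro allI AE_not_in null_setsI)
    fix i :: nat
    show "emeasure M (\<Inter>n. \<Union>m. B (1 / Suc i) n m) = 0"
      using null[of "1 / Suc i"] by (simp add: emeasure_eq_measure)
  qed measurable
  then show ?thesis
  proof (rule AE_mp, intro AE_I2 impI)
    fix \<omega> assume \<omega>: "\<omega> \<in> space M" and small: "\<forall>i. \<omega> \<notin> (\<Inter>n. \<Union>m. B (1 / Suc i) n m)"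
    have "Cauchy (\<lambda>n. \<Sum>j<n. Y j \<omega>)"
    proof (rule CauchyI')
      fix e :: real assume "0 < e"
      \<comment> \<open>Two block sums starting at \<open>n\<close> will be compared, hence half of
        \<open>e\<close> for each.\<close>
      obtain i where i: "1 / real (Suc i) < e / 2" using \<open>0 < e\<close> nat_approx_posE[of "e / 2"] by auto
      from small obtain n where n: "\<omega> \<notin> (\<Union>m. B (1 / Suc i) n m)" by blast
      then have lt: "\<bar>\<Sum>j<k. Y (n + j) \<omega>\<bar> < 1 / Suc i" for k using \<omega> by (auto simp: B_def not_le)
      have split: "(\<Sum>j<n + k. Y j \<omega>) = (\<Sum>j<n. Y j \<omega>) + (\<Sum>j<k. Y (n + j) \<omega>)" for k
        by (induction k) auto
      show "\<exists>N. \<forall>m\<ge>N. \<forall>k>m. dist (\<Sum>j<m. Y j \<omega>) (\<Sum>j<k. Y j \<omega>) < e"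
      proof (intro exI[of _ n] allI impI)
        fix m k assume "n \<le> m" "m < k"
        then have "dist (\<Sum>j<m. Y j \<omega>) (\<Sum>j<k. Y j \<omega>) =
            \<bar>(\<Sum>j<m - n. Y (n + j) \<omega>) - (\<Sum>j<k - n. Y (n + j) \<omega>)\<bar>"
          using split[of "m - n"] split[of "k - n"] by (simp add: dist_real_def)
        also have "\<dots> < e" using lt[of "m - n"] lt[of "k - n"] i by linarith
        finally show "dist (\<Sum>j<m. Y j \<omega>) (\<Sum>j<k. Y j \<omega>) < e" .
      qed
    qed
    then show "convergent (\<lambda>n. \<Sum>j<n. Y j \<omega>)" by (rule Cauchy_convergent)
  qed
qed

section \<open>Series of independent symmetric variables\<close>

lemma expectation_odd:
  fixes X :: "'a \<Rightarrow> real" and f :: "real \<Rightarrow> real"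
  assumes [measurable]: "X \<in> borel_measurable M" "f \<in> borel_measurable borel"
    and sym: "distr M borel (\<lambda>\<omega>. - X \<omega>) = distr M borel X"
    and odd: "\<And>x. f (- x) = - f x"
  shows "expectation (\<lambda>\<omega>. f (X \<omega>)) = 0"
proof -
  have "expectation (\<lambda>\<omega>. f (X \<omega>)) = (\<integral>x. f x \<partial>distr M borel (\<lambda>\<omega>. - X \<omega>))"
    by (subst sym) (simp add: integral_distr)
  also have "\<dots> = - expectation (\<lambda>\<omega>. f (X \<omega>))"
    by (simp add: integral_distr odd)
  finally show ?thesis by simp
qed

text \<open>For symmetric summands the characteristic function is real and equals the mean of the
  cosine. In the addition formula the sine of the new summand has mean zero, so only the product of
  cosines remains.\<close>

lemma expectation_cos_sum:
  fixes Y :: "nat \<Rightarrow> 'a \<Rightarrow> real"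
  assumes ind: "indep_vars (\<lambda>_. borel) Y UNIV"
    and sym: "\<And>j. distr M borel (\<lambda>\<omega>. - Y j \<omega>) = distr M borel (Y j)"
  shows "expectation (\<lambda>\<omega>. cos (t * (\<Sum>j<n. Y j \<omega>))) = (\<Prod>j<n. expectation (\<lambda>\<omega>. cos (t * Y j \<omega>)))"
proof (induction n)
  case 0
  show ?case by (simp add: prob_space)
next
  case (Suc n)
  have Y [measurable]: "Y j \<in> borel_measurable M" for j using ind by (auto simp: indep_vars_def)
  have iv: "indep_var borel (\<lambda>\<omega>. \<Sum>j<n. Y j \<omega>) borel (Y n)"
    using indep_var_past[OF ind, of "\<lambda>y. \<Sum>j<n. y j" n] by simp
  have int: "integrable M (\<lambda>\<omega>. cos (t * Z \<omega>))" "integrable M (\<lambda>\<omega>. sin (t * Z \<omega>))"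
    if [measurable]: "Z \<in> borel_measurable M" for Z
    by (auto intro!: integrable_const_bound[where B=1])
  have c: "indep_var borel (\<lambda>\<omega>. cos (t * (\<Sum>j<n. Y j \<omega>))) borel (\<lambda>\<omega>. cos (t * Y n \<omega>))"
    and s: "indep_var borel (\<lambda>\<omega>. sin (t * (\<Sum>j<n. Y j \<omega>))) borel (\<lambda>\<omega>. sin (t * Y n \<omega>))"
    using indep_var_compose[OF iv, of "\<lambda>x. cos (t * x)" borel "\<lambda>x. cos (t * x)" borel]
      indep_var_compose[OF iv, of "\<lambda>x. sin (t * x)" borel "\<lambda>x. sin (t * x)" borel]
    by (simp_all add: comp_def)
  have zero: "expectation (\<lambda>\<omega>. sin (t * Y n \<omega>)) = 0"
    by (rule expectation_odd[OF Y _ sym, of "\<lambda>x. sin (t * x)"]) auto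
  have "expectation (\<lambda>\<omega>. cos (t * (\<Sum>j<Suc n. Y j \<omega>))) =
      expectation (\<lambda>\<omega>. cos (t * (\<Sum>j<n. Y j \<omega>)) * cos (t * Y n \<omega>) - sin (t * (\<Sum>j<n. Y j \<omega>)) * sin (t * Y n \<omega>))"
    by (simp add: distrib_left cos_add)
  also have "\<dots> = expectation (\<lambda>\<omega>. cos (t * (\<Sum>j<n. Y j \<omega>)) * cos (t * Y n \<omega>))
      - expectation (\<lambda>\<omega>. sin (t * (\<Sum>j<n. Y j \<omega>)) * sin (t * Y n \<omega>))"
    by (intro Bochner_Integration.integral_diff indep_var_integrable[OF c] indep_var_integrable[OF s] int) auto
  also have "\<dots> = expectation (\<lambda>\<omega>. cos (t * (\<Sum>j<n. Y j \<omega>))) * expectation (\<lambda>\<omega>. cos (t * Y n \<omega>))"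
    using zero by (subst indep_var_lebesgue_integral[OF c], auto intro!: int)
      (subst indep_var_lebesgue_integral[OF s], auto intro!: int)
  finally show ?case using Suc by simp
qed

text \<open>Cutting off outside [-1, 1] is an odd operation, so the mean stays zero and the
  one-series theorem applies without centring. Almost sure summability of the truncated squares
  means that only finitely many summands were cut off.\<close>

lemma AE_convergent_if_symmetric:
  fixes Y :: "nat \<Rightarrow> 'a \<Rightarrow> real"
  assumes ind: "indep_vars (\<lambda>_. borel) Y UNIV"
    and sym: "\<And>j. distr M borel (\<lambda>\<omega>. - Y j \<omega>) = distr M borel (Y j)"
    and s: "summable (\<lambda>j. expectation (\<lambda>\<omega>. min 1 ((Y j \<omega>)\<^sup>2)))"
  shows "AE \<omega> in M. convergent (\<lambda>n. \<Sum>j<n. Y j \<omega>)"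
proof -
  have Y [measurable]: "Y j \<in> borel_measurable M" for j using ind by (auto simp: indep_vars_def)
  define f where "f x = (if \<bar>x\<bar> \<le> 1 then x else 0)" for x :: real
  have [measurable]: "f \<in> borel_measurable borel" unfolding f_def by measurable
  have int: "integrable M (\<lambda>\<omega>. min 1 ((Y j \<omega>)\<^sup>2))" for j
    by (intro integrable_const_bound[where B=1]) auto
  have "AE \<omega> in M. convergent (\<lambda>n. \<Sum>j<n. f (Y j \<omega>))"
  proof (rule AE_convergent_if_indep)
    show "indep_vars (\<lambda>_. borel) (\<lambda>j \<omega>. f (Y j \<omega>)) UNIV"
      by (rule indep_vars_compose2[OF ind]) auto
    show "expectation (\<lambda>\<omega>. f (Y j \<omega>)) = 0" for j
      by (rule expectation_odd[OF Y _ sym]) (auto simp: f_def)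
    show "summable (\<lambda>j. expectation (\<lambda>\<omega>. (f (Y j \<omega>))\<^sup>2))"
    proof (rule summable_comparison_test'[OF s])
      fix j
      have "expectation (\<lambda>\<omega>. (f (Y j \<omega>))\<^sup>2) \<le> expectation (\<lambda>\<omega>. min 1 ((Y j \<omega>)\<^sup>2))"
        by (intro integral_mono int integrable_const_bound[where B=1])
          (auto simp: f_def abs_square_le_1)
      then show "norm (expectation (\<lambda>\<omega>. (f (Y j \<omega>))\<^sup>2)) \<le> expectation (\<lambda>\<omega>. min 1 ((Y j \<omega>)\<^sup>2))"
        by simp
    qed
  qed (auto simp: f_def)
  moreover have "AE \<omega> in M. summable (\<lambda>j. min 1 ((Y j \<omega>)\<^sup>2))"
    by (rule AE_summable_if_summable_expectation[OF int _ s]) auto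
  ultimately show ?thesis
  proof eventually_elim
    case (elim \<omega>)
    have "\<forall>\<^sub>F j in sequentially. min 1 ((Y j \<omega>)\<^sup>2) < 1"
      using summable_LIMSEQ_zero[OF elim(2)] by (rule order_tendstoD) simp
    then have "\<forall>\<^sub>F j in sequentially. f (Y j \<omega>) = Y j \<omega>"
      by eventually_elim (auto simp: f_def min_def abs_square_less_1 split: if_splits)
    then have "summable (\<lambda>j. f (Y j \<omega>)) \<longleftrightarrow> summable (\<lambda>j. Y j \<omega>)" by (rule summable_cong)
    then show ?case using elim(1) by (simp add: summable_iff_convergent)
  qed
qed

text \<open>Dropping the first \<open>n\<close> summands shifts all later partial sums by a
  constant, so unboundedness above is a tail event.\<close>

lemma prob_unbounded_sums_zero_one:
  fixes Y :: "nat \<Rightarrow> 'a \<Rightarrow> real"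
  assumes ind: "indep_vars (\<lambda>_. borel) Y UNIV"
  defines "U \<equiv> {\<omega> \<in> space M. \<forall>K::nat. \<exists>n. real K < (\<Sum>j<n. Y j \<omega>)}"
  shows "prob U = 0 \<or> prob U = 1"
proof (rule kolmogorov_0_1_law)
  define E where "E j = {Y j -` B \<inter> space M | B. B \<in> sets borel}" for j
  show "sigma_algebra (space M) (E j)" for j
    using sets.sigma_algebra_axioms[of "vimage_algebra (space M) (Y j) borel"]
    by (simp add: E_def sets_vimage_algebra2)
  show "indep_sets E UNIV" using ind unfolding indep_vars_def2 E_def by simp
  show "U \<in> tail_events E"
    unfolding tail_events_def
  proof
    fix n :: nat
    define G where "G = sigma (space M) (\<Union> (E ` {n..}))"
    have sub: "\<Union> (E ` {n..}) \<subseteq> Pow (space M)" by (auto simp: E_def)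
    have [simp]: "space G = space M" by (simp add: G_def space_measure_of_conv)
    have setsG: "sets G = sigma_sets (space M) (\<Union> (E ` {n..}))"
      unfolding G_def by (rule sets_measure_of[OF sub])
    have Ym: "Y (n + j) \<in> borel_measurable G" for j
    proof (rule measurableI)
      fix B :: "real set" assume "B \<in> sets borel"
      then have "Y (n + j) -` B \<inter> space M \<in> \<Union> (E ` {n..})"
        by (auto simp: E_def intro!: bexI[of _ "n + j"])
      then show "Y (n + j) -` B \<inter> space G \<in> sets G" by (auto simp: setsG)
    qed simp
    note [measurable] = Ym
    have "U = {\<omega> \<in> space G. \<forall>K::nat. \<exists>m. real K < (\<Sum>j<m. Y (n + j) \<omega>)}"
    proof -
      have split: "(\<Sum>j<n + k. Y j \<omega>) = (\<Sum>j<n. Y j \<omega>) + (\<Sum>j<k. Y (n + j) \<omega>)" for k \<omega>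
        by (induction k) auto
      have "(\<forall>K::nat. \<exists>m. real K < (\<Sum>j<m. Y j \<omega>)) \<longleftrightarrow> (\<forall>K::nat. \<exists>m. real K < (\<Sum>j<m. Y (n + j) \<omega>))" for \<omega>
      proof safe
        fix K :: nat assume *: "\<forall>K::nat. \<exists>m. real K < (\<Sum>j<m. Y j \<omega>)"
        \<comment> \<open>\<open>K'\<close> also exceeds every partial sum up to \<open>n\<close>,
          so that the index found for it lies past the dropped summands.\<close>
        obtain K' :: nat where K': "real K + (\<Sum>j<n. Y j \<omega>) \<le> K'" "(\<Sum>i\<le>n. \<bar>\<Sum>j<i. Y j \<omega>\<bar>) \<le> K'"
          using real_arch_simple[of "max (real K + (\<Sum>j<n. Y j \<omega>)) (\<Sum>i\<le>n. \<bar>\<Sum>j<i. Y j \<omega>\<bar>)"] by auto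
        from * obtain m where m: "real K' < (\<Sum>j<m. Y j \<omega>)" by blast
        have "n \<le> m"
        proof (rule ccontr)
          assume "\<not> n \<le> m"
          then have "\<bar>\<Sum>j<m. Y j \<omega>\<bar> \<le> (\<Sum>i\<le>n. \<bar>\<Sum>j<i. Y j \<omega>\<bar>)"
            by (intro member_le_sum) auto
          with m K' show False by linarith
        qed
        then have "real K < (\<Sum>j<m - n. Y (n + j) \<omega>)" using m K' split[of \<omega> "m - n"] by simp
        then show "\<exists>m. real K < (\<Sum>j<m. Y (n + j) \<omega>)" by blast
      next
        fix K :: nat assume *: "\<forall>K::nat. \<exists>m. real K < (\<Sum>j<m. Y (n + j) \<omega>)"
        obtain K' :: nat where K': "real K - (\<Sum>j<n. Y j \<omega>) \<le> K'" using real_arch_simple by blast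
        from * obtain m where "real K' < (\<Sum>j<m. Y (n + j) \<omega>)" by blast
        then have "real K < (\<Sum>j<n + m. Y j \<omega>)" using K' split[of \<omega> m] by simp
        then show "\<exists>m. real K < (\<Sum>j<m. Y j \<omega>)" by blast
      qed
      then show ?thesis by (simp add: U_def)
    qed
    also have "\<dots> \<in> sets G" by measurable
    finally show "U \<in> sigma_sets (space M) (\<Union> (E ` {n..}))" by (simp add: setsG)
  qed
qed

text \<open>By the zero-one law it is enough that the event is not null. If it were, then by
  symmetry unboundedness below would be null too, and almost all paths would have bounded partial
  sums; this is what is refuted.\<close>

lemma AE_unbounded_if_symmetric:
  fixes Y :: "nat \<Rightarrow> 'a \<Rightarrow> real"
  assumes ind: "indep_vars (\<lambda>_. borel) Y UNIV"
    and sym: "\<And>j. distr M borel (\<lambda>\<omega>. - Y j \<omega>) = distr M borel (Y j)"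
    and ns: "\<not> summable (\<lambda>j. expectation (\<lambda>\<omega>. min 1 ((Y j \<omega>)\<^sup>2)))"
  shows "AE \<omega> in M. \<forall>K::nat. \<exists>n. real K < (\<Sum>j<n. Y j \<omega>)"
proof -
  have Y [measurable]: "Y j \<in> borel_measurable M" for j using ind by (auto simp: indep_vars_def)
  have indm: "indep_vars (\<lambda>_. borel) (\<lambda>j \<omega>. - Y j \<omega>) UNIV"
    by (rule indep_vars_compose2[OF ind]) auto
  define W where "W = {y \<in> space (PiM UNIV (\<lambda>_::nat. borel :: real measure)). \<forall>K::nat. \<exists>n. real K < (\<Sum>j<n. y j)}"
  have W [measurable]: "W \<in> sets (PiM UNIV (\<lambda>_::nat. borel :: real measure))"
    unfolding W_def by measurable
  define U where "U = {\<omega> \<in> space M. \<forall>K::nat. \<exists>n. real K < (\<Sum>j<n. Y j \<omega>)}"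
  define U' where "U' = {\<omega> \<in> space M. \<forall>K::nat. \<exists>n. real K < (\<Sum>j<n. - Y j \<omega>)}"
  have [measurable]: "U \<in> events" "U' \<in> events" unfolding U_def U'_def by measurable
  \<comment> \<open>Independent families with equal marginals have equal joint laws, so reversing
    all signs at once preserves the probability of an event about the whole sequence.\<close>
  have law: "distr M (PiM UNIV (\<lambda>_. borel)) (\<lambda>\<omega> j. - Y j \<omega>) = distr M (PiM UNIV (\<lambda>_. borel)) (\<lambda>\<omega> j. Y j \<omega>)"
    using indep_vars_iff_distr_eq_PiM[of UNIV Y "\<lambda>_. borel"] ind
      indep_vars_iff_distr_eq_PiM[of UNIV "\<lambda>j \<omega>. - Y j \<omega>" "\<lambda>_. borel"] indm
    by (simp add: sym restrict_UNIV)
  have "prob U' = measure (distr M (PiM UNIV (\<lambda>_. borel)) (\<lambda>\<omega> j. - Y j \<omega>)) W"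
    by (subst measure_distr[OF _ W])
      (auto simp: U'_def W_def space_PiM intro!: arg_cong[where f=prob] measurable_PiM_single')
  also have "\<dots> = prob U"
    unfolding law by (subst measure_distr[OF _ W])
      (auto simp: U_def W_def space_PiM intro!: arg_cong[where f=prob] measurable_PiM_single')
  finally have UU': "prob U' = prob U" .
  have "prob U \<noteq> 0"
  proof
    assume "prob U = 0"
    then have nul: "U \<in> null_sets M" "U' \<in> null_sets M"
      using UU' by (auto simp: emeasure_eq_measure intro!: null_setsI)
    define B where "B k = {\<omega> \<in> space M. \<forall>n. \<bar>\<Sum>j<n. Y j \<omega>\<bar> \<le> real k}" for k :: nat
    have B [measurable]: "B k \<in> events" for k unfolding B_def by measurable
    have "AE \<omega> in M. \<omega> \<in> (\<Union>k. B k)"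
      using AE_not_in[OF nul(1)] AE_not_in[OF nul(2)] AE_space
    proof eventually_elim
      case (elim \<omega>)
      then obtain K K' :: nat where K: "\<And>n. (\<Sum>j<n. Y j \<omega>) \<le> K" "\<And>n. - (\<Sum>j<n. Y j \<omega>) \<le> K'"
        by (auto simp: U_def U'_def not_less sum_negf)
      have "\<bar>\<Sum>j<n. Y j \<omega>\<bar> \<le> real (K + K')" for n using K[of n] by (simp add: abs_le_iff)
      then have "\<omega> \<in> B (K + K')" using elim by (simp add: B_def)
      then show ?case by blast
    qed
    then have one: "prob (\<Union>k. B k) = 1" by (subst prob_eq_1) auto
    have "(\<lambda>k. prob (B k)) \<longlonglongrightarrow> prob (\<Union>k. B k)"
      by (rule finite_Lim_measure_incseq) (auto simp: incseq_def B_def intro: order_trans)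
    then have "\<forall>\<^sub>F k in sequentially. 9 / 10 < prob (B k)"
      by (rule order_tendstoD) (simp add: one)
    then obtain k where k: "9 / 10 < prob (B k)" by (auto simp: eventually_sequentially)
    \<comment> \<open>sums bounded with high probability keep the characteristic functions, which are products, away
      from \<open>0\<close>; so \<open>\<Sum>j. E (1 - cos (t * Y j))\<close> converges, and hence \<open>\<Sum>j. (Y j)\<^sup>2\<close> does where all sums are bounded\<close>
    define t where "t = 1 / (2 * (real k + 1))"
    have t: "0 < t" "t * real k \<le> 1 / 2" by (auto simp: t_def field_simps)
    have small: "\<bar>t * (\<Sum>j<n. Y j \<omega>)\<bar> \<le> 1 / 2" if "\<omega> \<in> B k" for n \<omega>
    proof -
      have "\<bar>t * (\<Sum>j<n. Y j \<omega>)\<bar> \<le> t * real k"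
        using t that by (auto simp: abs_mult B_def intro!: mult_left_mono)
      with t show ?thesis by simp
    qed
    \<comment> \<open>On \<open>B k\<close> the argument is at most 1/2 in absolute value, so the
      cosine is at least 7/8; elsewhere it is at least -1. The mean is thus at least
      \<open>15 / 8 * prob (B k) - 1\<close>, and 9/10 is large enough to keep this above
      1/2.\<close>
    have half: "1 / 2 \<le> (\<Prod>j<n. expectation (\<lambda>\<omega>. cos (t * Y j \<omega>)))" for n
    proof -
      have intB: "integrable M (\<lambda>\<omega>. 15 / 8 * indicator (B k) \<omega> :: real)"
        by (intro integrable_mult_right integrable_real_indicator) (auto simp: emeasure_eq_measure)
      then have "7 / 8 * prob (B k) - (1 - prob (B k)) = expectation (\<lambda>\<omega>. 15 / 8 * indicator (B k) \<omega> - 1)"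
        by (subst Bochner_Integration.integral_diff) (simp_all add: prob_space)
      also have "\<dots> \<le> expectation (\<lambda>\<omega>. cos (t * (\<Sum>j<n. Y j \<omega>)))"
      proof (intro integral_mono)
        fix \<omega> assume "\<omega> \<in> space M"
        show "15 / 8 * indicator (B k) \<omega> - 1 \<le> cos (t * (\<Sum>j<n. Y j \<omega>))"
        proof (cases "\<omega> \<in> B k")
          case True
          have "(t * (\<Sum>j<n. Y j \<omega>))\<^sup>2 \<le> (1 / 2)\<^sup>2"
            using small[OF True, of n] by (simp flip: abs_le_square_iff)
          then show ?thesis
            using True cos_ge_one_minus_half_square[of "t * (\<Sum>j<n. Y j \<omega>)"] by (simp add: power_divide)
        qed simp
      qed (use intB in \<open>auto intro!: integrable_const_bound[where B=1 and f="\<lambda>\<omega>. cos (t * (\<Sum>j<n. Y j \<omega>))"]\<close>)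
      also have "\<dots> = (\<Prod>j<n. expectation (\<lambda>\<omega>. cos (t * Y j \<omega>)))"
        by (rule expectation_cos_sum[OF ind sym])
      finally show ?thesis using k by simp
    qed
    define d where "d j = expectation (\<lambda>\<omega>. 1 - cos (t * Y j \<omega>))" for j
    have int: "integrable M (\<lambda>\<omega>. 1 - cos (t * Y j \<omega>))" for j
      by (intro Bochner_Integration.integrable_diff integrable_const_bound[where B=1 and f="\<lambda>\<omega>. cos (t * Y j \<omega>)"]) auto
    have d: "expectation (\<lambda>\<omega>. cos (t * Y j \<omega>)) = 1 - d j" "0 \<le> d j" for j
    proof -
      show "expectation (\<lambda>\<omega>. cos (t * Y j \<omega>)) = 1 - d j"
        unfolding d_def by (subst Bochner_Integration.integral_diff)
          (auto simp: prob_space intro!: integrable_const_bound[where B=1])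
      show "0 \<le> d j" unfolding d_def by (rule Bochner_Integration.integral_nonneg) simp
    qed
    \<comment> \<open>Two consecutive products are positive, hence so is the factor by which they
      differ. Without this sign the products could not be compared factor by factor.\<close>
    have pos: "0 < 1 - d j" for j
    proof -
      have "0 < (\<Prod>j<j. 1 - d j)" "0 < (\<Prod>j<Suc j. 1 - d j)"
        using half[of j] half[of "Suc j"] by (auto simp: d(1))
      then show ?thesis by (simp add: zero_less_mult_iff)
    qed
    have "(\<Sum>j\<le>n. d j) \<le> ln 2" for n
    proof -
      have "1 / 2 \<le> (\<Prod>j<Suc n. 1 - d j)" using half[of "Suc n"] by (simp only: d(1))
      also have "\<dots> \<le> (\<Prod>j<Suc n. exp (- d j))"
        using pos exp_ge_add_one_self[of "- d _"] by (intro prod_mono) (auto intro: less_imp_le)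
      also have "\<dots> = exp (- (\<Sum>j\<le>n. d j))"
        by (simp add: sum_negf lessThan_Suc_atMost flip: exp_sum)
      finally have "ln (1 / 2) \<le> - (\<Sum>j\<le>n. d j)" 
        by (metis divide_pos_pos exp_gt_zero ln_exp ln_le_cancel_iff zero_less_numeral zero_less_one)
      then show ?thesis by (simp add: ln_div)
    qed
    then have "summable d" by (intro bounded_imp_summable[of d "ln 2"]) (auto simp: d)
    then have "AE \<omega> in M. summable (\<lambda>j. 1 - cos (t * Y j \<omega>))"
      unfolding d_def by (intro AE_summable_if_summable_expectation int) auto
    moreover have "AE \<omega> in M. \<not> summable (\<lambda>j. min 1 ((Y j \<omega>)\<^sup>2))"
      by (rule AE_not_summable_if_indep[OF indep_vars_compose2[OF ind] _ _ ns]) auto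
    ultimately have "AE \<omega> in M. \<omega> \<notin> B k"
    proof eventually_elim
      case (elim \<omega>)
      show ?case
      proof
        assume B: "\<omega> \<in> B k"
        \<comment> \<open>A summand is the difference of consecutive partial sums, each at most 1/2
          after scaling. So \<open>t * Y j\<close> stays in the range where the quadratic bound on
          the cosine is valid.\<close>
        have "\<bar>t * Y j \<omega>\<bar> \<le> 1" for j
        proof -
          have "\<bar>b\<bar> \<le> 1" if "\<bar>a\<bar> \<le> 1 / 2" "\<bar>a + b\<bar> \<le> 1 / 2" for a b :: real
            using that by linarith
          from this[OF small[OF B, of j]] small[OF B, of "Suc j"] show ?thesis by (simp add: distrib_left)
        qed
        then have "(t * Y j \<omega>)\<^sup>2 / 4 \<le> 1 - cos (t * Y j \<omega>)" for j by (rule cos_le_one_minus_square)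
        then have "(Y j \<omega>)\<^sup>2 \<le> 4 / t\<^sup>2 * (1 - cos (t * Y j \<omega>))" for j
          using t by (simp add: field_simps power_mult_distrib)
        then have "summable (\<lambda>j. (Y j \<omega>)\<^sup>2)"
          by (intro summable_comparison_test'[OF summable_mult[OF elim(1), of "4 / t\<^sup>2"]]) auto
        then show False using elim(2) summable_min_one_iff[of "\<lambda>j. (Y j \<omega>)\<^sup>2"] by simp
      qed
    qed
    then have "prob (B k) = 0" by (subst (asm) prob_eq_0[symmetric]) auto
    with k show False by simp
  qed
  then have "prob U = 1" using prob_unbounded_sums_zero_one[OF ind] by (simp add: U_def)
  then have "AE \<omega> in M. \<omega> \<in> U" by (subst (asm) prob_eq_1) auto
  then show ?thesis by (rule AE_mp) (simp add: U_def)
qed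

end

section \<open>The law of the race for exponential clocks\<close>

lemma measurable_next_urn:
  assumes [measurable]: "\<And>i. (\<lambda>x. h x i) \<in> borel_measurable L"
  shows "(\<lambda>x. next_urn A v (h x)) \<in> L \<rightarrow>\<^sub>M count_space UNIV"
  unfolding next_urn_def by measurable

text \<open>The recursive call depends on the random winner. It is measurable for each fixed winner,
  and there are only countably many.\<close>

lemma measurable_race:
  assumes "\<And>i. (\<lambda>x. h x i) \<in> borel_measurable L"
  shows "(\<lambda>x. race A v (h x) k) \<in> L \<rightarrow>\<^sub>M count_space UNIV"
  using assms
proof (induction k arbitrary: v h)
  case 0
  then show ?case by (simp add: measurable_next_urn)
next
  case (Suc k)
  note [measurable] = Suc.prems
  have "(\<lambda>x. residual A v a (h x) i) \<in> borel_measurable L" for a i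
    unfolding residual_def by measurable
  then have "(\<lambda>x. race A (v(a := Suc (v a))) (residual A v a (h x)) k) \<in> L \<rightarrow>\<^sub>M count_space UNIV" for a
    by (rule Suc.IH)
  from measurable_compose_countable[OF this measurable_next_urn[OF Suc.prems]] show ?case by simp
qed

lemma next_urn_cong:
  assumes "\<And>b. b \<in> {1..A} \<Longrightarrow> h (b, v b) = h' (b, v b)"
  shows "next_urn A v h = next_urn A v h'"
proof -
  have "a \<in> {1..A} \<and> (\<forall>b\<in>{1..A}. h (a, v a) \<le> h (b, v b)) \<longleftrightarrow>
      a \<in> {1..A} \<and> (\<forall>b\<in>{1..A}. h' (a, v a) \<le> h' (b, v b))" for a
    using assms by (intro conj_cong ball_cong refl) simp
  then show ?thesis unfolding next_urn_def by presburger
qed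

text \<open>A clock that has rung is never read again, so the clock of the first winner is free to
  be integrated out in \<open>race_step_law\<close>.\<close>

lemma race_cong:
  assumes "1 \<le> A" "\<And>b j. b \<in> {1..A} \<Longrightarrow> v b \<le> j \<Longrightarrow> h (b, j) = h' (b, j)"
  shows "race A v h k = race A v h' k"
  using assms(2)
proof (induction k arbitrary: v h h')
  case 0
  show ?case unfolding race.simps by (rule next_urn_cong) (rule 0, simp_all)
next
  case (Suc k)
  have eq: "next_urn A v h = next_urn A v h'" by (rule next_urn_cong) (rule Suc.prems, simp_all)
  obtain a where a: "next_urn A v h' = a" "a \<in> {1..A}" using next_urn_in[OF assms(1)] by blast
  show ?case
    unfolding race.simps eq a(1)
  proof (rule Suc.IH)
    fix b j assume bj: "b \<in> {1..A}" "(v(a := Suc (v a))) b \<le> j"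
    then have "v b \<le> j" by (cases "b = a") auto
    then have "h (b, j) = h' (b, j)" "h (a, v a) = h' (a, v a)"
      using Suc.prems[OF bj(1)] Suc.prems[OF a(2)] by blast+
    then show "residual A v a h (b, j) = residual A v a h' (b, j)" unfolding residual_def by presburger
  qed
qed

section \<open>Exponential clocks and lack of memory\<close>

definition clock :: "real measure" where
  "clock = density lborel (exponential_density 1)"

text \<open>All clocks have rate 1. Holding times arise on division by the feedback, so the clock
  space does not depend on it and a plain product with \<open>M\<close> is enough.\<close>

definition clocks :: "(nat \<times> nat \<Rightarrow> real) measure" where
  "clocks = PiM UNIV (\<lambda>_. clock)"

lemma sets_clock [measurable_cong, simp]: "sets clock = sets borel"
  and space_clock [simp]: "space clock = UNIV"
  by (simp_all add: clock_def)

lemma prob_space_clock: "prob_space clock"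
  unfolding clock_def by (rule prob_space_exponential_density) simp

lemma sets_clocks [measurable_cong]: "sets clocks = sets (PiM UNIV (\<lambda>_. borel))"
  unfolding clocks_def by (rule sets_PiM_cong) auto

lemma space_clocks [simp]: "space clocks = UNIV"
  by (simp add: clocks_def space_PiM)

lemma prob_space_clocks: "prob_space clocks"
  unfolding clocks_def by (rule prob_space_PiM) (rule prob_space_clock)

lemma AE_clock_iff:
  assumes "Measurable.pred borel P"
  shows "(AE x in clock. P x) \<longleftrightarrow> (AE x in lborel. 0 \<le> x \<longrightarrow> P x)"
  using assms unfolding clock_def
  by (subst AE_density) (auto simp: exponential_density_def not_less intro!: AE_cong)

lemma AE_clock_nonneg: "AE x in clock. 0 \<le> x"
  by (subst AE_clock_iff) auto

lemma AE_clock_neq: "AE x in clock. x \<noteq> s"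
  by (subst AE_clock_iff) (auto intro: AE_mp[OF AE_lborel_singleton[of s]])

lemma nn_integral_clock:
  assumes [measurable]: "g \<in> borel_measurable borel"
  shows "(\<integral>\<^sup>+x. g x \<partial>clock) = (\<integral>\<^sup>+x. ennreal (exponential_density 1 x) * g x \<partial>lborel)"
  unfolding clock_def by (rule nn_integral_density) auto

text \<open>Ties are broken by the urn index, so both \<open>s < x\<close> and \<open>s \<le> x\<close> occur as \<open>P\<close>.\<close>

lemma clock_memoryless:
  fixes g :: "real \<Rightarrow> ennreal"
  assumes [measurable]: "g \<in> borel_measurable borel" and s: "0 \<le> s"
    and P: "\<And>x. s < x \<Longrightarrow> P x" "\<And>x. P x \<Longrightarrow> s \<le> x"
  shows "(\<integral>\<^sup>+x. (if P x then g (x - s) else 0) \<partial>clock) = ennreal (exp (- s)) * (\<integral>\<^sup>+x. g x \<partial>clock)"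
proof -
  have "(\<integral>\<^sup>+x. (if P x then g (x - s) else 0) \<partial>clock) = (\<integral>\<^sup>+x. (if s < x then g (x - s) else 0) \<partial>clock)"
    using P by (intro nn_integral_cong_AE, intro AE_mp[OF AE_clock_neq[of s] AE_I2]) (auto simp: less_le)
  also have "\<dots> = (\<integral>\<^sup>+x. ennreal (exponential_density 1 x) * (if s < x then g (x - s) else 0) \<partial>lborel)"
    by (rule nn_integral_clock) measurable
  also have "\<dots> = (\<integral>\<^sup>+x. ennreal (exponential_density 1 (s + x)) * (if 0 < x then g x else 0) \<partial>lborel)"
    by (subst nn_integral_real_affine[where c=1 and t=s]) (auto cong: if_cong)
  also have "\<dots> = (\<integral>\<^sup>+x. ennreal (exp (- s)) * (ennreal (exponential_density 1 x) * g x) \<partial>lborel)"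
  proof (rule nn_integral_cong_AE, rule AE_mp[OF AE_lborel_singleton[of 0]], intro AE_I2 impI)
    fix x :: real assume "x \<noteq> 0"
    then show "ennreal (exponential_density 1 (s + x)) * (if 0 < x then g x else 0) =
        ennreal (exp (- s)) * (ennreal (exponential_density 1 x) * g x)"
    proof (cases "0 < x")
      case True
      then have "exponential_density 1 (s + x) = exp (- s) * exponential_density 1 x"
        using s by (simp add: exponential_density_def mult_exp_exp)
      with True show ?thesis by (simp add: ennreal_mult' mult.assoc)
    next
      case False
      with \<open>x \<noteq> 0\<close> show ?thesis by (simp add: exponential_density_def)
    qed
  qed
  also have "\<dots> = ennreal (exp (- s)) * (\<integral>\<^sup>+x. g x \<partial>clock)"
    by (subst nn_integral_clock) (auto simp: nn_integral_cmult)
  finally show ?thesis .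
qed

text \<open>The integrand times the density of \<open>clock\<close> is \<open>1 / (1 + c)\<close>
  times the exponential density of rate \<open>1 + c\<close>. With \<open>c\<close> the total rate
  of the rivals relative to the winner, this becomes the selection probability.\<close>

lemma nn_integral_exp_clock:
  assumes "0 \<le> c"
  shows "(\<integral>\<^sup>+x. ennreal (exp (- c * x)) \<partial>clock) = ennreal (1 / (1 + c))"
proof -
  interpret D: prob_space "density lborel (exponential_density (1 + c))"
    by (rule prob_space_exponential_density) (use assms in simp)
  have "(\<integral>\<^sup>+x. ennreal (exp (- c * x)) \<partial>clock) =
      (\<integral>\<^sup>+x. ennreal (1 / (1 + c)) * ennreal (exponential_density (1 + c) x) \<partial>lborel)"
  proof (subst nn_integral_clock, measurable, intro nn_integral_cong)
    fix x :: real
    have "exp (- x) * exp (- c * x) = exp (- x * (1 + c))"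
      by (simp add: mult_exp_exp algebra_simps)
    then show "ennreal (exponential_density 1 x) * ennreal (exp (- c * x)) =
        ennreal (1 / (1 + c)) * ennreal (exponential_density (1 + c) x)"
      using assms by (simp add: exponential_density_def flip: ennreal_mult')
  qed
  also have "\<dots> = ennreal (1 / (1 + c)) * emeasure (density lborel (exponential_density (1 + c))) UNIV"
    by (subst nn_integral_cmult) (auto simp: emeasure_density)
  also have "\<dots> = ennreal (1 / (1 + c))" using D.emeasure_space_1 by simp
  finally show ?thesis .
qed

text \<open>Redrawing one coordinate independently leaves the infinite product unchanged; this is
  Fubini for a single clock.\<close>

lemma clocks_resample: "distr (clock \<Otimes>\<^sub>M clocks) clocks (\<lambda>(x, e). e(i := x)) = clocks"
  using distr_pair_PiM_eq_PiM[of UNIV "\<lambda>_. clock" i] prob_space_clock by (simp add: clocks_def)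

lemma measurable_resample [measurable]:
  "(\<lambda>(x, e). e(i := x)) \<in> clock \<Otimes>\<^sub>M clocks \<rightarrow>\<^sub>M clocks"
proof -
  have "(\<lambda>(x, e). e(i := x)) \<in> clock \<Otimes>\<^sub>M clocks \<rightarrow>\<^sub>M PiM UNIV (\<lambda>_. borel)"
    by (rule measurable_PiM_single') (auto simp: fun_upd_apply split_beta clocks_def intro!: measurable_If)
  then show ?thesis by (simp add: measurable_cong_sets[OF refl sets_clocks])
qed

lemma nn_integral_clocks_split:
  assumes [measurable]: "G \<in> borel_measurable clocks"
  shows "(\<integral>\<^sup>+e. G e \<partial>clocks) = (\<integral>\<^sup>+x. \<integral>\<^sup>+e. G (e(i := x)) \<partial>clocks \<partial>clock)"
    and "(\<integral>\<^sup>+e. G e \<partial>clocks) = (\<integral>\<^sup>+e. \<integral>\<^sup>+x. G (e(i := x)) \<partial>clock \<partial>clocks)"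
proof -
  interpret C: prob_space clock by (rule prob_space_clock)
  interpret CS: prob_space clocks by (rule prob_space_clocks)
  interpret P: pair_sigma_finite clock clocks by unfold_locales
  have eq: "(\<integral>\<^sup>+e. G e \<partial>clocks) = (\<integral>\<^sup>+z. (\<lambda>(x, e). G (e(i := x))) z \<partial>(clock \<Otimes>\<^sub>M clocks))"
    by (subst (1) clocks_resample[of i, symmetric], subst nn_integral_distr) (auto simp: case_prod_beta')
  have m: "(\<lambda>(x, e). G (e(i := x))) \<in> borel_measurable (clock \<Otimes>\<^sub>M clocks)"
    using measurable_compose[OF measurable_resample assms] by (simp add: split_beta)
  show "(\<integral>\<^sup>+e. G e \<partial>clocks) = (\<integral>\<^sup>+x. \<integral>\<^sup>+e. G (e(i := x)) \<partial>clocks \<partial>clock)"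
    unfolding eq using CS.nn_integral_fst[OF m] by simp
  show "(\<integral>\<^sup>+e. G e \<partial>clocks) = (\<integral>\<^sup>+e. \<integral>\<^sup>+x. G (e(i := x)) \<partial>clock \<partial>clocks)"
    unfolding eq using P.nn_integral_snd[OF m] by simp
qed

lemma measurable_clocks_upd:
  assumes "G \<in> borel_measurable clocks"
  shows "(\<lambda>x. G (e(i := x))) \<in> borel_measurable borel"
  by (rule measurable_compose[OF _ assms])
    (auto simp: measurable_cong_sets[OF refl sets_clocks] fun_upd_apply intro!: measurable_PiM_single')

lemma clocks_memoryless_single:
  assumes G [measurable]: "G \<in> borel_measurable clocks" and s: "0 \<le> s"
    and P: "\<And>x. s < x \<Longrightarrow> P x" "\<And>x. P x \<Longrightarrow> s \<le> x" and [measurable]: "Measurable.pred borel P"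
  shows "(\<integral>\<^sup>+e. (if P (e i) then G (e(i := e i - s)) else 0) \<partial>clocks) = ennreal (exp (- s)) * (\<integral>\<^sup>+e. G e \<partial>clocks)"
proof -
  have [measurable]: "(\<lambda>e. e(i := e i - s)) \<in> clocks \<rightarrow>\<^sub>M clocks"
    by (auto simp: measurable_cong_sets[OF refl sets_clocks] fun_upd_apply clocks_def intro!: measurable_PiM_single')
  have [measurable]: "(\<lambda>e. e i) \<in> borel_measurable clocks"
    by (simp add: measurable_cong_sets[OF sets_clocks refl])
  have "(\<integral>\<^sup>+e. (if P (e i) then G (e(i := e i - s)) else 0) \<partial>clocks) =
      (\<integral>\<^sup>+e. \<integral>\<^sup>+x. (if P x then G (e(i := x - s)) else 0) \<partial>clock \<partial>clocks)"
    by (subst nn_integral_clocks_split(2)[of _ i]) (auto cong: if_cong)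
  also have "\<dots> = (\<integral>\<^sup>+e. ennreal (exp (- s)) * (\<integral>\<^sup>+x. G (e(i := x)) \<partial>clock) \<partial>clocks)"
    by (intro nn_integral_cong clock_memoryless[OF measurable_clocks_upd[OF G] s P])
  also have "\<dots> = ennreal (exp (- s)) * (\<integral>\<^sup>+e. \<integral>\<^sup>+x. G (e(i := x)) \<partial>clock \<partial>clocks)"
  proof (rule nn_integral_cmult)
    interpret C: prob_space clock by (rule prob_space_clock)
    have "(\<lambda>(e, x). G (e(i := x))) \<in> borel_measurable (clocks \<Otimes>\<^sub>M clock)"
      using measurable_compose[OF measurable_pair_swap' measurable_compose[OF measurable_resample G, of i]]
      by (simp add: split_beta)
    then show "(\<lambda>e. \<integral>\<^sup>+x. G (e(i := x)) \<partial>clock) \<in> borel_measurable clocks"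
      using C.borel_measurable_nn_integral by auto
  qed
  also have "\<dots> = ennreal (exp (- s)) * (\<integral>\<^sup>+e. G e \<partial>clocks)"
    by (subst nn_integral_clocks_split(2)[of G i]) auto
  finally show ?thesis .
qed

text \<open>The clocks are treated one at a time: the integrand for the smaller set,
  \<open>G'\<close>, becomes the \<open>G\<close> of the one-clock case. As the new index is outside
  \<open>K\<close>, moving its clock disturbs neither the conditions nor the shifts for
  \<open>K\<close>.\<close>

lemma clocks_memoryless:
  assumes "finite K" and G: "G \<in> borel_measurable clocks"
    and s: "\<And>i. i \<in> K \<Longrightarrow> 0 \<le> s i"
    and P: "\<And>i x. i \<in> K \<Longrightarrow> s i < x \<Longrightarrow> P i x" "\<And>i x. i \<in> K \<Longrightarrow> P i x \<Longrightarrow> s i \<le> x"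
      "\<And>i. Measurable.pred borel (P i)"
  shows "(\<integral>\<^sup>+e. (if \<forall>i\<in>K. P i (e i) then G (\<lambda>i. if i \<in> K then e i - s i else e i) else 0) \<partial>clocks)
      = ennreal (exp (- (\<Sum>i\<in>K. s i))) * (\<integral>\<^sup>+e. G e \<partial>clocks)"
  using assms(1) s P(1,2)
proof (induction K)
  case empty
  then show ?case by simp
next
  case (insert k K)
  define G' where "G' e = (if \<forall>i\<in>K. P i (e i) then G (\<lambda>i. if i \<in> K then e i - s i else e i) else 0)" for e
  have [measurable]: "(\<lambda>e. e i) \<in> borel_measurable clocks" for i
    by (simp add: measurable_cong_sets[OF sets_clocks refl])
  note [measurable] = P(3) G
  have [measurable]: "(\<lambda>e i. if i \<in> K then e i - s i else e i) \<in> clocks \<rightarrow>\<^sub>M clocks"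
    by (auto simp: measurable_cong_sets[OF refl sets_clocks] intro!: measurable_PiM_single')
  have [measurable]: "G' \<in> borel_measurable clocks"
    unfolding G'_def using insert.hyps(1) by measurable
  have "(if \<forall>i\<in>insert k K. P i (e i) then G (\<lambda>i. if i \<in> insert k K then e i - s i else e i) else 0)
      = (if P k (e k) then G' (e(k := e k - s k)) else 0)" for e
  proof -
    have "(\<lambda>i. if i \<in> insert k K then e i - s i else e i) =
        (\<lambda>i. if i \<in> K then (e(k := e k - s k)) i - s i else (e(k := e k - s k)) i)"
      using insert.hyps(2) by auto
    moreover have "(\<forall>i\<in>K. P i ((e(k := e k - s k)) i)) \<longleftrightarrow> (\<forall>i\<in>K. P i (e i))"
      using insert.hyps(2) by auto
    ultimately show ?thesis by (simp add: G'_def)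
  qed
  then have "(\<integral>\<^sup>+e. (if \<forall>i\<in>insert k K. P i (e i) then G (\<lambda>i. if i \<in> insert k K then e i - s i else e i) else 0) \<partial>clocks)
      = (\<integral>\<^sup>+e. (if P k (e k) then G' (e(k := e k - s k)) else 0) \<partial>clocks)" by (simp only:)
  also have "\<dots> = ennreal (exp (- s k)) * (\<integral>\<^sup>+e. G' e \<partial>clocks)"
    by (rule clocks_memoryless_single) (use insert.prems P(3) in auto)
  also have "(\<integral>\<^sup>+e. G' e \<partial>clocks) = ennreal (exp (- (\<Sum>i\<in>K. s i))) * (\<integral>\<^sup>+e. G e \<partial>clocks)"
    unfolding G'_def by (rule insert.IH) (use insert.prems in auto)
  finally have "(\<integral>\<^sup>+e. (if \<forall>i\<in>insert k K. P i (e i)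
        then G (\<lambda>i. if i \<in> insert k K then e i - s i else e i) else 0) \<partial>clocks)
      = ennreal (exp (- s k)) * (ennreal (exp (- (\<Sum>i\<in>K. s i))) * (\<integral>\<^sup>+e. G e \<partial>clocks))" .
  moreover have "exp (- (\<Sum>i\<in>insert k K. s i)) = exp (- s k) * exp (- (\<Sum>i\<in>K. s i))"
    using insert.hyps by (simp add: mult_exp_exp)
  ultimately show ?case by (simp only: ennreal_mult' exp_ge_zero mult.assoc)
qed

text \<open>For feedback frozen at \<open>f\<close>, the probability that urns started from
  \<open>v\<close> are selected in the order \<open>p\<close>.\<close>

primrec path_prob :: "nat \<Rightarrow> (nat \<times> nat \<Rightarrow> real) \<Rightarrow> (nat \<Rightarrow> nat) \<Rightarrow> nat list \<Rightarrow> real" where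
  "path_prob A f v [] = 1"
| "path_prob A f v (a # p) =
     f (a, v a) / (\<Sum>b=1..A. f (b, v b)) * path_prob A f (v(a := Suc (v a))) p"

text \<open>Fix the clock of the winner at \<open>x\<close>. Each rival must outlast
  \<open>f i * (x / f i0)\<close>, which has total probability \<open>exp (- c * x)\<close>, and by
  lack of memory what then remains of the rivals is fresh. Integration over \<open>x\<close> gives
  \<open>1 / (1 + c)\<close>, the required ratio. By \<open>indep\<close>, the quantity
  \<open>G\<close> ignores the spent clock.\<close>

lemma race_step_law:
  assumes a: "a \<in> {1..A}" and f: "\<And>i. 0 < f i"
    and G [measurable]: "G \<in> borel_measurable clocks" and indep: "\<And>e x. G (e((a, v a) := x)) = G e"
  shows "(\<integral>\<^sup>+e. (if next_urn A v (\<lambda>i. e i / f i) = a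
        then G (\<lambda>i. if i \<in> (\<lambda>b. (b, v b)) ` ({1..A} - {a}) then e i - f i * (e (a, v a) / f (a, v a)) else e i)
        else 0) \<partial>clocks)
      = ennreal (f (a, v a) / (\<Sum>b=1..A. f (b, v b))) * (\<integral>\<^sup>+e. G e \<partial>clocks)"
proof -
  define K where "K = (\<lambda>b. (b, v b)) ` ({1..A} - {a})"
  define i0 where "i0 = (a, v a)"
  define c where "c = (\<Sum>i\<in>K. f i) / f i0"
  have K: "finite K" "i0 \<notin> K" by (auto simp: K_def i0_def)
  have c: "0 \<le> c" unfolding c_def using f by (intro divide_nonneg_nonneg sum_nonneg less_imp_le) auto
  have [measurable]: "(\<lambda>e. e i) \<in> borel_measurable clocks" for i
    by (simp add: measurable_cong_sets[OF sets_clocks refl])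
  have [measurable]: "(\<lambda>e i. if i \<in> K then e i - f i * (e i0 / f i0) else e i) \<in> clocks \<rightarrow>\<^sub>M clocks"
    by (auto simp: measurable_cong_sets[OF refl sets_clocks] intro!: measurable_PiM_single')
  have [measurable]: "(\<lambda>e. next_urn A v (\<lambda>i. e i / f i)) \<in> clocks \<rightarrow>\<^sub>M count_space UNIV"
    by (rule measurable_next_urn) measurable
  define P where "P x i y = (if fst i < a then f i * (x / f i0) < y else f i * (x / f i0) \<le> y)"
    for x :: real and i y
  have sel: "next_urn A v (\<lambda>i. (e(i0 := x)) i / f i) = a \<longleftrightarrow> (\<forall>i\<in>K. P x i (e i))" for e x
  proof -
    have "(\<forall>i\<in>K. P x i (e i)) \<longleftrightarrow> (\<forall>b\<in>{1..A} - {a}. P x (b, v b) (e (b, v b)))"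
      by (auto simp: K_def)
    also have "\<dots> \<longleftrightarrow> next_urn A v (\<lambda>i. (e(i0 := x)) i / f i) = a"
      unfolding next_urn_iff[OF a] P_def i0_def
      by (intro ball_cong refl) (simp add: pos_less_divide_eq pos_le_divide_eq f mult.commute)
    finally show ?thesis by simp
  qed
  have "(\<integral>\<^sup>+e. (if next_urn A v (\<lambda>i. e i / f i) = a
        then G (\<lambda>i. if i \<in> K then e i - f i * (e i0 / f i0) else e i) else 0) \<partial>clocks)
     = (\<integral>\<^sup>+x. \<integral>\<^sup>+e. (if next_urn A v (\<lambda>i. (e(i0 := x)) i / f i) = a
        then G (\<lambda>i. if i \<in> K then (e(i0 := x)) i - f i * ((e(i0 := x)) i0 / f i0) else (e(i0 := x)) i) else 0)
        \<partial>clocks \<partial>clock)"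
    by (rule nn_integral_clocks_split(1)) measurable
  also have "\<dots> = (\<integral>\<^sup>+x. \<integral>\<^sup>+e. (if \<forall>i\<in>K. P x i (e i)
        then G (\<lambda>i. if i \<in> K then e i - f i * (x / f i0) else e i) else 0) \<partial>clocks \<partial>clock)"
  proof -
    have "G (\<lambda>i. if i \<in> K then (e(i0 := x)) i - f i * ((e(i0 := x)) i0 / f i0) else (e(i0 := x)) i)
        = G (\<lambda>i. if i \<in> K then e i - f i * (x / f i0) else e i)" for e x
    proof -
      have "(\<lambda>i. if i \<in> K then (e(i0 := x)) i - f i * ((e(i0 := x)) i0 / f i0) else (e(i0 := x)) i)
          = (\<lambda>i. if i \<in> K then e i - f i * (x / f i0) else e i)((a, v a) := x)"
        using K(2) by (auto simp: i0_def)
      then show ?thesis by (simp only: indep)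
    qed
    then show ?thesis by (simp only: sel)
  qed
  also have "\<dots> = (\<integral>\<^sup>+x. ennreal (exp (- c * x)) * (\<integral>\<^sup>+e. G e \<partial>clocks) \<partial>clock)"
  proof (rule nn_integral_cong_AE, rule AE_mp[OF AE_clock_nonneg], intro AE_I2 impI)
    fix x :: real assume "0 \<le> x"
    then have "(\<integral>\<^sup>+e. (if \<forall>i\<in>K. P x i (e i)
        then G (\<lambda>i. if i \<in> K then e i - f i * (x / f i0) else e i) else 0) \<partial>clocks)
      = ennreal (exp (- (\<Sum>i\<in>K. f i * (x / f i0)))) * (\<integral>\<^sup>+e. G e \<partial>clocks)"
      using f by (intro clocks_memoryless K G) (auto simp: P_def less_imp_le split: if_splits)
    then show "(\<integral>\<^sup>+e. (if \<forall>i\<in>K. P x i (e i)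
        then G (\<lambda>i. if i \<in> K then e i - f i * (x / f i0) else e i) else 0) \<partial>clocks)
      = ennreal (exp (- c * x)) * (\<integral>\<^sup>+e. G e \<partial>clocks)"
      by (simp add: c_def sum_distrib_right sum_divide_distrib)
  qed
  also have "\<dots> = ennreal (1 / (1 + c)) * (\<integral>\<^sup>+e. G e \<partial>clocks)"
  proof (subst nn_integral_multc)
    show "(\<lambda>x. ennreal (exp (- c * x))) \<in> borel_measurable clock"
      unfolding measurable_cong_sets[OF sets_clock refl] by measurable
  qed (simp only: nn_integral_exp_clock[OF c])
  also have "1 / (1 + c) = f (a, v a) / (\<Sum>b=1..A. f (b, v b))"
  proof -
    have "(\<Sum>b=1..A. f (b, v b)) = f i0 + (\<Sum>b\<in>{1..A} - {a}. f (b, v b))"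
      using a by (simp add: sum.remove i0_def)
    also have "(\<Sum>b\<in>{1..A} - {a}. f (b, v b)) = (\<Sum>i\<in>K. f i)"
      unfolding K_def by (subst sum.reindex) (auto simp: inj_on_def)
    finally show ?thesis using f[of i0] by (simp add: c_def i0_def field_simps)
  qed
  finally show ?thesis by (simp only: K_def i0_def)
qed

lemma race_path_law:
  assumes f: "\<And>i. 0 < f i" and "set p \<subseteq> {1..A}"
  shows "emeasure clocks {e. \<forall>k<length p. race A v (\<lambda>i. e i / f i) k = p ! k} = ennreal (path_prob A f v p)"
  using assms(2)
proof (induction p arbitrary: v)
  case Nil
  interpret CS: prob_space clocks by (rule prob_space_clocks)
  show ?case using CS.emeasure_space_1 by simp
next
  case (Cons a p)
  have a: "a \<in> {1..A}" using Cons.prems by simp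
  define v' where "v' = v(a := Suc (v a))"
  \<comment> \<open>This is \<open>residual\<close> in the scale of the rate-1 clocks: elapsed time
    is multiplied by the rate of the clock concerned.\<close>
  define \<sigma> where "\<sigma> e = (\<lambda>i. if i \<in> (\<lambda>b. (b, v b)) ` ({1..A} - {a}) then e i - f i * (e (a, v a) / f (a, v a)) else e i)"
    for e :: "nat \<times> nat \<Rightarrow> real"
  define S where "S = {e. \<forall>k<length p. race A v' (\<lambda>i. e i / f i) k = p ! k}"
  have comp [measurable]: "(\<lambda>e. e i) \<in> borel_measurable clocks" for i
    by (simp add: measurable_cong_sets[OF sets_clocks refl])
  have [measurable]: "(\<lambda>e. race A v (\<lambda>i. e i / f i) k) \<in> clocks \<rightarrow>\<^sub>M count_space UNIV" for v k
    by (rule measurable_race) measurable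
  have "{e \<in> space clocks. \<forall>k<length p. race A v (\<lambda>i. e i / f i) k = p ! k} \<in> sets clocks" for v p
    by measurable
  then have ev: "{e. \<forall>k<length p. race A v (\<lambda>i. e i / f i) k = p ! k} \<in> sets clocks" for v p
    by simp
  have S [measurable]: "S \<in> sets clocks" unfolding S_def by (rule ev)
  have res: "residual A v a (\<lambda>i. e i / f i) = (\<lambda>i. \<sigma> e i / f i)" for e
  proof -
    have "f i \<noteq> 0" for i using f[of i] by simp
    then show ?thesis by (auto simp: residual_def \<sigma>_def diff_divide_distrib fun_eq_iff)
  qed
  have "(\<forall>k<length (a # p). race A v (\<lambda>i. e i / f i) k = (a # p) ! k) \<longleftrightarrow>
      next_urn A v (\<lambda>i. e i / f i) = a \<and> \<sigma> e \<in> S" for e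
    by (cases "next_urn A v (\<lambda>i. e i / f i) = a") (simp_all add: S_def v'_def res All_less_Suc2)
  then have "emeasure clocks {e. \<forall>k<length (a # p). race A v (\<lambda>i. e i / f i) k = (a # p) ! k} =
      (\<integral>\<^sup>+e. (if next_urn A v (\<lambda>i. e i / f i) = a then indicator S (\<sigma> e) else 0) \<partial>clocks)"
    by (subst nn_integral_indicator[OF ev, symmetric]) (auto intro!: nn_integral_cong simp: indicator_def)
  also have "\<dots> = ennreal (f (a, v a) / (\<Sum>b=1..A. f (b, v b))) * (\<integral>\<^sup>+e. indicator S e \<partial>clocks)"
    unfolding \<sigma>_def
  proof (rule race_step_law[OF a f])
    fix e x
    have "race A v' (\<lambda>i. (e((a, v a) := x)) i / f i) k = race A v' (\<lambda>i. e i / f i) k" for k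
      using a by (intro race_cong) (auto simp: v'_def)
    then show "indicator S (e((a, v a) := x)) = (indicator S e :: ennreal)"
      by (simp add: S_def indicator_def)
  qed measurable
  also have "(\<integral>\<^sup>+e. indicator S e \<partial>clocks) = ennreal (path_prob A f v' p)"
    using Cons.IH[of v'] Cons.prems by (simp add: S_def[symmetric])
  finally have "emeasure clocks {e. \<forall>k<length (a # p). race A v (\<lambda>i. e i / f i) k = (a # p) ! k} =
      ennreal (f (a, v a) / (\<Sum>b=1..A. f (b, v b))) * ennreal (path_prob A f v' p)" .
  also have "\<dots> = ennreal (path_prob A f v (a # p))"
    unfolding path_prob.simps v'_def
    by (rule ennreal_mult'[symmetric]) (intro divide_nonneg_nonneg sum_nonneg less_imp_le f)
  finally show ?case .
qed

section \<open>The law of the balls-in-bins process\<close>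

text \<open>The race recursion peels off the first selection of a path, while the conditional
  probabilities of the process concern the last one; both are needed for the same product.\<close>

lemma path_prob_append:
  "path_prob A f v (p @ [a]) = path_prob A f v p *
     (f (a, v a + count_list p a) / (\<Sum>b=1..A. f (b, v b + count_list p b)))"
proof (induction p arbitrary: v)
  case Nil
  show ?case by simp
next
  case (Cons x p)
  have "(v(x := Suc (v x))) b + count_list p b = v b + count_list (x # p) b" for b by simp
  then show ?case by (simp only: append_Cons path_prob.simps Cons.IH mult.assoc)
qed

lemma urn_count_path:
  assumes "\<And>k. k < length p \<Longrightarrow> c k = p ! k"
  shows "urn_count v c a (length p) = v a + count_list p a"
  using assms
proof (induction p rule: rev_induct)
  case (snoc x p)
  have "urn_count v c a (length p) = v a + count_list p a"
    using snoc.prems by (intro snoc.IH) (auto simp: nth_append)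
  moreover have "c (length p) = x" using snoc.prems[of "length p"] by simp
  ultimately show ?case by (simp add: urn_count_Suc)
qed simp

context balls_in_bins
begin

text \<open>The value 1 at indices that are not urns makes every rate positive, as
  \<open>race_path_law\<close> demands of all indices.\<close>

definition rate :: "'w \<Rightarrow> nat \<times> nat \<Rightarrow> real" where
  "rate \<omega> i = (if fst i \<in> {1..A} then F (fst i) (snd i) \<omega> else 1)"

definition selected :: "nat \<Rightarrow> 'w \<Rightarrow> nat" where
  "selected n \<omega> = (LEAST a. a \<in> {1..A} \<and> u a (n + 1) \<omega> = u a n \<omega> + 1)"

lemma rate_pos: "\<omega> \<in> space M \<Longrightarrow> 0 < rate \<omega> i"
  using F_pos by (simp add: rate_def)

lemma selected_iff:
  assumes "\<omega> \<in> space M"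
  shows "selected n \<omega> = a \<longleftrightarrow> a \<in> {1..A} \<and> u a (n + 1) \<omega> = u a n \<omega> + 1"
proof -
  obtain s where s: "s \<in> {1..A}" "u s (n + 1) \<omega> = u s n \<omega> + 1"
    and other: "\<And>a. a \<in> {1..A} \<Longrightarrow> a \<noteq> s \<Longrightarrow> u a (n + 1) \<omega> = u a n \<omega>"
    using u_step[OF assms, of n] by blast
  have uniq: "a \<in> {1..A} \<and> u a (n + 1) \<omega> = u a n \<omega> + 1 \<longleftrightarrow> a = s" for a
    using s other[of a] by (cases "a = s") auto
  have "selected n \<omega> = s" unfolding selected_def uniq by (rule Least_equality) auto
  then show ?thesis using uniq[of a] by auto
qed

lemma selected_in: "\<omega> \<in> space M \<Longrightarrow> selected n \<omega> \<in> {1..A}"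
  using selected_iff by blast

lemma u_eq_urn_count:
  assumes "\<omega> \<in> space M" "a \<in> {1..A}"
  shows "u a n \<omega> = urn_count u0 (\<lambda>k. selected k \<omega>) a n"
proof (induction n)
  case 0
  show ?case using u_init assms by simp
next
  case (Suc n)
  have "u a (n + 1) \<omega> = u a n \<omega> + (if selected n \<omega> = a then 1 else 0)"
  proof -
    obtain s where "s \<in> {1..A}" "u s (n + 1) \<omega> = u s n \<omega> + 1"
      and other: "\<forall>a\<in>{1..A} - {s}. u a (n + 1) \<omega> = u a n \<omega>"
      using u_step[OF assms(1), of n] by blast
    then have "selected n \<omega> = s" using selected_iff[OF assms(1), of n s] by blast
    then show ?thesis
      using other assms(2) \<open>u s (n + 1) \<omega> = u s n \<omega> + 1\<close> by (cases "a = s") simp_all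
  qed
  with Suc show ?case by (simp add: urn_count_Suc)
qed

lemma space_urn_history [simp]: "space (urn_history M A F u n) = space M"
  by (simp add: urn_history_def space_measure_of_conv)

lemma sets_urn_history:
  "sets (urn_history M A F u n) = sigma_sets (space M)
     ({F a j -` S \<inter> space M | a j S. a \<in> {1..A} \<and> S \<in> sets borel} \<union>
      {u a k -` S \<inter> space M | a k S. a \<in> {1..A} \<and> k \<le> n})"
  unfolding urn_history_def by (rule sets_measure_of) auto

lemma F_measurable_history:
  assumes "a \<in> {1..A}"
  shows "F a j \<in> borel_measurable (urn_history M A F u n)"
proof (rule measurableI)
  fix S :: "real set" assume "S \<in> sets borel"
  then show "F a j -` S \<inter> space (urn_history M A F u n) \<in> sets (urn_history M A F u n)"
    unfolding sets_urn_history space_urn_history using assms by (intro sigma_sets.Basic) blast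
qed simp

lemma u_measurable_history:
  assumes "a \<in> {1..A}" "k \<le> n"
  shows "u a k \<in> urn_history M A F u n \<rightarrow>\<^sub>M count_space UNIV"
proof (rule measurableI)
  fix S :: "nat set"
  show "u a k -` S \<inter> space (urn_history M A F u n) \<in> sets (urn_history M A F u n)"
    unfolding sets_urn_history space_urn_history using assms by (intro sigma_sets.Basic) blast
qed simp

lemma F_measurable: "a \<in> {1..A} \<Longrightarrow> F a j \<in> borel_measurable M"
  using F_indep by (auto simp: indep_vars_def)

lemma subalgebra_urn_history: "subalgebra M (urn_history M A F u n)"
proof -
  have "F a j -` S \<inter> space M \<in> sets M" if "a \<in> {1..A}" "S \<in> sets borel" for a j S
    using that by (intro measurable_sets[OF F_measurable])
  moreover have "u a k -` S \<inter> space M \<in> sets M" if "a \<in> {1..A}" for a k S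
    using that by (intro measurable_sets[OF u_measurable]) auto
  ultimately show ?thesis
    unfolding subalgebra_def space_urn_history sets_urn_history
    by (intro conjI refl sets.sigma_sets_subset) blast
qed

lemma selected_measurable_history:
  assumes "k < n"
  shows "selected k \<in> urn_history M A F u n \<rightarrow>\<^sub>M count_space UNIV"
proof -
  have "Measurable.pred (urn_history M A F u n) (\<lambda>\<omega>. a \<in> {1..A} \<and> u a (k + 1) \<omega> = u a k \<omega> + 1)" for a
  proof (cases "a \<in> {1..A}")
    case True
    have "Measurable.pred (urn_history M A F u n) (\<lambda>\<omega>. u a (k + 1) \<omega> = m + 1)" for m
      by (rule measurable_compose[OF u_measurable_history[OF True]]) (use assms in auto)
    then have "Measurable.pred (urn_history M A F u n) (\<lambda>\<omega>. u a (k + 1) \<omega> = u a k \<omega> + 1)"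
      by (rule measurable_compose_countable[OF _ u_measurable_history[OF True]]) (use assms in simp)
    with True show ?thesis by (simp only: simp_thms)
  next
    case False
    then show ?thesis by (simp only: simp_thms, intro measurable_const) simp
  qed
  then show ?thesis unfolding selected_def[abs_def] by (rule measurable_Least)
qed

lemma selected_measurable [measurable]: "selected k \<in> M \<rightarrow>\<^sub>M count_space UNIV"
  by (rule measurable_from_subalg[OF subalgebra_urn_history selected_measurable_history[of k "Suc k", OF lessI]])

lemma rate_measurable_history [measurable]: "(\<lambda>\<omega>. rate \<omega> i) \<in> borel_measurable (urn_history M A F u n)"
proof (cases "fst i \<in> {1..A}")
  case True
  then show ?thesis using F_measurable_history[OF True] by (simp add: rate_def)
next
  case False
  then have "rate \<omega> i = 1" for \<omega> unfolding rate_def by (rule if_not_P)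
  then show ?thesis by simp
qed

lemma rate_measurable [measurable]: "(\<lambda>\<omega>. rate \<omega> i) \<in> borel_measurable M"
  by (rule measurable_from_subalg[OF subalgebra_urn_history rate_measurable_history])

text \<open>The weight \<open>w\<close> absorbs the selection probabilities of the later steps in the induction.\<close>

lemma selected_path_weighted:
  assumes "set p \<subseteq> {1..A}"
    and w: "\<And>n. w \<in> borel_measurable (urn_history M A F u n)"
    and bound: "\<And>\<omega>. \<omega> \<in> space M \<Longrightarrow> \<bar>w \<omega>\<bar> \<le> 1"
  shows "(\<integral>\<omega>. w \<omega> * indicator {\<omega> \<in> space M. \<forall>k<length p. selected k \<omega> = p ! k} \<omega> \<partial>M)
       = (\<integral>\<omega>. w \<omega> * path_prob A (rate \<omega>) u0 p \<partial>M)"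
  using assms
proof (induction p arbitrary: w rule: rev_induct)
  case Nil
  show ?case by (intro Bochner_Integration.integral_cong) (auto simp: indicator_def)
next
  case (snoc a p)
  have a: "a \<in> {1..A}" and p: "set p \<subseteq> {1..A}" using snoc.prems(1) by auto
  define n where "n = length p"
  let ?H = "urn_history M A F u n"
  interpret H: finite_measure_subalgebra M ?H
    by unfold_locales (rule subalgebra_urn_history)
  define v where "v b = u0 b + count_list p b" for b
  define r where "r \<omega> = rate \<omega> (a, v a) / (\<Sum>b=1..A. rate \<omega> (b, v b))" for \<omega>
  define pre where "pre = {\<omega> \<in> space M. \<forall>k<length p. selected k \<omega> = p ! k}"
  define E where "E = {\<omega> \<in> space M. u a (n + 1) \<omega> = u a n \<omega> + 1}"
  note w [measurable] = snoc.prems(2)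
  have w_M [measurable]: "w \<in> borel_measurable M"
    by (rule measurable_from_subalg[OF subalgebra_urn_history w])
  have "{\<omega> \<in> space ?H. selected k \<omega> = p ! k} \<in> sets ?H" if "k < length p" for k
  proof -
    have "selected k -` {p ! k} \<inter> space ?H \<in> sets ?H"
      using that by (intro measurable_sets[OF selected_measurable_history]) (auto simp: n_def)
    then show ?thesis by (simp only: vimage_def Int_def mem_Collect_eq singleton_iff conj_commute)
  qed
  then have "{\<omega> \<in> space ?H. \<forall>k\<in>{..<length p}. selected k \<omega> = p ! k} \<in> sets ?H"
    by (rule sets.sets_Collect_finite_All) auto
  then have pre_H [measurable]: "pre \<in> sets ?H"
    by (simp only: pre_def space_urn_history Ball_def lessThan_iff)
  then have pre_M [measurable]: "pre \<in> sets M"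
    using subalgebra_urn_history unfolding subalgebra_def by blast
  have [measurable]: "u a m \<in> borel_measurable M" for m
    by (rule measurable_compose[OF u_measurable[OF a], where g = "\<lambda>x. x"]) simp
  have E_M [measurable]: "E \<in> sets M" unfolding E_def by measurable
  \<comment> \<open>\<open>r\<close> depends on the feedback alone, which every history contains
    from the start. Hence \<open>w * r\<close> is an admissible weight for the shorter path.\<close>
  have r_H [measurable]: "r \<in> borel_measurable (urn_history M A F u m)" for m unfolding r_def by measurable
  have r01: "0 \<le> r \<omega>" "r \<omega> \<le> 1" if "\<omega> \<in> space M" for \<omega>
  proof -
    have "rate \<omega> (a, v a) \<le> (\<Sum>b=1..A. rate \<omega> (b, v b))"
      using a rate_pos[OF that] by (intro member_le_sum) (auto intro: less_imp_le)
    moreover have "0 < rate \<omega> (a, v a)" by (rule rate_pos[OF that])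
    ultimately show "0 \<le> r \<omega>" "r \<omega> \<le> 1" by (auto simp: r_def divide_le_eq)
  qed
  have pre_E: "indicator {\<omega> \<in> space M. \<forall>k<length (p @ [a]). selected k \<omega> = (p @ [a]) ! k} \<omega>
      = (indicator pre \<omega> * indicator E \<omega> :: real)" if "\<omega> \<in> space M" for \<omega>
  proof -
    have "(\<forall>k<length (p @ [a]). selected k \<omega> = (p @ [a]) ! k) \<longleftrightarrow>
        (\<forall>k<length p. selected k \<omega> = p ! k) \<and> selected n \<omega> = a"
      by (auto simp: n_def nth_append less_Suc_eq)
    then show ?thesis
      using that a selected_iff[OF that, of n a] by (simp add: pre_def E_def indicator_def)
  qed
  have int: "integrable M (\<lambda>\<omega>. (w \<omega> * indicator pre \<omega>) * indicator E \<omega>)"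
    using snoc.prems(3) by (intro integrable_const_bound[where B=1] AE_I2) (auto simp: indicator_def)
  have "(\<integral>\<omega>. w \<omega> * indicator {\<omega> \<in> space M. \<forall>k<length (p @ [a]). selected k \<omega> = (p @ [a]) ! k} \<omega> \<partial>M)
      = (\<integral>\<omega>. (w \<omega> * indicator pre \<omega>) * indicator E \<omega> \<partial>M)"
    using pre_E by (intro Bochner_Integration.integral_cong) (auto simp: mult.assoc)
  also have "\<dots> = (\<integral>\<omega>. (w \<omega> * indicator pre \<omega>) * real_cond_exp M ?H (indicator E) \<omega> \<partial>M)"
    by (rule H.real_cond_exp_intg(2)[symmetric, OF int]) measurable
  also have "\<dots> = (\<integral>\<omega>. (w \<omega> * r \<omega>) * indicator pre \<omega> \<partial>M)"
  proof (rule integral_cong_AE)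
    show "AE \<omega> in M. (w \<omega> * indicator pre \<omega>) * real_cond_exp M ?H (indicator E) \<omega> = (w \<omega> * r \<omega>) * indicator pre \<omega>"
      using selection[OF a, of n] AE_space
    proof eventually_elim
      case (elim \<omega>)
      show ?case
      proof (cases "\<omega> \<in> pre")
        case True
        \<comment> \<open>Along the prefix \<open>p\<close> the sizes are determined, so the random
          selection probability is the explicit ratio \<open>r\<close>.\<close>
        have "u b n \<omega> = v b" if "b \<in> {1..A}" for b
          using u_eq_urn_count[OF elim(2) that, of n] urn_count_path[of p "\<lambda>k. selected k \<omega>" u0 b] True
          by (auto simp: pre_def v_def n_def)
        then have "F a (u a n \<omega>) \<omega> / (\<Sum>b=1..A. F b (u b n \<omega>) \<omega>) = r \<omega>"
          using a by (auto simp: r_def rate_def intro!: arg_cong2[where f="(/)"] sum.cong)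
        with elim(1) show ?thesis by (simp add: E_def)
      qed simp
    qed
    have "r \<in> borel_measurable M" by (rule measurable_from_subalg[OF subalgebra_urn_history r_H])
    then show "(\<lambda>\<omega>. w \<omega> * r \<omega> * indicator pre \<omega>) \<in> borel_measurable M" by measurable
  qed measurable
  also have "\<dots> = (\<integral>\<omega>. (w \<omega> * r \<omega>) * path_prob A (rate \<omega>) u0 p \<partial>M)"
    unfolding pre_def
  proof (rule snoc.IH[OF p])
    show "\<bar>w \<omega> * r \<omega>\<bar> \<le> 1" if "\<omega> \<in> space M" for \<omega>
      using snoc.prems(3)[OF that] r01[OF that] by (simp add: abs_mult mult_le_one)
  qed measurable
  also have "\<dots> = (\<integral>\<omega>. w \<omega> * path_prob A (rate \<omega>) u0 (p @ [a]) \<partial>M)"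
    by (simp add: path_prob_append r_def v_def mult_ac)
  finally show ?case .
qed

lemma path_prob_measurable [measurable]: "(\<lambda>\<omega>. path_prob A (rate \<omega>) v p) \<in> borel_measurable M"
  by (induction p arbitrary: v) simp_all

lemma path_prob_nonneg: "\<omega> \<in> space M \<Longrightarrow> 0 \<le> path_prob A (rate \<omega>) v p"
  by (induction p arbitrary: v)
    (auto intro!: mult_nonneg_nonneg divide_nonneg_nonneg sum_nonneg less_imp_le[OF rate_pos])

lemma path_prob_le_1:
  assumes "\<omega> \<in> space M" "set p \<subseteq> {1..A}"
  shows "path_prob A (rate \<omega>) v p \<le> 1"
  using assms(2)
proof (induction p arbitrary: v)
  case (Cons a p)
  have "rate \<omega> (a, v a) \<le> (\<Sum>b=1..A. rate \<omega> (b, v b))"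
    using Cons.prems rate_pos[OF assms(1)] by (intro member_le_sum) (auto intro: less_imp_le)
  moreover have "0 < rate \<omega> (a, v a)" by (rule rate_pos[OF assms(1)])
  ultimately have "rate \<omega> (a, v a) / (\<Sum>b=1..A. rate \<omega> (b, v b)) \<le> 1" by (simp add: divide_le_eq)
  then show ?case
    unfolding path_prob.simps using Cons path_prob_nonneg[OF assms(1)] by (intro mult_le_one) auto
qed simp

lemma selected_path_law:
  assumes "set p \<subseteq> {1..A}"
  shows "emeasure M {\<omega> \<in> space M. \<forall>k<length p. selected k \<omega> = p ! k}
       = (\<integral>\<^sup>+\<omega>. ennreal (path_prob A (rate \<omega>) u0 p) \<partial>M)"
proof -
  let ?E = "{\<omega> \<in> space M. \<forall>k<length p. selected k \<omega> = p ! k}"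
  have "emeasure M ?E = ennreal (\<integral>\<omega>. 1 * indicator ?E \<omega> \<partial>M)"
    by (simp add: emeasure_eq_measure)
  also have "\<dots> = ennreal (\<integral>\<omega>. 1 * path_prob A (rate \<omega>) u0 p \<partial>M)"
    by (subst selected_path_weighted[OF assms]) auto
  also have "\<dots> = (\<integral>\<^sup>+\<omega>. ennreal (path_prob A (rate \<omega>) u0 p) \<partial>M)"
    using path_prob_nonneg path_prob_le_1[OF _ assms]
    by (subst nn_integral_eq_integral) (auto intro!: integrable_const_bound[where B=1])
  finally show ?thesis .
qed

end

lemma emeasure_prefix_sum:
  fixes c :: "'a \<Rightarrow> nat \<Rightarrow> nat"
  assumes [measurable]: "\<And>k. (\<lambda>\<omega>. c \<omega> k) \<in> M \<rightarrow>\<^sub>M count_space UNIV"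
    and "finite I" and c: "\<And>\<omega> k. \<omega> \<in> space M \<Longrightarrow> c \<omega> k \<in> I"
  shows "emeasure M {\<omega> \<in> space M. R (map (c \<omega>) [0..<n])}
      = (\<Sum>p | set p \<subseteq> I \<and> length p = n \<and> R p. emeasure M {\<omega> \<in> space M. \<forall>k<length p. c \<omega> k = p ! k})"
proof -
  let ?P = "{p. set p \<subseteq> I \<and> length p = n \<and> R p}"
  let ?E = "\<lambda>p. {\<omega> \<in> space M. \<forall>k<length p. c \<omega> k = p ! k}"
  have fin: "finite ?P"
    by (rule finite_subset[OF _ finite_lists_length_eq[OF \<open>finite I\<close>, of n]]) auto
  have eq: "{\<omega> \<in> space M. R (map (c \<omega>) [0..<n])} = (\<Union>p\<in>?P. ?E p)"
  proof (intro set_eqI iffI)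
    fix \<omega> assume "\<omega> \<in> {\<omega> \<in> space M. R (map (c \<omega>) [0..<n])}"
    then show "\<omega> \<in> (\<Union>p\<in>?P. ?E p)"
      using c by (intro UN_I[of "map (c \<omega>) [0..<n]"]) auto
  next
    fix \<omega> assume "\<omega> \<in> (\<Union>p\<in>?P. ?E p)"
    then obtain p where p: "length p = n" "R p" "\<omega> \<in> space M" "\<forall>k<length p. c \<omega> k = p ! k" by auto
    then have "map (c \<omega>) [0..<n] = p" by (intro nth_equalityI) auto
    with p show "\<omega> \<in> {\<omega> \<in> space M. R (map (c \<omega>) [0..<n])}" by simp
  qed
  have "disjoint_family_on ?E ?P"
  proof (unfold disjoint_family_on_def, intro ballI impI equals0I)
    fix p q \<omega> assume pq: "p \<in> ?P" "q \<in> ?P" "p \<noteq> q" and "\<omega> \<in> ?E p \<inter> ?E q"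
    then have "p = q" by (intro nth_equalityI) auto
    with pq show False by simp
  qed
  moreover have "?E p \<in> sets M" for p by measurable
  ultimately show ?thesis unfolding eq by (intro sum_emeasure[symmetric] fin) auto
qed

text \<open>A cylinder over finitely many steps depends on a prefix of some length \<open>n\<close>.
  As \<open>I\<close> is finite, its probability is a finite sum over such prefixes, and the
  cylinders determine the law.\<close>

lemma distr_eq_if_prefixes:
  fixes c :: "'a \<Rightarrow> nat \<Rightarrow> nat" and c' :: "'b \<Rightarrow> nat \<Rightarrow> nat"
  assumes "prob_space M" and m: "\<And>k. (\<lambda>\<omega>. c \<omega> k) \<in> M \<rightarrow>\<^sub>M count_space UNIV"
    "\<And>k. (\<lambda>\<omega>. c' \<omega> k) \<in> N \<rightarrow>\<^sub>M count_space UNIV"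
    and I: "finite I" "\<And>\<omega> k. \<omega> \<in> space M \<Longrightarrow> c \<omega> k \<in> I" "\<And>\<omega> k. \<omega> \<in> space N \<Longrightarrow> c' \<omega> k \<in> I"
    and eq: "\<And>p. set p \<subseteq> I \<Longrightarrow> emeasure M {\<omega> \<in> space M. \<forall>k<length p. c \<omega> k = p ! k} =
      emeasure N {\<omega> \<in> space N. \<forall>k<length p. c' \<omega> k = p ! k}"
  shows "distr M (PiM UNIV (\<lambda>_. count_space UNIV)) c = distr N (PiM UNIV (\<lambda>_. count_space UNIV)) c'"
proof (rule measure_eqI_PiM_infinite)
  have mc: "c \<in> M \<rightarrow>\<^sub>M PiM UNIV (\<lambda>_. count_space UNIV)" "c' \<in> N \<rightarrow>\<^sub>M PiM UNIV (\<lambda>_. count_space UNIV)"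
    using m by (auto intro!: measurable_PiM_single')
  show "finite_measure (distr M (PiM UNIV (\<lambda>_. count_space UNIV)) c)"
    by (intro prob_space.finite_measure prob_space.prob_space_distr assms mc)
  fix B :: "nat \<Rightarrow> nat set" and J :: "nat set" assume J: "finite J"
  then obtain n where n: "J \<subseteq> {..<n}" using finite_nat_iff_bounded by blast
  define R where "R p = (\<forall>j\<in>J. p ! j \<in> B j)" for p
  let ?X = "prod_emb UNIV (\<lambda>_. count_space UNIV) J (Pi\<^sub>E J B)"
  have X: "?X \<in> sets (PiM UNIV (\<lambda>_. count_space UNIV))"
    using J by (intro sets_PiM_I) auto
  have mem: "x \<in> ?X \<longleftrightarrow> R (map x [0..<n])" for x
  proof -
    have "map x [0..<n] ! j = x j" if "j \<in> J" for j using that n by auto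
    then show ?thesis by (auto simp: prod_emb_def R_def PiE_iff)
  qed
  have "emeasure (distr M (PiM UNIV (\<lambda>_. count_space UNIV)) c) ?X = emeasure M {\<omega> \<in> space M. R (map (c \<omega>) [0..<n])}"
    by (subst emeasure_distr[OF mc(1) X]) (auto simp: mem intro!: arg_cong[where f="emeasure M"])
  also have "\<dots> = emeasure N {\<omega> \<in> space N. R (map (c' \<omega>) [0..<n])}"
    using eq by (subst (1 2) emeasure_prefix_sum[where I=I]) (auto intro!: m I sum.cong)
  also have "\<dots> = emeasure (distr N (PiM UNIV (\<lambda>_. count_space UNIV)) c') ?X"
    by (subst emeasure_distr[OF mc(2) X]) (auto simp: mem intro!: arg_cong[where f="emeasure N"])
  finally show "emeasure (distr M (PiM UNIV (\<lambda>_. count_space UNIV)) c) ?X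
      = emeasure (distr N (PiM UNIV (\<lambda>_. count_space UNIV)) c') ?X" .
qed auto

lemma measurable_urn_count [measurable]:
  "(\<lambda>c. urn_count v c a n) \<in> PiM UNIV (\<lambda>_. count_space UNIV) \<rightarrow>\<^sub>M count_space UNIV"
proof (induction n)
  case (Suc n)
  note [measurable] = Suc
  show ?case unfolding urn_count_Suc by measurable
qed simp

lemma monopoly_cong: "(\<And>a. a \<in> {1..A} \<Longrightarrow> v a = v' a) \<Longrightarrow> monopoly A v \<longleftrightarrow> monopoly A v'"
  unfolding monopoly_def by (intro arg_cong[where f=Ex1] ext) auto

lemma strict_leadership_cong:
  assumes "\<And>a. a \<in> {1..A} \<Longrightarrow> v a = v' a"
  shows "strict_leadership A v \<longleftrightarrow> strict_leadership A v'"
  unfolding strict_leadership_def using assms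
  by (intro bex_cong refl eventually_cong always_eventually allI ball_cong) auto

lemma pred_monopoly: "Measurable.pred (PiM UNIV (\<lambda>_. count_space UNIV)) (\<lambda>c. monopoly A (urn_count v c))"
proof -
  have "{c \<in> space (PiM UNIV (\<lambda>_. count_space UNIV)). filterlim (urn_count v c a) at_top sequentially}
      \<in> sets (PiM UNIV (\<lambda>_. count_space UNIV))" for a
    unfolding filterlim_at_top eventually_sequentially by measurable
  then show ?thesis
    unfolding monopoly_def pred_def by (intro sets.sets_Collect_countable_Ex1') auto
qed

lemma pred_strict_leadership:
  "Measurable.pred (PiM UNIV (\<lambda>_. count_space UNIV)) (\<lambda>c. strict_leadership A (urn_count v c))"
proof -
  let ?S = "PiM UNIV (\<lambda>_::nat. count_space (UNIV :: nat set))"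
  have "{c \<in> space ?S. urn_count v c a' n < urn_count v c a n} \<in> sets ?S" for a a' n
  proof -
    have [measurable]: "(\<lambda>c. urn_count v c a n) \<in> borel_measurable ?S" for a
      by (rule measurable_compose[OF measurable_urn_count, where g = "\<lambda>x. x"]) simp
    show ?thesis by measurable
  qed
  then show ?thesis
    unfolding strict_leadership_def eventually_sequentially pred_def
    by (intro sets.sets_Collect_countable_Ex' sets.sets_Collect_countable_Ex
        sets.sets_Collect_countable_All sets.sets_Collect_imp sets.sets_Collect_const
        sets.sets_Collect_countable_All') auto
qed

lemma emeasure_clocks_UNIV [simp]: "emeasure clocks UNIV = 1"
  using prob_space.emeasure_space_1[OF prob_space_clocks] by (simp only: space_clocks)

lemma measurable_clocks_component [measurable]: "(\<lambda>e. e i) \<in> borel_measurable clocks"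
  by (simp add: measurable_cong_sets[OF sets_clocks refl])

lemma nn_integral_clocks_prod:
  fixes g :: "nat \<times> nat \<Rightarrow> real \<Rightarrow> ennreal"
  assumes "finite K" and g: "\<And>i. g i \<in> borel_measurable borel"
  shows "(\<integral>\<^sup>+e. (\<Prod>i\<in>K. g i (e i)) \<partial>clocks) = (\<Prod>i\<in>K. \<integral>\<^sup>+x. g i x \<partial>clock)"
  using assms(1)
proof (induction K)
  case empty
  show ?case by simp
next
  case (insert k K)
  note [measurable] = g
  have [simp]: "(\<Prod>i\<in>K. g i (if i = k then x else e i)) = (\<Prod>i\<in>K. g i (e i))" for e x
    using insert.hyps by (intro prod.cong) auto
  have "(\<integral>\<^sup>+e. (\<Prod>i\<in>insert k K. g i (e i)) \<partial>clocks) =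
      (\<integral>\<^sup>+x. \<integral>\<^sup>+e. g k x * (\<Prod>i\<in>K. g i (e i)) \<partial>clocks \<partial>clock)"
    using insert.hyps by (subst nn_integral_clocks_split(1)[of _ k]) auto
  also have "\<dots> = (\<integral>\<^sup>+x. g k x * (\<integral>\<^sup>+e. (\<Prod>i\<in>K. g i (e i)) \<partial>clocks) \<partial>clock)"
    by (intro nn_integral_cong nn_integral_cmult) measurable
  also have "\<dots> = (\<integral>\<^sup>+x. g k x \<partial>clock) * (\<integral>\<^sup>+e. (\<Prod>i\<in>K. g i (e i)) \<partial>clocks)"
    by (rule nn_integral_multc) (use g in \<open>simp add: measurable_cong_sets[OF sets_clock refl]\<close>)
  finally show ?case using insert by simp
qed

lemma AE_clocks_nonneg: "AE e in clocks. \<forall>i. 0 \<le> e i"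
  unfolding AE_all_countable clocks_def
  by (intro allI AE_PiM_component prob_space_clock AE_clock_nonneg) auto

text \<open>With all clocks but one frozen, \<open>Q\<close> can hold for at most one value of the
  remaining clock, and the exponential law has no atoms.\<close>

lemma AE_clocks_resample:
  assumes [measurable]: "Measurable.pred clocks Q"
    and uniq: "\<And>e x y. Q (e(i := x)) \<Longrightarrow> Q (e(i := y)) \<Longrightarrow> x = y"
  shows "AE e in clocks. \<not> Q e"
proof -
  have "{e \<in> space clocks. Q e} \<in> sets clocks" by measurable
  then have E: "{e. Q e} \<in> sets clocks" by simp
  have "emeasure clocks {e. Q e} = (\<integral>\<^sup>+e. indicator {e. Q e} e \<partial>clocks)"
    using E by simp
  also have "\<dots> = (\<integral>\<^sup>+e. \<integral>\<^sup>+x. indicator {e. Q e} (e(i := x)) \<partial>clock \<partial>clocks)"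
    using E by (intro nn_integral_clocks_split(2)) simp
  also have "\<dots> = (\<integral>\<^sup>+e. 0 \<partial>clocks)"
  proof (intro nn_integral_cong)
    fix e
    obtain s where s: "\<And>x. Q (e(i := x)) \<Longrightarrow> x = s" using uniq by metis
    have "(\<integral>\<^sup>+x. indicator {e. Q e} (e(i := x)) \<partial>clock) = (\<integral>\<^sup>+x. 0 \<partial>clock)"
      by (rule nn_integral_cong_AE, rule AE_mp[OF AE_clock_neq[of s]]) (use s in \<open>auto intro!: AE_I2 simp: indicator_def\<close>)
    then show "(\<integral>\<^sup>+x. indicator {e. Q e} (e(i := x)) \<partial>clock) = (0 :: ennreal)" by simp
  qed
  finally have "{e. Q e} \<in> null_sets clocks" using E by (auto intro!: null_setsI)
  from AE_not_in[OF this] show ?thesis by simp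
qed

section \<open>The race driven by the random feedback\<close>

context balls_in_bins
begin

text \<open>From the first factor only the feedback enters, through \<open>rate\<close>; the
  selections on this space are those of the race.\<close>

definition joint :: "('w \<times> (nat \<times> nat \<Rightarrow> real)) measure" where
  "joint = M \<Otimes>\<^sub>M clocks"

definition hold :: "nat \<times> nat \<Rightarrow> 'w \<times> (nat \<times> nat \<Rightarrow> real) \<Rightarrow> real" where
  "hold i z = snd z i / rate (fst z) i"

lemma prob_space_joint: "prob_space joint"
  unfolding joint_def by (intro prob_space_pair prob_space_axioms prob_space_clocks)

sublocale clocks: prob_space clocks by (rule prob_space_clocks)
sublocale pair: pair_prob_space M clocks ..
sublocale joint: prob_space joint by (rule prob_space_joint)

lemma space_joint [simp]: "space joint = space M \<times> UNIV"
  by (simp add: joint_def space_pair_measure)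

lemma measurable_fst_joint [measurable]: "fst \<in> joint \<rightarrow>\<^sub>M M"
  and measurable_snd_joint [measurable]: "snd \<in> joint \<rightarrow>\<^sub>M clocks"
  by (simp_all add: joint_def)

lemma hold_measurable [measurable]: "hold i \<in> borel_measurable joint"
  unfolding hold_def[abs_def]
  by (intro borel_measurable_divide measurable_compose[OF measurable_snd_joint measurable_clocks_component]
      measurable_compose[OF measurable_fst_joint rate_measurable])

lemma nn_integral_joint:
  assumes "f \<in> borel_measurable joint"
  shows "(\<integral>\<^sup>+z. f z \<partial>joint) = (\<integral>\<^sup>+\<omega>. \<integral>\<^sup>+e. f (\<omega>, e) \<partial>clocks \<partial>M)"
  using clocks.nn_integral_fst[of f M] assms by (simp add: joint_def)

lemma race_measurable: "(\<lambda>z. race A u0 (\<lambda>i. hold i z) k) \<in> joint \<rightarrow>\<^sub>M count_space UNIV"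
  by (rule measurable_race) (rule hold_measurable)

lemma race_path_law_joint:
  assumes p: "set p \<subseteq> {1..A}"
  shows "emeasure joint {z \<in> space joint. \<forall>k<length p. race A u0 (\<lambda>i. hold i z) k = p ! k}
      = (\<integral>\<^sup>+\<omega>. ennreal (path_prob A (rate \<omega>) u0 p) \<partial>M)"
proof -
  note [measurable] = race_measurable
  let ?E = "{z \<in> space joint. \<forall>k<length p. race A u0 (\<lambda>i. hold i z) k = p ! k}"
  have E: "?E \<in> sets joint" by measurable
  have "emeasure joint ?E = (\<integral>\<^sup>+z. indicator ?E z \<partial>joint)"
    by (rule nn_integral_indicator[OF E, symmetric])
  also have "\<dots> = (\<integral>\<^sup>+\<omega>. \<integral>\<^sup>+e. indicator ?E (\<omega>, e) \<partial>clocks \<partial>M)"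
    by (rule nn_integral_joint[OF borel_measurable_indicator[OF E]])
  also have "\<dots> = (\<integral>\<^sup>+\<omega>. ennreal (path_prob A (rate \<omega>) u0 p) \<partial>M)"
  proof (intro nn_integral_cong)
    fix \<omega> assume \<omega>: "\<omega> \<in> space M"
    let ?S = "{e. \<forall>k<length p. race A u0 (\<lambda>i. e i / rate \<omega> i) k = p ! k}"
    have [measurable]: "(\<lambda>e. race A u0 (\<lambda>i. e i / rate \<omega> i) k) \<in> clocks \<rightarrow>\<^sub>M count_space UNIV" for k
      by (rule measurable_race) measurable
    have "{e \<in> space clocks. \<forall>k<length p. race A u0 (\<lambda>i. e i / rate \<omega> i) k = p ! k} \<in> sets clocks"
      by measurable
    then have "?S \<in> sets clocks" by simp
    moreover have "indicator ?E (\<omega>, e) = (indicator ?S e :: ennreal)" for e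
      using \<omega> by (simp add: indicator_def hold_def)
    ultimately have "(\<integral>\<^sup>+e. indicator ?E (\<omega>, e) \<partial>clocks) = emeasure clocks ?S" by simp
    also have "\<dots> = ennreal (path_prob A (rate \<omega>) u0 p)"
      by (rule race_path_law[OF rate_pos[OF \<omega>] p])
    finally show "(\<integral>\<^sup>+e. indicator ?E (\<omega>, e) \<partial>clocks) = ennreal (path_prob A (rate \<omega>) u0 p)" .
  qed
  finally show ?thesis .
qed

text \<open>On both spaces a finite path has as its probability the mean of \<open>path_prob\<close>
  over the feedback.\<close>

lemma selection_law:
  assumes "1 \<le> A"
  shows "distr M (PiM UNIV (\<lambda>_. count_space UNIV)) (\<lambda>\<omega> k. selected k \<omega>)
    = distr joint (PiM UNIV (\<lambda>_. count_space UNIV)) (\<lambda>z k. race A u0 (\<lambda>i. hold i z) k)"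
proof (rule distr_eq_if_prefixes[where I="{1..A}"])
  show "emeasure M {\<omega> \<in> space M. \<forall>k<length p. selected k \<omega> = p ! k} =
      emeasure joint {z \<in> space joint. \<forall>k<length p. race A u0 (\<lambda>i. hold i z) k = p ! k}"
    if "set p \<subseteq> {1..A}" for p
    using selected_path_law[OF that] race_path_law_joint[OF that] by simp
qed (rule prob_space_axioms selected_measurable race_measurable finite_atLeastAtMost selected_in race_in[OF assms] | assumption)+

lemma prob_transfer:
  assumes "1 \<le> A" and Q: "Measurable.pred (PiM UNIV (\<lambda>_. count_space UNIV)) Q"
  shows "\<P>(\<omega> in M. Q (\<lambda>k. selected k \<omega>)) = \<P>(z in joint. Q (race A u0 (\<lambda>i. hold i z)))"
proof -
  let ?S = "PiM UNIV (\<lambda>_::nat. count_space (UNIV :: nat set))"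
  have m: "(\<lambda>\<omega> k. selected k \<omega>) \<in> M \<rightarrow>\<^sub>M ?S" "(\<lambda>z k. race A u0 (\<lambda>i. hold i z) k) \<in> joint \<rightarrow>\<^sub>M ?S"
    using race_measurable by (auto intro!: measurable_PiM_single')
  have X: "{c \<in> space ?S. Q c} \<in> sets ?S" using Q by simp
  have "\<P>(\<omega> in M. Q (\<lambda>k. selected k \<omega>)) = measure (distr M ?S (\<lambda>\<omega> k. selected k \<omega>)) {c \<in> space ?S. Q c}"
    by (subst measure_distr[OF m(1) X]) (auto simp: space_PiM intro!: arg_cong[where f=prob])
  also have "\<dots> = measure (distr joint ?S (\<lambda>z k. race A u0 (\<lambda>i. hold i z) k)) {c \<in> space ?S. Q c}"
    by (simp only: selection_law[OF assms(1)])
  also have "\<dots> = \<P>(z in joint. Q (race A u0 (\<lambda>i. hold i z)))"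
    by (subst measure_distr[OF m(2) X]) (auto simp: space_PiM intro!: arg_cong[where f="measure joint"])
  finally show ?thesis .
qed

lemma AE_hold_nonneg: "AE z in joint. \<forall>i. 0 \<le> hold i z"
proof -
  have m: "Measurable.pred joint (\<lambda>z. \<forall>i. 0 \<le> hold i z)" by measurable
  have "AE \<omega> in M. AE e in clocks. \<forall>i. 0 \<le> hold i (\<omega>, e)"
  proof (rule AE_I2)
    fix \<omega> assume \<omega>: "\<omega> \<in> space M"
    show "AE e in clocks. \<forall>i. 0 \<le> hold i (\<omega>, e)"
      using AE_clocks_nonneg
      by eventually_elim (simp add: hold_def less_imp_le[OF rate_pos[OF \<omega>]])
  qed
  then show ?thesis
    unfolding joint_def using m
    by (intro pair.AE_pair_measure[of "\<lambda>z. \<forall>i. 0 \<le> hold i z"]) (simp_all add: joint_def pred_def)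
qed

text \<open>Changing the first clock of urn \<open>a\<close> moves all late differences by one
  constant, so at most one value of it makes the limit 0. Phrasing the tie through differences, not
  through limits of the separate sums, lets it serve both monopoly and leadership.\<close>

lemma AE_no_tie:
  assumes ab: "a \<in> {1..A}" "b \<in> {1..A}" "a \<noteq> b"
  shows "AE z in joint. \<not> (\<lambda>l. (\<Sum>j=u0 a..l. hold (a, j) z) - (\<Sum>j=u0 b..l. hold (b, j) z)) \<longlonglongrightarrow> 0"
proof -
  define Q where "Q z \<longleftrightarrow> (\<lambda>l. (\<Sum>j=u0 a..l. hold (a, j) z) - (\<Sum>j=u0 b..l. hold (b, j) z)) \<longlonglongrightarrow> 0" for z
  have Qm: "Measurable.pred joint Q" unfolding Q_def by measurable
  have "AE \<omega> in M. AE e in clocks. \<not> Q (\<omega>, e)"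
  proof (rule AE_I2, rule AE_clocks_resample[where i="(a, u0 a)"])
    fix \<omega> assume \<omega>: "\<omega> \<in> space M"
    have "(\<lambda>e. (\<omega>, e)) \<in> clocks \<rightarrow>\<^sub>M joint" unfolding joint_def using \<omega> by measurable
    from measurable_compose[OF this Qm] show "Measurable.pred clocks (\<lambda>e. Q (\<omega>, e))" .
    fix e x y assume Q: "Q (\<omega>, e((a, u0 a) := x))" "Q (\<omega>, e((a, u0 a) := y))"
    define D where "D x l = (\<Sum>j=u0 a..l. hold (a, j) (\<omega>, e((a, u0 a) := x))) - (\<Sum>j=u0 b..l. hold (b, j) (\<omega>, e((a, u0 a) := x)))" for x l
    have "D x l - D y l = (x - y) / rate \<omega> (a, u0 a)" if "u0 a \<le> l" for l
    proof -
      have "(\<Sum>j=u0 a..l. hold (a, j) (\<omega>, e((a, u0 a) := w))) =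
          w / rate \<omega> (a, u0 a) + (\<Sum>j=Suc (u0 a)..l. hold (a, j) (\<omega>, e))" for w
      proof -
        have "(\<Sum>j=Suc (u0 a)..l. hold (a, j) (\<omega>, e((a, u0 a) := w))) = (\<Sum>j=Suc (u0 a)..l. hold (a, j) (\<omega>, e))"
          by (intro sum.cong) (auto simp: hold_def)
        then show ?thesis using that by (simp add: sum.atLeast_Suc_atMost hold_def)
      qed
      moreover have "(\<Sum>j=u0 b..l. hold (b, j) (\<omega>, e((a, u0 a) := w))) = (\<Sum>j=u0 b..l. hold (b, j) (\<omega>, e))" for w
        using ab(3) by (intro sum.cong) (auto simp: hold_def)
      ultimately show ?thesis by (simp add: D_def diff_divide_distrib)
    qed
    then have "(\<lambda>l. D x l - D y l) \<longlonglongrightarrow> (x - y) / rate \<omega> (a, u0 a)"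
      by (intro tendsto_eventually eventually_sequentiallyI)
    moreover have "(\<lambda>l. D x l - D y l) \<longlonglongrightarrow> 0 - 0"
      using Q unfolding Q_def D_def by (rule tendsto_diff)
    ultimately have "(x - y) / rate \<omega> (a, u0 a) = 0 - 0" by (rule LIMSEQ_unique)
    then show "x = y" using rate_pos[OF \<omega>, of "(a, u0 a)"] by simp
  qed
  then have "AE z in joint. \<not> Q z"
    unfolding joint_def using Qm
    by (intro pair.AE_pair_measure[of "\<lambda>z. \<not> Q z"]) (simp_all add: joint_def pred_def)
  then show ?thesis by (simp add: Q_def)
qed

end

section \<open>Convergence criteria for the holding times\<close>

lemma nn_integral_clock_ge:
  assumes "0 \<le> s"
  shows "(\<integral>\<^sup>+x. indicator {s..} x \<partial>clock) = ennreal (exp (- s))"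
proof -
  have "(\<integral>\<^sup>+x. indicator {s..} x \<partial>clock) = (\<integral>\<^sup>+x. (if s \<le> x then 1 else 0) \<partial>clock)"
    by (intro nn_integral_cong) (auto simp: indicator_def)
  also have "\<dots> = ennreal (exp (- s)) * (\<integral>\<^sup>+x. 1 \<partial>clock)"
    by (rule clock_memoryless) (use assms in auto)
  also have "\<dots> = ennreal (exp (- s))"
    using prob_space.emeasure_space_1[OF prob_space_clock] by simp
  finally show ?thesis .
qed

lemma nn_integral_clock_le_pos:
  assumes "0 < s"
  shows "0 < (\<integral>\<^sup>+x. indicator {..s} x \<partial>clock)"
proof -
  interpret C: prob_space clock by (rule prob_space_clock)
  have "emeasure clock {s..} = ennreal (exp (- s))"
    using nn_integral_clock_ge[of s] assms by simp
  then have "C.prob {s..} = exp (- s)" by (simp add: C.emeasure_eq_measure)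
  moreover have "C.prob ({..s} \<union> {s..}) \<le> C.prob {..s} + C.prob {s..}"
    by (rule measure_Un_le) auto
  moreover have "{..s} \<union> {s..} = space clock" by auto
  ultimately have "1 \<le> C.prob {..s} + exp (- s)" using C.prob_space by simp
  moreover have "exp (- s) < 1" using assms by simp
  ultimately have "0 < C.prob {..s}" by linarith
  then show ?thesis by (simp add: C.emeasure_eq_measure)
qed

lemma nn_integral_clock_moment:
  "(\<integral>\<^sup>+x. ennreal (1 + x ^ p) \<partial>clock) = ennreal (1 + fact p)"
proof -
  have "(\<integral>\<^sup>+x. ennreal (1 + x ^ p) \<partial>clock) = (\<integral>\<^sup>+x. 1 + ennreal (x ^ p) \<partial>clock)"
    by (rule nn_integral_cong_AE, rule AE_mp[OF AE_clock_nonneg]) (auto intro!: AE_I2 simp: ennreal_plus)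
  also have "\<dots> = (\<integral>\<^sup>+x. 1 \<partial>clock) + (\<integral>\<^sup>+x. ennreal (x ^ p) \<partial>clock)"
    by (rule nn_integral_add) (simp_all add: measurable_cong_sets[OF sets_clock refl])
  also have "(\<integral>\<^sup>+x. ennreal (x ^ p) \<partial>clock) = (\<integral>\<^sup>+x. ennreal (exponential_density 1 x * x ^ p) \<partial>lborel)"
    by (subst nn_integral_clock) (auto intro!: nn_integral_cong simp: ennreal_mult' exponential_density_def)
  also have "\<dots> = ennreal (fact p)"
    using nn_integral_erlang_ith_moment[of 1 0 p] by simp
  finally show ?thesis
    using prob_space.emeasure_space_1[OF prob_space_clock] by (simp add: ennreal_plus)
qed

context balls_in_bins
begin

text \<open>Independence acts in two layers: given the feedback, the integral over the clocks
  factorises, and the factors are then functions of distinct, independent feedback values.\<close>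

lemma nn_integral_hold_prod:
  fixes g :: "nat \<times> nat \<Rightarrow> real \<Rightarrow> ennreal"
  assumes K: "finite K" "K \<subseteq> {1..A} \<times> UNIV" and g: "\<And>i. g i \<in> borel_measurable borel"
  shows "(\<integral>\<^sup>+z. (\<Prod>i\<in>K. g i (hold i z)) \<partial>joint)
       = (\<Prod>i\<in>K. \<integral>\<^sup>+\<omega>. \<integral>\<^sup>+x. g i (x / rate \<omega> i) \<partial>clock \<partial>M)"
proof -
  interpret C: prob_space clock by (rule prob_space_clock)
  note [measurable] = g
  define k where "k i r = (\<integral>\<^sup>+x. g i (x / r) \<partial>clock)" for i and r :: real
  have k [measurable]: "k i \<in> borel_measurable borel" for i
  proof -
    have "(\<lambda>(r, x). g i (x / r)) \<in> borel_measurable (borel \<Otimes>\<^sub>M clock)" by measurable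
    from C.borel_measurable_nn_integral[OF this] show ?thesis unfolding k_def[abs_def] .
  qed
  have "(\<lambda>z. \<Prod>i\<in>K. g i (hold i z)) \<in> borel_measurable joint"
    by (intro borel_measurable_prod_ennreal measurable_compose[OF hold_measurable g])
  then have "(\<integral>\<^sup>+z. (\<Prod>i\<in>K. g i (hold i z)) \<partial>joint) = (\<integral>\<^sup>+\<omega>. \<integral>\<^sup>+e. (\<Prod>i\<in>K. g i (hold i (\<omega>, e))) \<partial>clocks \<partial>M)"
    by (rule nn_integral_joint)
  also have "\<dots> = (\<integral>\<^sup>+\<omega>. (\<Prod>i\<in>K. k i (rate \<omega> i)) \<partial>M)"
  proof (rule nn_integral_cong)
    fix \<omega>
    have "(\<integral>\<^sup>+e. (\<Prod>i\<in>K. g i (e i / rate \<omega> i)) \<partial>clocks) = (\<Prod>i\<in>K. k i (rate \<omega> i))"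
      unfolding k_def by (rule nn_integral_clocks_prod[OF K(1), of "\<lambda>i x. g i (x / rate \<omega> i)"]) measurable
    then show "(\<integral>\<^sup>+e. (\<Prod>i\<in>K. g i (hold i (\<omega>, e))) \<partial>clocks) = (\<Prod>i\<in>K. k i (rate \<omega> i))"
      by (simp add: hold_def)
  qed
  also have "\<dots> = (\<Prod>i\<in>K. \<integral>\<^sup>+\<omega>. k i (rate \<omega> i) \<partial>M)"
  proof (rule indep_vars_nn_integral[OF K(1)])
    have "indep_vars (\<lambda>_. borel) (\<lambda>i \<omega>. k i ((case i of (a, j) \<Rightarrow> F a j) \<omega>)) K"
      by (rule indep_vars_compose2[OF indep_vars_subset[OF F_indep K(2)] k])
    then show "indep_vars (\<lambda>_. borel) (\<lambda>i \<omega>. k i (rate \<omega> i)) K"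
      by (rule indep_vars_cong[THEN iffD1, rotated -1]) (use K(2) in \<open>auto simp: rate_def fun_eq_iff\<close>)
  qed simp
  finally show ?thesis by (simp add: k_def)
qed

lemma nn_integral_hold:
  assumes "a \<in> {1..A}" and g: "g \<in> borel_measurable borel"
  shows "(\<integral>\<^sup>+z. g (hold (a, j) z) \<partial>joint) = (\<integral>\<^sup>+\<omega>. \<integral>\<^sup>+x. g (x / F a j \<omega>) \<partial>clock \<partial>M)"
  using nn_integral_hold_prod[of "{(a, j)}" "\<lambda>_. g"] assms by (simp add: rate_def)

lemma indep_hold: "joint.indep_vars (\<lambda>_. borel) hold ({1..A} \<times> UNIV)"
  unfolding joint.indep_vars_def2
proof (intro conjI ballI hold_measurable joint.indep_setsI)
  fix i
  show "{hold i -` B \<inter> space joint |B. B \<in> sets borel} \<subseteq> sets joint"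
    using measurable_sets[OF hold_measurable] by blast
next
  fix E and K :: "(nat \<times> nat) set"
  assume K: "K \<subseteq> {1..A} \<times> UNIV" "finite K" "K \<noteq> {}"
    and "\<forall>i\<in>K. E i \<in> {hold i -` B \<inter> space joint |B. B \<in> sets borel}"
  then obtain B where B: "\<And>i. i \<in> K \<Longrightarrow> B i \<in> sets borel" "\<And>i. i \<in> K \<Longrightarrow> E i = hold i -` B i \<inter> space joint"
    by (simp add: Bex_def) metis
  \<comment> \<open>The value 0 outside \<open>K\<close> makes every \<open>g i\<close> measurable,
    as the product formula asks.\<close>
  define g where "g i = (if i \<in> K then indicator (B i) else (\<lambda>_. 0) :: real \<Rightarrow> ennreal)" for i
  have g: "g i \<in> borel_measurable borel" for i using B(1) by (auto simp: g_def)
  have E: "E i \<in> sets joint" if "i \<in> K" for i using B that measurable_sets[OF hold_measurable] by simp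
  have g_ind: "g i (hold i z) = indicator (E i) z" if "i \<in> K" "z \<in> space joint" for i z
    using that B(2) by (auto simp: g_def indicator_def)
  have single: "emeasure joint (E i) = (\<integral>\<^sup>+\<omega>. \<integral>\<^sup>+x. g i (x / rate \<omega> i) \<partial>clock \<partial>M)" if "i \<in> K" for i
  proof -
    have "emeasure joint (E i) = (\<integral>\<^sup>+z. indicator (E i) z \<partial>joint)"
      by (rule nn_integral_indicator[OF E[OF that], symmetric])
    also have "\<dots> = (\<integral>\<^sup>+z. (\<Prod>i\<in>{i}. g i (hold i z)) \<partial>joint)"
      using g_ind[OF that] by (intro nn_integral_cong) simp
    also have "\<dots> = (\<integral>\<^sup>+\<omega>. \<integral>\<^sup>+x. g i (x / rate \<omega> i) \<partial>clock \<partial>M)"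
      using K(1) that by (subst nn_integral_hold_prod[OF _ _ g]) auto
    finally show ?thesis .
  qed
  have "emeasure joint (\<Inter>i\<in>K. E i) = (\<integral>\<^sup>+z. indicator (\<Inter>i\<in>K. E i) z \<partial>joint)"
    using K E by (intro nn_integral_indicator[symmetric] sets.finite_INT) auto
  also have "\<dots> = (\<integral>\<^sup>+z. (\<Prod>i\<in>K. g i (hold i z)) \<partial>joint)"
  proof (rule nn_integral_cong)
    fix z assume z: "z \<in> space joint"
    have "(\<Prod>i\<in>K. g i (hold i z)) = (\<Prod>i\<in>K. indicator (E i) z)"
      by (intro prod.cong refl g_ind z)
    also have "\<dots> = indicator (\<Inter>i\<in>K. E i) z"
      using K by (auto simp: indicator_def prod.If_cases prod_zero_iff split: if_splits)
    finally show "indicator (\<Inter>i\<in>K. E i) z = (\<Prod>i\<in>K. g i (hold i z))" by simp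
  qed
  also have "\<dots> = (\<Prod>i\<in>K. emeasure joint (E i))"
    using single by (simp add: nn_integral_hold_prod[OF K(2,1) g])
  finally show "joint.prob (\<Inter>i\<in>K. E i) = (\<Prod>i\<in>K. joint.prob (E i))"
    by (simp add: joint.emeasure_eq_measure prod_ennreal ennreal_inj prod_nonneg)
qed

end

text \<open>The summand \<open>x ^ p\<close> of the factor serves the case
  \<open>1 \<le> f ^ p\<close>; the summand 1 serves smaller feedback, where the truncated value on
  the right is 1.\<close>

lemma min_one_scaled_le:
  fixes x f :: real
  assumes "0 \<le> x" "0 < f"
  shows "min 1 ((x / f) ^ p) \<le> (1 + x ^ p) * min 1 (1 / f ^ p)"
proof (cases "1 \<le> f ^ p")
  case True
  then have "min 1 (1 / f ^ p) = 1 / f ^ p" by simp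
  moreover have "(x / f) ^ p \<le> (1 + x ^ p) * (1 / f ^ p)"
    using assms by (simp add: power_divide divide_right_mono)
  ultimately show ?thesis by (simp add: min.coboundedI2)
next
  case False
  then have "min 1 (1 / f ^ p) = 1" using assms by simp
  moreover have "1 \<le> 1 + x ^ p" using assms by simp
  ultimately show ?thesis by (simp add: min.coboundedI1)
qed

text \<open>Keeps only the event that the clock is at least 1, on which the holding time is at least
  \<open>1 / f\<close>.\<close>

lemma min_one_scaled_ge:
  fixes x f :: real
  assumes "0 \<le> x" "0 < f"
  shows "indicator {1..} x * min 1 (1 / f ^ p) \<le> min 1 ((x / f) ^ p)"
proof (cases "1 \<le> x")
  case True
  then have "1 / f ^ p \<le> (x / f) ^ p"
    using assms by (simp add: power_divide divide_right_mono)
  with True show ?thesis by simp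
qed (use assms in simp)

text \<open>The clock of the urn with the smaller feedback has to be the slow one, so that the
  difference is at least \<open>1 / (2 * f)\<close> in both cases.\<close>

lemma min_one_diff_square_ge:
  fixes x y f g :: real
  assumes "0 \<le> x" "0 \<le> y" "0 < f" "0 < g"
  shows "1 / 4 * min 1 (1 / f\<^sup>2) *
      (if f \<le> g then indicator {1..} x * indicator {..1 / 2} y else indicator {1..} y * indicator {..1 / 2} x)
    \<le> min 1 ((x / f - y / g)\<^sup>2)"
proof -
  have main: "1 / 4 * min 1 (1 / f\<^sup>2) \<le> min 1 (d\<^sup>2)" if "1 / (2 * f) \<le> \<bar>d\<bar>" for d
  proof -
    have "(1 / (2 * f))\<^sup>2 \<le> d\<^sup>2" using that assms(3) by (simp flip: abs_le_square_iff)
    then have "1 / 4 * (1 / f\<^sup>2) \<le> d\<^sup>2" by (simp add: power_divide power_mult_distrib)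
    moreover have "min 1 (1 / f\<^sup>2) \<le> 1 / f\<^sup>2" "min 1 (1 / f\<^sup>2) \<le> 1" by (rule min.cobounded2, rule min.cobounded1)
    ultimately have "1 / 4 * min 1 (1 / f\<^sup>2) \<le> d\<^sup>2" "1 / 4 * min 1 (1 / f\<^sup>2) \<le> 1" by linarith+
    then show ?thesis by (intro min.boundedI)
  qed
  have nn: "0 \<le> min 1 ((x / f - y / g)\<^sup>2)" by simp
  show ?thesis
  proof (cases "f \<le> g")
    case True
    show ?thesis
    proof (cases "1 \<le> x \<and> y \<le> 1 / 2")
      case xy: True
      have "y / g \<le> (1 / 2) / f" using True xy assms by (intro frac_le) auto
      moreover have "1 / f \<le> x / f" using xy assms by (intro divide_right_mono) auto
      ultimately have "1 / (2 * f) \<le> \<bar>x / f - y / g\<bar>" by (simp add: field_simps)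
      from main[OF this] show ?thesis using True xy by simp
    next
      case False
      then show ?thesis using True nn by (auto simp: indicator_def)
    qed
  next
    case False
    show ?thesis
    proof (cases "1 \<le> y \<and> x \<le> 1 / 2")
      case xy: True
      have "x / f \<le> (1 / 2) / f" using xy assms by (intro divide_right_mono) auto
      moreover have "1 / f \<le> y / g" using False xy assms by (intro frac_le) auto
      ultimately have "(1 / f) - (1 / 2) / f \<le> \<bar>x / f - y / g\<bar>" by linarith
      moreover have "(1 / f) - (1 / 2) / f = 1 / (2 * f)" using assms by (simp add: field_simps)
      ultimately show ?thesis using main[of "x / f - y / g"] False xy by simp
    next
      case F: False
      then show ?thesis using False nn by (auto simp: indicator_def)
    qed
  qed
qed

lemma min_one_diff_square_le:
  fixes x y :: real
  assumes "0 \<le> x" "0 \<le> y"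
  shows "min 1 ((x - y)\<^sup>2) \<le> min 1 (x\<^sup>2) + min 1 (y\<^sup>2)"
proof -
  have "\<bar>x - y\<bar> \<le> max x y" using assms by auto
  then have "(x - y)\<^sup>2 \<le> (max x y)\<^sup>2" using assms by (simp flip: abs_le_square_iff)
  then have "min 1 ((x - y)\<^sup>2) \<le> min 1 ((max x y)\<^sup>2)" by auto
  also have "\<dots> \<le> min 1 (x\<^sup>2) + min 1 (y\<^sup>2)" by (cases "x \<le> y") (auto simp: max_def)
  finally show ?thesis .
qed

section \<open>Truncated moments of holding times and of their differences\<close>

locale random_feedback_urns =
  balls_in_bins M N X A u0 F u + law: feedback_sequence N X
  for M :: "'w measure" and N :: "'v measure" and X A u0 F u +
  assumes two_urns: "2 \<le> A"
begin

text \<open>The series of these numbers over \<open>j\<close> decides the theorem: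
  \<open>p = 1\<close> for monopoly, \<open>p = 2\<close> for leadership. Truncation keeps them
  finite for every law of the feedback.\<close>

definition moment :: "nat \<Rightarrow> nat \<Rightarrow> real" where
  "moment p j = law.expectation (\<lambda>\<eta>. min 1 (1 / X j \<eta> ^ p))"

lemma X_measurable [measurable]: "X j \<in> borel_measurable N"
  using law.X_indep by (auto simp: law.indep_vars_def)

lemma F_marginal:
  assumes a: "a \<in> {1..A}"
  shows "distr M borel (F a j) = distr N borel (X j)"
proof -
  have mF: "(\<lambda>\<omega> j. F a j \<omega>) \<in> M \<rightarrow>\<^sub>M PiM UNIV (\<lambda>_. borel)"
    by (intro measurable_PiM_single' F_measurable[OF a]) auto
  have mX: "(\<lambda>\<eta> j. X j \<eta>) \<in> N \<rightarrow>\<^sub>M PiM UNIV (\<lambda>_. borel)"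
    by (intro measurable_PiM_single' X_measurable) auto
  have mj: "(\<lambda>f. f j) \<in> PiM UNIV (\<lambda>_. borel) \<rightarrow>\<^sub>M (borel :: real measure)" by simp
  have "distr (distr M (PiM UNIV (\<lambda>_. borel)) (\<lambda>\<omega> j. F a j \<omega>)) borel (\<lambda>f. f j) =
      distr (distr N (PiM UNIV (\<lambda>_. borel)) (\<lambda>\<eta> j. X j \<eta>)) borel (\<lambda>f. f j)"
    by (simp only: F_law[OF a])
  then show ?thesis by (simp add: distr_distr[OF mj mF] distr_distr[OF mj mX] comp_def)
qed

lemma nn_integral_F:
  assumes "a \<in> {1..A}" and g: "g \<in> borel_measurable borel"
  shows "(\<integral>\<^sup>+\<omega>. g (F a j \<omega>) \<partial>M) = (\<integral>\<^sup>+\<eta>. g (X j \<eta>) \<partial>N)"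
  using nn_integral_distr[OF F_measurable[OF assms(1), of j], of g] g
    nn_integral_distr[OF X_measurable[of j], of g] F_marginal[OF assms(1), of j] by simp

lemma min_X_bounds:
  assumes "\<eta> \<in> space N"
  shows "0 \<le> min 1 (1 / X j \<eta> ^ p)" "min 1 (1 / X j \<eta> ^ p) \<le> 1"
  using law.X_pos[OF assms, of j] by simp_all

lemma integrable_min_X: "integrable N (\<lambda>\<eta>. min 1 (1 / X j \<eta> ^ p))"
  using min_X_bounds by (intro law.integrable_const_bound[where B=1] AE_I2) auto

lemma moment_nonneg: "0 \<le> moment p j"
  unfolding moment_def using min_X_bounds by (intro integral_nonneg_AE AE_I2) auto

lemma nn_integral_min_F:
  assumes "a \<in> {1..A}"
  shows "(\<integral>\<^sup>+\<omega>. ennreal (min 1 (1 / F a j \<omega> ^ p)) \<partial>M) = ennreal (moment p j)"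
proof -
  have "(\<integral>\<^sup>+\<omega>. ennreal (min 1 (1 / F a j \<omega> ^ p)) \<partial>M) = (\<integral>\<^sup>+\<eta>. ennreal (min 1 (1 / X j \<eta> ^ p)) \<partial>N)"
    by (rule nn_integral_F[OF assms]) measurable
  also have "\<dots> = ennreal (moment p j)"
    unfolding moment_def using min_X_bounds by (intro nn_integral_eq_integral integrable_min_X AE_I2) auto
  finally show ?thesis .
qed

text \<open>On truncated terms, divergence of the means forces almost sure divergence of the series.
  So almost sure convergence of the random series is equivalent to a deterministic
  condition.\<close>

lemma AE_summable_X_iff:
  assumes "0 < p"
  shows "(AE \<eta> in N. summable (\<lambda>j. 1 / X j \<eta> ^ p)) \<longleftrightarrow> summable (moment p)"
proof -
  have ind: "law.indep_vars (\<lambda>_. borel) (\<lambda>j \<eta>. min 1 (1 / X j \<eta> ^ p)) UNIV"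
    by (rule law.indep_vars_compose2[OF law.X_indep]) measurable
  have iff: "summable (\<lambda>j. min 1 (1 / X j \<eta> ^ p)) \<longleftrightarrow> summable (\<lambda>j. 1 / X j \<eta> ^ p)" if "\<eta> \<in> space N" for \<eta>
    using law.X_pos[OF that] by (intro summable_min_one_iff) (auto intro: less_imp_le)
  have moment_eq: "moment p = (\<lambda>j. law.expectation (\<lambda>\<eta>. min 1 (1 / X j \<eta> ^ p)))"
    by (simp add: moment_def fun_eq_iff)
  show ?thesis
  proof
    assume "summable (moment p)"
    then have "AE \<eta> in N. summable (\<lambda>j. min 1 (1 / X j \<eta> ^ p))"
      unfolding moment_eq using min_X_bounds
      by (intro law.AE_summable_if_summable_expectation integrable_min_X) auto
    then show "AE \<eta> in N. summable (\<lambda>j. 1 / X j \<eta> ^ p)" by (rule AE_mp) (auto simp: iff)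
  next
    assume *: "AE \<eta> in N. summable (\<lambda>j. 1 / X j \<eta> ^ p)"
    show "summable (moment p)"
    proof (rule ccontr)
      assume "\<not> summable (moment p)"
      then have "AE \<eta> in N. \<not> summable (\<lambda>j. min 1 (1 / X j \<eta> ^ p))"
        unfolding moment_eq using min_X_bounds by (intro law.AE_not_summable_if_indep[OF ind]) auto
      with * AE_space have "AE \<eta> in N. False" by eventually_elim (simp add: iff)
      then show False using law.AE_False by simp
    qed
  qed
qed

text \<open>Integrating the clock first, given the feedback, leaves its moment
  \<open>1 + fact p\<close> as the constant. The absolute value is there because holding times are
  nonnegative only almost surely.\<close>

lemma expectation_hold_le:
  assumes a: "a \<in> {1..A}"
  shows "joint.expectation (\<lambda>z. min 1 (\<bar>hold (a, j) z\<bar> ^ p)) \<le> (1 + fact p) * moment p j"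
proof -
  have "ennreal (joint.expectation (\<lambda>z. min 1 (\<bar>hold (a, j) z\<bar> ^ p))) =
      (\<integral>\<^sup>+z. ennreal (min 1 (\<bar>hold (a, j) z\<bar> ^ p)) \<partial>joint)"
    by (intro nn_integral_eq_integral[symmetric] joint.integrable_const_bound[where B=1]) auto
  also have "\<dots> = (\<integral>\<^sup>+\<omega>. \<integral>\<^sup>+x. ennreal (min 1 (\<bar>x / F a j \<omega>\<bar> ^ p)) \<partial>clock \<partial>M)"
    by (rule nn_integral_hold[OF a, of "\<lambda>h. ennreal (min 1 (\<bar>h\<bar> ^ p))"]) measurable
  also have "\<dots> \<le> (\<integral>\<^sup>+\<omega>. \<integral>\<^sup>+x. ennreal (1 + x ^ p) * ennreal (min 1 (1 / F a j \<omega> ^ p)) \<partial>clock \<partial>M)"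
  proof (intro nn_integral_mono nn_integral_mono_AE, rule AE_mp[OF AE_clock_nonneg], intro AE_I2 impI)
    fix \<omega> and x :: real assume "\<omega> \<in> space M" "0 \<le> x"
    moreover from this have "0 < F a j \<omega>" using F_pos[OF a] by blast
    ultimately have "ennreal (min 1 (\<bar>x / F a j \<omega>\<bar> ^ p)) \<le> ennreal ((1 + x ^ p) * min 1 (1 / F a j \<omega> ^ p))"
      using min_one_scaled_le[of x "F a j \<omega>" p] by (intro ennreal_leI) simp
    also have "\<dots> = ennreal (1 + x ^ p) * ennreal (min 1 (1 / F a j \<omega> ^ p))"
      using \<open>0 \<le> x\<close> by (intro ennreal_mult') simp
    finally show "ennreal (min 1 (\<bar>x / F a j \<omega>\<bar> ^ p)) \<le> ennreal (1 + x ^ p) * ennreal (min 1 (1 / F a j \<omega> ^ p))" .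
  qed
  also have "\<dots> = (\<integral>\<^sup>+\<omega>. ennreal (1 + fact p) * ennreal (min 1 (1 / F a j \<omega> ^ p)) \<partial>M)"
    by (intro nn_integral_cong, subst nn_integral_multc)
      (auto simp: nn_integral_clock_moment measurable_cong_sets[OF sets_clock refl])
  also have "\<dots> = ennreal (1 + fact p) * ennreal (moment p j)"
    using F_measurable[OF a] by (subst nn_integral_cmult) (auto simp: nn_integral_min_F[OF a])
  also have "\<dots> = ennreal ((1 + fact p) * moment p j)"
    by (rule ennreal_mult'[symmetric]) simp
  finally show ?thesis
    using moment_nonneg by (subst (asm) ennreal_le_iff) (auto intro: mult_nonneg_nonneg)
qed

text \<open>The constant \<open>exp (- 1)\<close> is the probability that the clock is at least
  1.\<close>

lemma expectation_hold_ge: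
  assumes a: "a \<in> {1..A}"
  shows "exp (- 1) * moment p j \<le> joint.expectation (\<lambda>z. min 1 (\<bar>hold (a, j) z\<bar> ^ p))"
proof -
  have "ennreal (exp (- 1)) * ennreal (moment p j) =
      (\<integral>\<^sup>+\<omega>. ennreal (exp (- 1)) * ennreal (min 1 (1 / F a j \<omega> ^ p)) \<partial>M)"
    using F_measurable[OF a] by (subst nn_integral_cmult) (auto simp: nn_integral_min_F[OF a])
  also have "\<dots> = (\<integral>\<^sup>+\<omega>. \<integral>\<^sup>+x. indicator {1..} x * ennreal (min 1 (1 / F a j \<omega> ^ p)) \<partial>clock \<partial>M)"
    by (intro nn_integral_cong, subst nn_integral_multc)
      (use nn_integral_clock_ge[of 1] in \<open>auto simp: measurable_cong_sets[OF sets_clock refl]\<close>)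
  also have "\<dots> \<le> (\<integral>\<^sup>+\<omega>. \<integral>\<^sup>+x. ennreal (min 1 (\<bar>x / F a j \<omega>\<bar> ^ p)) \<partial>clock \<partial>M)"
  proof (intro nn_integral_mono nn_integral_mono_AE, rule AE_mp[OF AE_clock_nonneg], intro AE_I2 impI)
    fix \<omega> and x :: real assume "\<omega> \<in> space M" "0 \<le> x"
    moreover from this have "0 < F a j \<omega>" using F_pos[OF a] by blast
    ultimately show "indicator {1..} x * ennreal (min 1 (1 / F a j \<omega> ^ p)) \<le> ennreal (min 1 (\<bar>x / F a j \<omega>\<bar> ^ p))"
      using min_one_scaled_ge[of x "F a j \<omega>" p] by (auto simp: indicator_def ennreal_leI split: if_splits)
  qed
  also have "\<dots> = (\<integral>\<^sup>+z. ennreal (min 1 (\<bar>hold (a, j) z\<bar> ^ p)) \<partial>joint)"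
    by (rule nn_integral_hold[OF a, of "\<lambda>h. ennreal (min 1 (\<bar>h\<bar> ^ p))", symmetric]) measurable
  also have "\<dots> = ennreal (joint.expectation (\<lambda>z. min 1 (\<bar>hold (a, j) z\<bar> ^ p)))"
    by (intro nn_integral_eq_integral joint.integrable_const_bound[where B=1]) auto
  finally show ?thesis
    by (subst (asm) ennreal_mult'[symmetric]) (auto simp: ennreal_le_iff intro!: Bochner_Integration.integral_nonneg)
qed

definition gap :: "nat \<Rightarrow> nat \<Rightarrow> nat \<Rightarrow> 'w \<times> (nat \<times> nat \<Rightarrow> real) \<Rightarrow> real" where
  "gap a b j z = hold (a, j) z - hold (b, j) z"

lemma gap_measurable [measurable]: "gap a b j \<in> borel_measurable joint"
  unfolding gap_def[abs_def] by measurable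

text \<open>Given the feedback, ask that the urn with the smaller value has a clock of at least 1
  and the other a clock of at most 1/2. Which urn has which part depends on the feedback, but the
  probability of the event does not, and so it comes out as a constant. The factor 1/4 is the square
  of 1 - 1/2.\<close>

lemma expectation_gap_ge:
  assumes a: "a \<in> {1..A}" and b: "b \<in> {1..A}" and "a \<noteq> b"
  obtains c where "0 < c" "\<And>j. c * moment 2 j \<le> joint.expectation (\<lambda>z. min 1 ((gap a b j z)\<^sup>2))"
proof -
  define c1 where "c1 = (\<integral>\<^sup>+x. indicator {1 :: real..} x \<partial>clock)"
  define c2 where "c2 = (\<integral>\<^sup>+x. indicator {..1 / 2 :: real} x \<partial>clock)"
  interpret C: prob_space clock by (rule prob_space_clock)
  have c1: "c1 = ennreal (exp (- 1))" unfolding c1_def by (rule nn_integral_clock_ge) simp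
  have c2: "c2 = ennreal (C.prob {..1 / 2})" "0 < C.prob {..1 / 2}"
    using nn_integral_clock_le_pos[of "1 / 2"] by (auto simp: c2_def C.emeasure_eq_measure)
  define c where "c = 1 / 4 * (exp (- 1) * C.prob {..1 / 2})"
  have "0 < c" using c2(2) by (simp add: c_def)
  moreover have "c * moment 2 j \<le> joint.expectation (\<lambda>z. min 1 ((gap a b j z)\<^sup>2))" for j
  proof -
    define G where "G x y = (indicator {1 :: real..} x * indicator {..1 / 2 :: real} y :: ennreal)" for x y
    have G: "(\<integral>\<^sup>+e. G (e i) (e i') \<partial>clocks) = c1 * c2" if "i \<noteq> i'" for i i'
      using nn_integral_clocks_prod[of "{i, i'}" "\<lambda>k. if k = i then indicator {1..} else indicator {..1 / 2}"] that
      by (simp add: G_def c1_def c2_def)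
    have Gm [measurable]: "(\<lambda>e. G (e i) (e i')) \<in> borel_measurable clocks" for i i'
      unfolding G_def by measurable
    have "ennreal c * ennreal (moment 2 j) =
        (\<integral>\<^sup>+\<omega>. ennreal c * ennreal (min 1 (1 / (F a j \<omega>)\<^sup>2)) \<partial>M)"
      using F_measurable[OF a] by (subst nn_integral_cmult) (auto simp: nn_integral_min_F[OF a])
    also have "\<dots> = (\<integral>\<^sup>+\<omega>. \<integral>\<^sup>+e. ennreal (1 / 4 * min 1 (1 / (F a j \<omega>)\<^sup>2)) *
        (if F a j \<omega> \<le> F b j \<omega> then G (e (a, j)) (e (b, j)) else G (e (b, j)) (e (a, j))) \<partial>clocks \<partial>M)"
    proof (intro nn_integral_cong)
      fix \<omega> assume "\<omega> \<in> space M"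
      have "(\<integral>\<^sup>+e. ennreal (1 / 4 * min 1 (1 / (F a j \<omega>)\<^sup>2)) *
        (if F a j \<omega> \<le> F b j \<omega> then G (e (a, j)) (e (b, j)) else G (e (b, j)) (e (a, j))) \<partial>clocks)
        = ennreal (1 / 4 * min 1 (1 / (F a j \<omega>)\<^sup>2)) * (c1 * c2)"
        using \<open>a \<noteq> b\<close> by (cases "F a j \<omega> \<le> F b j \<omega>") (simp_all add: nn_integral_cmult G)
      also have "\<dots> = ennreal c * ennreal (min 1 (1 / (F a j \<omega>)\<^sup>2))"
        unfolding c1 c2(1) c_def by (simp flip: ennreal_mult' add: mult_ac)
      finally show "ennreal c * ennreal (min 1 (1 / (F a j \<omega>)\<^sup>2)) = (\<integral>\<^sup>+e. ennreal (1 / 4 * min 1 (1 / (F a j \<omega>)\<^sup>2)) *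
        (if F a j \<omega> \<le> F b j \<omega> then G (e (a, j)) (e (b, j)) else G (e (b, j)) (e (a, j))) \<partial>clocks)" by simp
    qed
    also have "\<dots> \<le> (\<integral>\<^sup>+\<omega>. \<integral>\<^sup>+e. ennreal (min 1 ((gap a b j (\<omega>, e))\<^sup>2)) \<partial>clocks \<partial>M)"
    proof (intro nn_integral_mono nn_integral_mono_AE, rule AE_mp[OF AE_clocks_nonneg], intro AE_I2 impI)
      fix \<omega> and e :: "nat \<times> nat \<Rightarrow> real" assume "\<omega> \<in> space M" "\<forall>i. 0 \<le> e i"
      then have pos: "0 \<le> e (a, j)" "0 \<le> e (b, j)" "0 < F a j \<omega>" "0 < F b j \<omega>"
        using F_pos[OF a] F_pos[OF b] by auto
      have gap: "gap a b j (\<omega>, e) = e (a, j) / F a j \<omega> - e (b, j) / F b j \<omega>"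
        using a b by (simp add: gap_def hold_def rate_def)
      have "ennreal (1 / 4 * min 1 (1 / (F a j \<omega>)\<^sup>2)) *
        (if F a j \<omega> \<le> F b j \<omega> then G (e (a, j)) (e (b, j)) else G (e (b, j)) (e (a, j)))
        = ennreal (1 / 4 * min 1 (1 / (F a j \<omega>)\<^sup>2) * (if F a j \<omega> \<le> F b j \<omega>
          then indicator {1..} (e (a, j)) * indicator {..1 / 2} (e (b, j))
          else indicator {1..} (e (b, j)) * indicator {..1 / 2} (e (a, j))))"
        by (simp add: G_def indicator_def)
      also have "\<dots> \<le> ennreal (min 1 ((gap a b j (\<omega>, e))\<^sup>2))"
        unfolding gap by (intro ennreal_leI min_one_diff_square_ge pos)
      finally show "ennreal (1 / 4 * min 1 (1 / (F a j \<omega>)\<^sup>2)) *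
        (if F a j \<omega> \<le> F b j \<omega> then G (e (a, j)) (e (b, j)) else G (e (b, j)) (e (a, j)))
        \<le> ennreal (min 1 ((gap a b j (\<omega>, e))\<^sup>2))" .
    qed
    also have "\<dots> = (\<integral>\<^sup>+z. ennreal (min 1 ((gap a b j z)\<^sup>2)) \<partial>joint)"
      by (rule nn_integral_joint[symmetric]) measurable
    also have "\<dots> = ennreal (joint.expectation (\<lambda>z. min 1 ((gap a b j z)\<^sup>2)))"
      by (intro nn_integral_eq_integral joint.integrable_const_bound[where B=1]) auto
    finally show ?thesis
      using \<open>0 < c\<close> by (subst (asm) ennreal_mult'[symmetric])
        (auto simp: ennreal_le_iff intro!: Bochner_Integration.integral_nonneg)
  qed
  ultimately show thesis by (rule that)
qed

lemma hold_law:
  assumes "a \<in> {1..A}" "b \<in> {1..A}"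
  shows "distr joint borel (hold (a, j)) = distr joint borel (hold (b, j))"
proof (rule measure_eqI)
  interpret C: prob_space clock by (rule prob_space_clock)
  fix B assume "B \<in> sets (distr joint borel (hold (a, j)))"
  then have B [measurable]: "B \<in> sets borel" by simp
  define k where "k r = (\<integral>\<^sup>+x. indicator B (x / r) \<partial>clock)" for r :: real
  have "(\<lambda>(r, x). indicator B (x / r) :: ennreal) \<in> borel_measurable (borel \<Otimes>\<^sub>M clock)" by measurable
  from C.borel_measurable_nn_integral[OF this] have k: "k \<in> borel_measurable borel" unfolding k_def[abs_def] .
  have "emeasure (distr joint borel (hold (c, j))) B = (\<integral>\<^sup>+\<eta>. k (X j \<eta>) \<partial>N)" if c: "c \<in> {1..A}" for c
  proof -
    have "emeasure (distr joint borel (hold (c, j))) B = (\<integral>\<^sup>+z. indicator B (hold (c, j) z) \<partial>joint)"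
      by (subst nn_integral_distr[symmetric, OF hold_measurable]) simp_all
    also have "\<dots> = (\<integral>\<^sup>+\<omega>. k (F c j \<omega>) \<partial>M)"
      unfolding k_def by (rule nn_integral_hold[OF c]) simp
    also have "\<dots> = (\<integral>\<^sup>+\<eta>. k (X j \<eta>) \<partial>N)" by (rule nn_integral_F[OF c k])
    finally show ?thesis .
  qed
  then show "emeasure (distr joint borel (hold (a, j))) B = emeasure (distr joint borel (hold (b, j))) B"
    using assms by simp
qed simp

text \<open>The holding times of two urns at the same size are independent with a common law.
  Exchanging them preserves their joint law and reverses the sign of the difference.\<close>

lemma gap_symmetric:
  assumes a: "a \<in> {1..A}" and b: "b \<in> {1..A}" and "a \<noteq> b"
  shows "distr joint borel (\<lambda>z. - gap a b j z) = distr joint borel (gap a b j)"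
proof -
  have law: "distr joint borel (gap x y j) =
      distr (distr joint borel (hold (x, j)) \<Otimes>\<^sub>M distr joint borel (hold (y, j))) borel (\<lambda>(s, t). s - t)"
    if "x \<in> {1..A}" "y \<in> {1..A}" "x \<noteq> y" for x y
  proof -
    have "joint.indep_var borel ((\<lambda>f. f (x, j)) \<circ> (\<lambda>z. \<lambda>i\<in>{(x, j)}. hold i z))
        borel ((\<lambda>f. f (y, j)) \<circ> (\<lambda>z. \<lambda>i\<in>{(y, j)}. hold i z))"
      using that by (intro joint.indep_var_compose[OF joint.indep_var_restrict[OF indep_hold]]) auto
    then have "joint.indep_var borel (hold (x, j)) borel (hold (y, j))" by (simp add: comp_def)
    then have "distr joint borel (hold (x, j)) \<Otimes>\<^sub>M distr joint borel (hold (y, j)) =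
        distr joint (borel \<Otimes>\<^sub>M borel) (\<lambda>z. (hold (x, j) z, hold (y, j) z))"
      by (simp add: joint.indep_var_distribution_eq)
    then show ?thesis
      by (simp add: distr_distr comp_def gap_def[abs_def])
  qed
  have "(\<lambda>z. - gap a b j z) = gap b a j" by (simp add: gap_def fun_eq_iff)
  then show ?thesis
    using law[OF a b] law[OF b a] hold_law[OF a b, of j] \<open>a \<noteq> b\<close> by simp
qed

lemma indep_gap:
  assumes a: "a \<in> {1..A}" and b: "b \<in> {1..A}"
  shows "joint.indep_vars (\<lambda>_. borel) (gap a b) UNIV"
proof -
  have "joint.indep_vars (\<lambda>j. PiM {(a, j), (b, j)} (\<lambda>_. borel)) (\<lambda>j z. \<lambda>i\<in>{(a, j), (b, j)}. hold i z) UNIV"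
    using a b by (intro joint.indep_vars_restrict[OF indep_hold]) (auto simp: disjoint_family_on_def)
  from joint.indep_vars_compose2[OF this, of "\<lambda>j f. f (a, j) - f (b, j)" "\<lambda>_. borel"]
  show ?thesis by (simp add: gap_def[abs_def])
qed

lemma indep_hold_urn:
  assumes "a \<in> {1..A}"
  shows "joint.indep_vars (\<lambda>_. borel) (\<lambda>j. hold (a, j)) UNIV"
proof -
  have "joint.indep_vars (\<lambda>j. PiM {(a, j)} (\<lambda>_. borel)) (\<lambda>j z. \<lambda>i\<in>{(a, j)}. hold i z) UNIV"
    using assms by (intro joint.indep_vars_restrict[OF indep_hold]) (auto simp: disjoint_family_on_def)
  from joint.indep_vars_compose2[OF this, of "\<lambda>j f. f (a, j)" "\<lambda>_. borel"]
  show ?thesis by simp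
qed

lemma AE_summable_hold:
  assumes a: "a \<in> {1..A}" and s: "summable (moment p)"
  shows "AE z in joint. summable (\<lambda>j. \<bar>hold (a, j) z\<bar> ^ p)"
proof -
  have "AE z in joint. summable (\<lambda>j. min 1 (\<bar>hold (a, j) z\<bar> ^ p))"
  proof (rule joint.AE_summable_if_summable_expectation)
    show "summable (\<lambda>j. joint.expectation (\<lambda>z. min 1 (\<bar>hold (a, j) z\<bar> ^ p)))"
      by (rule summable_comparison_test'[OF summable_mult[OF s, of "1 + fact p"]])
        (use expectation_hold_le[OF a] in \<open>auto simp: abs_of_nonneg Bochner_Integration.integral_nonneg\<close>)
  qed (auto intro!: joint.integrable_const_bound[where B=1])
  then show ?thesis by (rule AE_mp) (simp add: summable_min_one_iff)
qed

lemma AE_not_summable_hold: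
  assumes a: "a \<in> {1..A}" and ns: "\<not> summable (moment 1)"
  shows "AE z in joint. \<not> summable (\<lambda>j. \<bar>hold (a, j) z\<bar>)"
proof -
  have "AE z in joint. \<not> summable (\<lambda>j. min 1 \<bar>hold (a, j) z\<bar>)"
  proof (rule joint.AE_not_summable_if_indep)
    show "joint.indep_vars (\<lambda>_. borel) (\<lambda>j z. min 1 \<bar>hold (a, j) z\<bar>) UNIV"
      by (rule joint.indep_vars_compose2[OF indep_hold_urn[OF a]]) measurable
    show "\<not> summable (\<lambda>j. joint.expectation (\<lambda>z. min 1 \<bar>hold (a, j) z\<bar>))"
    proof
      assume s: "summable (\<lambda>j. joint.expectation (\<lambda>z. min 1 \<bar>hold (a, j) z\<bar>))"
      have "summable (moment 1)"
      proof (rule summable_comparison_test'[OF summable_mult[OF s, of "exp 1"]])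
        fix j
        have "exp 1 * (exp (- 1) * moment 1 j) \<le> exp 1 * joint.expectation (\<lambda>z. min 1 \<bar>hold (a, j) z\<bar>)"
          using expectation_hold_ge[OF a, of 1 j] by (intro mult_left_mono) auto
        then show "norm (moment 1 j) \<le> exp 1 * joint.expectation (\<lambda>z. min 1 \<bar>hold (a, j) z\<bar>)"
          using moment_nonneg[of 1 j] by (simp add: mult.assoc[symmetric] mult_exp_exp)
      qed
      with ns show False by simp
    qed
  qed auto
  then show ?thesis by (rule AE_mp) (simp add: summable_min_one_iff)
qed

lemma AE_convergent_gap:
  assumes a: "a \<in> {1..A}" and b: "b \<in> {1..A}" and s: "summable (moment 2)"
  shows "AE z in joint. convergent (\<lambda>n. \<Sum>j<n. gap a b j z)"
proof (cases "a = b")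
  case True
  then show ?thesis by (simp add: gap_def convergent_const)
next
  case False
  show ?thesis
  proof (rule joint.AE_convergent_if_symmetric[OF indep_gap[OF a b] gap_symmetric[OF a b False]])
    show "summable (\<lambda>j. joint.expectation (\<lambda>z. min 1 ((gap a b j z)\<^sup>2)))"
    proof (rule summable_comparison_test'[OF summable_mult[OF s, of "2 * (1 + fact 2)"]])
      fix j
      have int: "integrable joint (\<lambda>z. min 1 (f z ^ 2))" if [measurable]: "f \<in> borel_measurable joint"
        for f :: "_ \<Rightarrow> real"
        by (rule joint.integrable_const_bound[where B=1]) auto
      have "joint.expectation (\<lambda>z. min 1 ((gap a b j z)\<^sup>2)) \<le>
          joint.expectation (\<lambda>z. min 1 (\<bar>hold (a, j) z\<bar>\<^sup>2) + min 1 (\<bar>hold (b, j) z\<bar>\<^sup>2))"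
      proof (intro integral_mono_AE int Bochner_Integration.integrable_add)
        show "AE z in joint. min 1 ((gap a b j z)\<^sup>2) \<le> min 1 (\<bar>hold (a, j) z\<bar>\<^sup>2) + min 1 (\<bar>hold (b, j) z\<bar>\<^sup>2)"
          using AE_hold_nonneg by eventually_elim (simp add: gap_def min_one_diff_square_le)
      qed measurable
      also have "\<dots> = joint.expectation (\<lambda>z. min 1 (\<bar>hold (a, j) z\<bar>\<^sup>2)) + joint.expectation (\<lambda>z. min 1 (\<bar>hold (b, j) z\<bar>\<^sup>2))"
        by (intro Bochner_Integration.integral_add int) measurable
      also have "\<dots> \<le> 2 * (1 + fact 2) * moment 2 j"
        using expectation_hold_le[OF a, of j 2] expectation_hold_le[OF b, of j 2] by simp
      finally show "norm (joint.expectation (\<lambda>z. min 1 ((gap a b j z)\<^sup>2))) \<le> 2 * (1 + fact 2) * moment 2 j"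
        by (simp add: abs_of_nonneg Bochner_Integration.integral_nonneg)
    qed
  qed
qed

lemma AE_unbounded_gap:
  assumes a: "a \<in> {1..A}" and b: "b \<in> {1..A}" and ab: "a \<noteq> b" and ns: "\<not> summable (moment 2)"
  shows "AE z in joint. \<forall>K::nat. \<exists>n. real K < (\<Sum>j<n. gap a b j z)"
proof (rule joint.AE_unbounded_if_symmetric[OF indep_gap[OF a b] gap_symmetric[OF a b ab]])
  obtain c where c: "0 < c" "\<And>j. c * moment 2 j \<le> joint.expectation (\<lambda>z. min 1 ((gap a b j z)\<^sup>2))"
    using expectation_gap_ge[OF a b ab] by blast
  show "\<not> summable (\<lambda>j. joint.expectation (\<lambda>z. min 1 ((gap a b j z)\<^sup>2)))"
  proof
    assume "summable (\<lambda>j. joint.expectation (\<lambda>z. min 1 ((gap a b j z)\<^sup>2)))"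
    then have "summable (\<lambda>j. c * moment 2 j)"
      by (rule summable_comparison_test'[of _ 0]) (use c moment_nonneg in auto)
    then have "summable (moment 2)" using c(1) by (subst (asm) summable_cmult_iff) simp
    with ns show False by simp
  qed
qed

lemma moment_2_le_1: "moment 2 j \<le> moment 1 j"
  unfolding moment_def
proof (intro integral_mono integrable_min_X)
  fix \<eta> assume "\<eta> \<in> space N"
  then have pos: "0 < X j \<eta>" by (rule law.X_pos)
  show "min 1 (1 / (X j \<eta>)\<^sup>2) \<le> min 1 (1 / X j \<eta> ^ 1)"
  proof (cases "1 \<le> X j \<eta>")
    case True
    then have "X j \<eta> ^ 1 \<le> (X j \<eta>)\<^sup>2" by (intro power_increasing) auto
    then have "1 / (X j \<eta>)\<^sup>2 \<le> 1 / X j \<eta> ^ 1" using pos by (intro divide_left_mono) auto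
    then show ?thesis by auto
  qed (use pos in simp)
qed

text \<open>In contrapositive form: when leadership is to be refuted, the first moments diverge as
  well, so all urns grow beyond every bound.\<close>

lemma summable_moment_2: "summable (moment 1) \<Longrightarrow> summable (moment 2)"
  by (rule summable_comparison_test'[of _ 0]) (use moment_nonneg moment_2_le_1 in auto)

section \<open>Almost sure fate of the race and its transfer to the urns\<close>

abbreviation run :: "'w \<times> (nat \<times> nat \<Rightarrow> real) \<Rightarrow> nat \<Rightarrow> nat" where
  "run z \<equiv> race A u0 (\<lambda>i. hold i z)"

lemma urn_race_run:
  assumes "\<forall>i. 0 \<le> hold i z"
  shows "urn_race A u0 (\<lambda>i. hold i z) (run z)"
proof
  show "0 \<le> hold i z" for i using assms by blast
  show "run z k \<in> {1..A}" for k using two_urns by (intro race_in) simp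
qed (rule race_order, use two_urns assms in auto)

lemma AE_all_pairs:
  assumes "\<And>a b. a \<in> {1..A} \<Longrightarrow> b \<in> {1..A} \<Longrightarrow> AE z in joint. R a b z"
  shows "AE z in joint. \<forall>a\<in>{1..A}. \<forall>b\<in>{1..A}. R a b z"
  using assms by (intro AE_finite_allI) auto

lemma AE_ties: "AE z in joint. \<forall>a\<in>{1..A}. \<forall>b\<in>{1..A}. a \<noteq> b \<longrightarrow>
    \<not> (\<lambda>l. (\<Sum>j=u0 a..l. hold (a, j) z) - (\<Sum>j=u0 b..l. hold (b, j) z)) \<longlonglongrightarrow> 0"
proof (rule AE_all_pairs)
  fix a b assume "a \<in> {1..A}" "b \<in> {1..A}"
  then show "AE z in joint. a \<noteq> b \<longrightarrow>
    \<not> (\<lambda>l. (\<Sum>j=u0 a..l. hold (a, j) z) - (\<Sum>j=u0 b..l. hold (b, j) z)) \<longlonglongrightarrow> 0"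
    using AE_no_tie[of a b] by (cases "a = b") simp_all
qed

lemma AE_monopoly:
  assumes "summable (moment 1)"
  shows "AE z in joint. monopoly A (urn_count u0 (run z))"
proof -
  have "AE z in joint. \<forall>a\<in>{1..A}. summable (\<lambda>j. \<bar>hold (a, j) z\<bar> ^ 1)"
    using assms by (intro AE_finite_allI AE_summable_hold) auto
  with AE_ties AE_hold_nonneg show ?thesis
  proof eventually_elim
    case (elim z)
    interpret urn_race A u0 "\<lambda>i. hold i z" "run z" by (rule urn_race_run[OF elim(2)])
    show ?case
      by (rule monopoly_if_summable) (use elim in \<open>auto simp: exit_time_def\<close>)
  qed
qed

lemma AE_all_at_top:
  assumes "\<not> summable (moment 1)"
  shows "AE z in joint. \<forall>a\<in>{1..A}. filterlim (urn_count u0 (run z) a) at_top sequentially"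
proof -
  have "AE z in joint. \<forall>a\<in>{1..A}. \<not> summable (\<lambda>j. \<bar>hold (a, j) z\<bar>)"
    using assms by (intro AE_finite_allI AE_not_summable_hold) auto
  with AE_hold_nonneg show ?thesis
  proof eventually_elim
    case (elim z)
    interpret urn_race A u0 "\<lambda>i. hold i z" "run z" by (rule urn_race_run[OF elim(1)])
    show ?case
      by (intro ballI all_at_top) (use elim in auto)
  qed
qed

lemma AE_not_monopoly:
  assumes "\<not> summable (moment 1)"
  shows "AE z in joint. \<not> monopoly A (urn_count u0 (run z))"
  using AE_all_at_top[OF assms]
proof eventually_elim
  case (elim z)
  have "1 \<in> {1..A}" "2 \<in> {1..A}" using two_urns by auto
  with elim have "filterlim (urn_count u0 (run z) 1) at_top sequentially"
    "filterlim (urn_count u0 (run z) 2) at_top sequentially" by blast+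
  with \<open>1 \<in> {1..A}\<close> \<open>2 \<in> {1..A}\<close> have "1 = (2::nat)" if "monopoly A (urn_count u0 (run z))"
    using that unfolding monopoly_def by blast
  then show ?case by auto
qed

text \<open>A monopoly gives a leader at once. If the first moments diverge instead, all urns grow
  beyond every bound, which is the setting in which limits of exit time differences single out a
  leader.\<close>

lemma AE_strict_leadership:
  assumes s: "summable (moment 2)"
  shows "AE z in joint. strict_leadership A (urn_count u0 (run z))"
proof (cases "summable (moment 1)")
  case True
  from AE_monopoly[OF True] AE_hold_nonneg show ?thesis
  proof eventually_elim
    case (elim z)
    interpret urn_race A u0 "\<lambda>i. hold i z" "run z" by (rule urn_race_run[OF elim(2)])
    show ?case by (rule strict_leadership_if_monopoly[OF elim(1)])
  qed
next
  case False
  have "AE z in joint. \<forall>a\<in>{1..A}. summable (\<lambda>j. \<bar>hold (a, j) z\<bar> ^ 2)"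
    using s by (intro AE_finite_allI AE_summable_hold) auto
  moreover have "AE z in joint. \<forall>a\<in>{1..A}. \<forall>b\<in>{1..A}. convergent (\<lambda>n. \<Sum>j<n. gap a b j z)"
    using s by (intro AE_all_pairs AE_convergent_gap)
  ultimately show ?thesis
    using AE_all_at_top[OF False] AE_ties AE_hold_nonneg
  proof eventually_elim
    case (elim z)
    interpret urn_race A u0 "\<lambda>i. hold i z" "run z" by (rule urn_race_run[OF elim(5)])
    show ?case
    proof (rule strict_leadership_if_convergent)
      show "(\<lambda>j. hold (a, j) z) \<longlonglongrightarrow> 0" if "a \<in> {1..A}" for a
      proof -
        have "(\<lambda>j. \<bar>hold (a, j) z\<bar>\<^sup>2) \<longlonglongrightarrow> 0"
          using elim(1) that by (intro summable_LIMSEQ_zero) blast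
        then have "(\<lambda>j. sqrt ((hold (a, j) z)\<^sup>2)) \<longlonglongrightarrow> sqrt 0"
          by (intro tendsto_real_sqrt) simp
        then show ?thesis by (simp add: tendsto_rabs_zero_iff)
      qed
      show "convergent (\<lambda>l. exit_time a l - exit_time b l)" if "a \<in> {1..A}" "b \<in> {1..A}" for a b
        using elim(2) that by (intro convergent_exit_time_diff) (simp add: gap_def)
    qed (use elim in \<open>auto simp: exit_time_def\<close>)
  qed
qed

text \<open>Unboundedness above is applied to every ordered pair of urns, so each urn of a pair is
  late against the other for arbitrarily large sizes, and neither can lead for ever.\<close>

lemma AE_not_strict_leadership:
  assumes ns: "\<not> summable (moment 2)"
  shows "AE z in joint. \<not> strict_leadership A (urn_count u0 (run z))"
proof -
  have "AE z in joint. \<forall>a\<in>{1..A}. \<forall>b\<in>{1..A}. a \<noteq> b \<longrightarrow> (\<forall>K::nat. \<exists>n. real K < (\<Sum>j<n. gap a b j z))"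
  proof (rule AE_all_pairs)
    fix a b assume "a \<in> {1..A}" "b \<in> {1..A}"
    then show "AE z in joint. a \<noteq> b \<longrightarrow> (\<forall>K::nat. \<exists>n. real K < (\<Sum>j<n. gap a b j z))"
      using AE_unbounded_gap[of a b] ns by (cases "a = b") simp_all
  qed
  moreover have "\<not> summable (moment 1)" using ns summable_moment_2 by blast
  note AE_all_at_top[OF this]
  ultimately show ?thesis
    using AE_hold_nonneg
  proof eventually_elim
    case (elim z)
    interpret urn_race A u0 "\<lambda>i. hold i z" "run z" by (rule urn_race_run[OF elim(3)])
    show ?case
    proof (rule no_strict_leadership[OF two_urns])
      show "\<exists>l\<ge>m. exit_time b l < exit_time a l" if "a \<in> {1..A}" "b \<in> {1..A}" "a \<noteq> b" for a b m
        using elim(1) that by (intro exit_time_oscillation) (simp add: gap_def)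
    qed (use elim in auto)
  qed
qed

text \<open>The sizes \<open>u a\<close> are tied to the selections only for actual urns, hence the
  congruence condition on \<open>Q\<close>.\<close>

lemma prob_by_race:
  assumes Q: "Measurable.pred (PiM UNIV (\<lambda>_. count_space UNIV)) (\<lambda>c. Q (urn_count u0 c))"
    and cong: "\<And>v v'. (\<And>a. a \<in> {1..A} \<Longrightarrow> v a = v' a) \<Longrightarrow> Q v \<longleftrightarrow> Q v'"
  shows prob_eq_1_by_race: "AE z in joint. Q (urn_count u0 (run z)) \<Longrightarrow> \<P>(\<omega> in M. Q (\<lambda>a n. u a n \<omega>)) = 1"
    and prob_eq_0_by_race: "AE z in joint. \<not> Q (urn_count u0 (run z)) \<Longrightarrow> \<P>(\<omega> in M. Q (\<lambda>a n. u a n \<omega>)) = 0"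
proof -
  have "\<P>(\<omega> in M. Q (\<lambda>a n. u a n \<omega>)) = \<P>(\<omega> in M. Q (urn_count u0 (\<lambda>k. selected k \<omega>)))"
  proof (intro arg_cong[where f=prob] Collect_cong conj_cong refl cong)
    fix \<omega> a assume "\<omega> \<in> space M" "a \<in> {1..A}"
    then show "(\<lambda>n. u a n \<omega>) = urn_count u0 (\<lambda>k. selected k \<omega>) a" by (simp add: u_eq_urn_count fun_eq_iff)
  qed
  also have "\<dots> = \<P>(z in joint. Q (urn_count u0 (run z)))"
    using two_urns by (intro prob_transfer[OF _ Q]) simp
  finally have eq: "\<P>(\<omega> in M. Q (\<lambda>a n. u a n \<omega>)) = \<P>(z in joint. Q (urn_count u0 (run z)))" .
  have "run \<in> joint \<rightarrow>\<^sub>M PiM UNIV (\<lambda>_. count_space UNIV)"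
    by (rule measurable_PiM_single') (auto intro: race_measurable)
  from measurable_compose[OF this Q] have ev: "{z \<in> space joint. Q (urn_count u0 (run z))} \<in> sets joint"
    by (simp only: pred_def)
  show "AE z in joint. Q (urn_count u0 (run z)) \<Longrightarrow> \<P>(\<omega> in M. Q (\<lambda>a n. u a n \<omega>)) = 1"
    unfolding eq using joint.prob_Collect_eq_1[OF ev] by blast
  show "AE z in joint. \<not> Q (urn_count u0 (run z)) \<Longrightarrow> \<P>(\<omega> in M. Q (\<lambda>a n. u a n \<omega>)) = 0"
    unfolding eq using joint.prob_Collect_eq_0[OF ev] by blast
qed

lemma prob_monopoly:
  "\<P>(\<omega> in M. monopoly A (\<lambda>a n. u a n \<omega>)) = (if summable (moment 1) then 1 else 0)"
  using prob_eq_1_by_race[OF pred_monopoly monopoly_cong AE_monopoly]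
    prob_eq_0_by_race[OF pred_monopoly monopoly_cong AE_not_monopoly] by simp

lemma prob_strict_leadership:
  "\<P>(\<omega> in M. strict_leadership A (\<lambda>a n. u a n \<omega>)) = (if summable (moment 2) then 1 else 0)"
  using prob_eq_1_by_race[OF pred_strict_leadership strict_leadership_cong AE_strict_leadership]
    prob_eq_0_by_race[OF pred_strict_leadership strict_leadership_cong AE_not_strict_leadership] by simp

end

theorem theorem1p10:
  fixes M :: "'w measure" and N :: "'v measure"
    and X :: "nat \<Rightarrow> 'v \<Rightarrow> real"
    and A :: nat and u0 :: "nat \<Rightarrow> nat"
    and F :: "nat \<Rightarrow> nat \<Rightarrow> 'w \<Rightarrow> real"
    and u :: "nat \<Rightarrow> nat \<Rightarrow> 'w \<Rightarrow> nat"
  assumes "2 \<le> A"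
    and "feedback_sequence N X"
    and "balls_in_bins M N X A u0 F u"
  shows "(\<P>(\<omega> in M. monopoly A (\<lambda>a n. u a n \<omega>)) = 0 \<or>
          \<P>(\<omega> in M. monopoly A (\<lambda>a n. u a n \<omega>)) = 1)
       \<and> (\<P>(\<omega> in M. monopoly A (\<lambda>a n. u a n \<omega>)) = 1 \<longleftrightarrow>
          (AE \<eta> in N. summable (\<lambda>j. 1 / X j \<eta>)))
       \<and> (\<P>(\<omega> in M. strict_leadership A (\<lambda>a n. u a n \<omega>)) = 0 \<or>
          \<P>(\<omega> in M. strict_leadership A (\<lambda>a n. u a n \<omega>)) = 1)
       \<and> (\<P>(\<omega> in M. strict_leadership A (\<lambda>a n. u a n \<omega>)) = 1 \<longleftrightarrow>
          (AE \<eta> in N. summable (\<lambda>j. 1 / (X j \<eta>)\<^sup>2)))"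
proof -
  interpret random_feedback_urns M N X A u0 F u
    using assms by (simp add: random_feedback_urns_def random_feedback_urns_axioms_def)
  show ?thesis
    using AE_summable_X_iff[of 1] AE_summable_X_iff[of 2]
    by (simp add: prob_monopoly prob_strict_leadership)
qed

end
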